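(* Let $p\ge2$ be an integer not divisible by $3$. Let $x,y\in\mathcal W^{(+)}_p$ and $\mu\in E_p$. Then $$\chi_x^{(p)}(\mu)\,\chi_y^{(p)}(\mu)=\sum_{z\in\mathcal W^{(+)}_p}{}^{(p)}N^z_{x,y}\,\chi_z^{(p)}(\mu),$$ where $${}^{(p)}N^z_{x,y}=\sum_{w'\in W^{[z]}_{(p)}}\det(\overline{w'})\,m^x_{w'zy^{-1}}=\sum_{w\in W^{[p]}}\det(\bar w)\,m^x_{zwy^{-1}}=\sum_{w\in W^{[p]}}\det(\bar w)\,N^{zw}_{x,y}.$$ Furthermore, for all $x,y,z\in\mathcal W^{(+)}_p$, $${}^{(p)}N^z_{x,y}={}^{(3p)}\bar N^{\iota(z)}_{\iota(x)\,\iota(y)}.$$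
   Context: Setting: $sl(3)$ with simple roots $\alpha_1,\alpha_2$, positive roots $\alpha_1,\alpha_2,\theta=\alpha_1+\alpha_2$, $\langle\alpha_i,\alpha_i\rangle=2$, root lattice $Q$, $Q^+=\mathbb Z_{\ge0}\alpha_1+\mathbb Z_{\ge0}\alpha_2$, weight lattice $P$, fundamental weights $\bar\Lambda_1,\bar\Lambda_2$, $\bar\rho=\bar\Lambda_1+\bar\Lambda_2$, dominant weights $P_+$; $P_+^k=\{\lambda\in P_+:\langle\lambda,\theta\rangle\le k\}$; triality $\tau(\lambda)=\langle\lambda,\alpha_1\rangle+2\langle\lambda,\alpha_2\rangle$ mod 3. $\overline W$ is the finite Weyl group, $\det(w)=\pm1$, shifted action $w\cdot\lambda=w(\lambda+\bar\rho)-\bar\rho$. $W=\overline W\ltimes t_Q$ is the affine Weyl group ($w\,t_\beta w^{-1}=t_{w(\beta)}$), each $y\in W$ being uniquely $y=\bar y\,t_{-\lambda}$, $\bar y\in\overline W$, $\lambda\in Q$; $y\mapsto\bar y$ is the horizontal projection. $\iota:W\to Q$, $\iota(\bar y\,t_{-\lambda})=3\lambda+\bar y^{-1}\cdot0$. For $w\in\overline W$ let $P_+^{(w)}=\{\lambda\in P_+:\langle\lambda,\alpha_i\rangle>0\text{ if }w(\alpha_i)<0\}$ and $P_{+,p}^{(w)}=\{\lambda\in P_+^{(w)}:\langle\lambda,\theta\rangle<p\text{ if }w(\theta)>0,\ \langle\lambda,\theta\rangle\le p\text{ if }w(\theta)<0\}$. Let $\mathcal W^{(+)}=\{\bar y\,t_{-\lambda}\in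 W:\lambda\in P_+^{(\bar y)}\cap Q\}$ and $\mathcal W^{(+)}_p=\{\bar y\,t_{-\lambda}\in W:\lambda\in P_{+,p}^{(\bar y)}\cap Q\}$. Let $W^{[p]}=\overline W\ltimes t_{pQ}\subset W$ and $W^{[z]}_{(p)}=zW^{[p]}z^{-1}$ (the affine Kac--Wakimoto group of $z$, denoted $W^{[z\cdot k\Lambda_0]}$ in the source, $k+3=3/p$). Let $K_\beta$ be the Kostant partition function of $sl(3)$ and $\bar m^\lambda_\nu=\sum_{w\in\overline W}\det(w)K_{w\cdot\lambda-\nu}$ for $\lambda,\nu\in P$ (the weight multiplicity of $\nu$ in the irreducible $sl(3)$-module of highest weight $\lambda$ if $\lambda\in P_+$). For $x\in\mathcal W^{(+)}$, $v\in W$ put $m^x_v=\bar m^{\iota(x)}_{\iota(v)}$. For $x,y,v\in\mathcal W^{(+)}$ put $N^v_{x,y}=\sum_{w\in\overline W}\det(w)\,m^x_{vwy^{-1}}$, and $N^v_{x,y}=0$ for $v\in W\setminus\mathcal W^{(+)}$. For a positive integer $h$, $\lambda,\mu\in P$: $\bar\chi^{(h)}_\lambda(\mu)=\sum_{\nu\in P}\bar m^\lambda_\nu\,e^{-\frac{2\pi i}{h}\langle\nu,\mu+\bar\rho\rangle}$. For $h\ge3$, ${}^{(h)}\bar N^\sigma_{\lambda\nu}$ ($\lambda,\nu,\sigma\in P_+^{h-3}$) are the structure constants of the integrable $\widehat{sl}(3)$ fusion algebra at shifted level $h$: $\bar\chi^{(h)}_\lambda(\mu)\bar\chi^{(h)}_\nu(\mu)=\sum_{\sigma\in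 P_+^{h-3}}{}^{(h)}\bar N^\sigma_{\lambda\nu}\bar\chi^{(h)}_\sigma(\mu)$ for all $\mu\in P_+^{h-3}$. One has $\iota(\mathcal W^{(+)}_p)\subset P_+^{3p-3}$. Let $E_p=\{\mu\in P_+:0\le\langle\mu,\alpha_i\rangle\le p-1,\ i=1,2\}$; for $\mu\in E_p$ put $\varepsilon(\mu)=1$ if $\langle\mu,\theta\rangle\le p-2$ and $\varepsilon(\mu)=-1$ otherwise, and $F(\mu)=\varepsilon(\mu)\sqrt{3+\bar\chi^{(p)}_{\bar\Lambda_1}(\mu)+\bar\chi^{(p)}_{\bar\Lambda_2}(\mu)}$ (nonnegative square root of a nonnegative real number). For $y=\bar y\,t_{-\lambda}\in\mathcal W_p^{(+)}$ and $\mu\in E_p$ the quantised character is $$\chi_y^{(p)}(\mu)=e^{-\frac{2\pi i p}{3}\tau(\mu)\tau(\lambda)}\Big(\bar\chi^{(p)}_{\lambda+\bar y^{-1}\cdot0}(\mu)+\bar\chi^{(p)}_{\lambda+\bar y^{-1}\cdot(-2\bar\Lambda_1)}(\mu)+\bar\chi^{(p)}_{\lambda+\bar y^{-1}\cdot(-2\bar\Lambda_2)}(\mu)+(F(\mu)+2)\big(\bar\chi^{(p)}_{\lambda+\bar y^{-1}\cdot(-\bar\rho)}(\mu)+\bar\chi^{(p)}_{\lambda+\bar y^{-1}\cdot(-\bar\Lambda_2)}(\mu)+\bar\chi^{(p)}_{\lambda+\bar y^{-1}\cdot(-\bar\Lambda_1)}(\mu)\big)\Big)$$ (the overall phase equals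 $1$ for $y\in\mathcal W^{(+)}_p$, since then $\tau(\lambda)=0$). *)

theory Defs
  imports "HOL-Analysis.Analysis"
begin

section \<open>The weight lattice and the finite Weyl group of \<open>sl(3)\<close>\<close>

text \<open>A weight is given by its Dynkin labels: \<open>(a, b)\<close> stands for \<open>a \<Lambda>\<^sub>1 + b \<Lambda>\<^sub>2\<close>, so that
  \<open>\<langle>(a, b), \<alpha>\<^sub>1\<rangle> = a\<close> and \<open>\<langle>(a, b), \<alpha>\<^sub>2\<rangle> = b\<close>, and the type is the whole weight lattice \<open>P\<close>.
  Addition and subtraction of weights are the componentwise ones of the product type.\<close>

type_synonym weight = "int \<times> int"

definition scale :: "int \<Rightarrow> weight \<Rightarrow> weight" where
  "scale n \<xi> = (n * fst \<xi>, n * snd \<xi>)"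

definition \<Lambda>\<^sub>1 :: weight where "\<Lambda>\<^sub>1 = (1, 0)"
definition \<Lambda>\<^sub>2 :: weight where "\<Lambda>\<^sub>2 = (0, 1)"
definition \<rho> :: weight where "\<rho> = \<Lambda>\<^sub>1 + \<Lambda>\<^sub>2"

text \<open>The simple roots are the rows of the Cartan matrix.\<close>

definition \<alpha>\<^sub>1 :: weight where "\<alpha>\<^sub>1 = (2, -1)"
definition \<alpha>\<^sub>2 :: weight where "\<alpha>\<^sub>2 = (-1, 2)"
definition \<theta> :: weight where "\<theta> = \<alpha>\<^sub>1 + \<alpha>\<^sub>2"

definition pos_roots :: "weight set" where "pos_roots = {\<alpha>\<^sub>1, \<alpha>\<^sub>2, \<theta>}"

definition root_lattice :: "weight set" where
  "root_lattice = {scale m \<alpha>\<^sub>1 + scale n \<alpha>\<^sub>2 |m n. True}"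

text \<open>The Gram matrix of the fundamental weights is the inverse of the Cartan matrix.\<close>

definition ip :: "weight \<Rightarrow> weight \<Rightarrow> real" where
  "ip \<xi> \<mu> = of_int (2 * fst \<xi> * fst \<mu> + fst \<xi> * snd \<mu> + snd \<xi> * fst \<mu> + 2 * snd \<xi> * snd \<mu>) / 3"

lemma ip_\<alpha>\<^sub>1: "ip \<xi> \<alpha>\<^sub>1 = of_int (fst \<xi>)"
  and ip_\<alpha>\<^sub>2: "ip \<xi> \<alpha>\<^sub>2 = of_int (snd \<xi>)"
  and ip_\<theta>: "ip \<xi> \<theta> = of_int (fst \<xi> + snd \<xi>)"
  by (simp_all add: ip_def \<alpha>\<^sub>1_def \<alpha>\<^sub>2_def \<theta>_def field_simps)

definition dominant :: "weight set" where
  "dominant = {\<xi>. ip \<xi> \<alpha>\<^sub>1 \<ge> 0 \<and> ip \<xi> \<alpha>\<^sub>2 \<ge> 0}"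

definition dominant_level :: "int \<Rightarrow> weight set" where
  "dominant_level k = {\<xi> \<in> dominant. ip \<xi> \<theta> \<le> of_int k}"

definition triality :: "weight \<Rightarrow> int" where
  "triality \<xi> = (fst \<xi> + 2 * snd \<xi>) mod 3"

definition s\<^sub>1 :: "weight \<Rightarrow> weight" where "s\<^sub>1 \<xi> = \<xi> - scale (fst \<xi>) \<alpha>\<^sub>1"
definition s\<^sub>2 :: "weight \<Rightarrow> weight" where "s\<^sub>2 \<xi> = \<xi> - scale (snd \<xi>) \<alpha>\<^sub>2"

inductive_set weyl :: "(weight \<Rightarrow> weight) set" where
  "id \<in> weyl"
| "w \<in> weyl \<Longrightarrow> s\<^sub>1 \<circ> w \<in> weyl"
| "w \<in> weyl \<Longrightarrow> s\<^sub>2 \<circ> w \<in> weyl"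

text \<open>Determinant of a linear map in the basis \<open>\<Lambda>\<^sub>1, \<Lambda>\<^sub>2\<close>.\<close>

definition wdet :: "(weight \<Rightarrow> weight) \<Rightarrow> int" where
  "wdet w = fst (w \<Lambda>\<^sub>1) * snd (w \<Lambda>\<^sub>2) - snd (w \<Lambda>\<^sub>1) * fst (w \<Lambda>\<^sub>2)"

definition shifted :: "(weight \<Rightarrow> weight) \<Rightarrow> weight \<Rightarrow> weight" where
  "shifted w \<xi> = w (\<xi> + \<rho>) - \<rho>"


section \<open>The affine Weyl group\<close>

text \<open>The semidirect product of the finite Weyl group and the translations \<open>t\<^sub>\<beta>\<close>, \<open>\<beta> \<in> Q\<close>, is
  realised faithfully as a group of affine transformations of \<open>P\<close>, with \<open>t\<^sub>\<beta>\<close> the translation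
  by \<open>\<beta>\<close>; the group operations are composition and \<^const>\<open>inv\<close>.\<close>

definition transl :: "weight \<Rightarrow> weight \<Rightarrow> weight" where
  "transl \<beta> = (\<lambda>\<mu>. \<mu> + \<beta>)"

definition affine_weyl :: "(weight \<Rightarrow> weight) set" where
  "affine_weyl = {w \<circ> transl \<beta> |w \<beta>. w \<in> weyl \<and> \<beta> \<in> root_lattice}"

text \<open>The components \<open>w\<close> and \<open>\<xi>\<close> of \<open>y = w t\<^bsub>-\<xi>\<^esub>\<close>; note the sign in the latter.\<close>

definition horiz :: "(weight \<Rightarrow> weight) \<Rightarrow> (weight \<Rightarrow> weight)" where
  "horiz y = (THE w. w \<in> weyl \<and> (\<exists>\<xi> \<in> root_lattice. y = w \<circ> transl (- \<xi>)))"

definition vert :: "(weight \<Rightarrow> weight) \<Rightarrow> weight" where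
  "vert y = (THE \<xi>. \<xi> \<in> root_lattice \<and> (\<exists>w \<in> weyl. y = w \<circ> transl (- \<xi>)))"

definition iota :: "(weight \<Rightarrow> weight) \<Rightarrow> weight" where
  "iota y = scale 3 (vert y) + shifted (inv (horiz y)) 0"

text \<open>For a root \<open>\<beta>\<close>, \<open>\<beta> > 0\<close> means \<open>\<beta> \<in> pos_roots\<close> and \<open>\<beta> < 0\<close> means \<open>- \<beta> \<in> pos_roots\<close>.\<close>

definition dominant_w :: "(weight \<Rightarrow> weight) \<Rightarrow> weight set" where
  "dominant_w w = {\<xi> \<in> dominant.
     (- w \<alpha>\<^sub>1 \<in> pos_roots \<longrightarrow> ip \<xi> \<alpha>\<^sub>1 > 0) \<and> (- w \<alpha>\<^sub>2 \<in> pos_roots \<longrightarrow> ip \<xi> \<alpha>\<^sub>2 > 0)}"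

definition dominant_wp :: "int \<Rightarrow> (weight \<Rightarrow> weight) \<Rightarrow> weight set" where
  "dominant_wp p w = {\<xi> \<in> dominant_w w.
     (w \<theta> \<in> pos_roots \<longrightarrow> ip \<xi> \<theta> < of_int p) \<and> (- w \<theta> \<in> pos_roots \<longrightarrow> ip \<xi> \<theta> \<le> of_int p)}"

definition W_plus :: "(weight \<Rightarrow> weight) set" where
  "W_plus = {y \<in> affine_weyl. vert y \<in> dominant_w (horiz y) \<inter> root_lattice}"

definition W_plus_p :: "int \<Rightarrow> (weight \<Rightarrow> weight) set" where
  "W_plus_p p = {y \<in> affine_weyl. vert y \<in> dominant_wp p (horiz y) \<inter> root_lattice}"

text \<open>The subgroup generated by the finite Weyl group and the translations by \<open>p Q\<close>, and its
  conjugate by \<open>z\<close>, the affine Kac--Wakimoto group of \<open>z\<close>.\<close>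

definition W_sub :: "int \<Rightarrow> (weight \<Rightarrow> weight) set" where
  "W_sub p = {w \<circ> transl (scale p \<beta>) |w \<beta>. w \<in> weyl \<and> \<beta> \<in> root_lattice}"

definition KW_group :: "int \<Rightarrow> (weight \<Rightarrow> weight) \<Rightarrow> (weight \<Rightarrow> weight) set" where
  "KW_group p z = {z \<circ> w \<circ> inv z |w. w \<in> W_sub p}"


section \<open>Multiplicities\<close>

definition kostant :: "weight \<Rightarrow> int" where
  "kostant \<beta> = int (card {(a, b, c).
     scale (int a) \<alpha>\<^sub>1 + scale (int b) \<alpha>\<^sub>2 + scale (int c) \<theta> = \<beta>})"

definition mbar :: "weight \<Rightarrow> weight \<Rightarrow> int" where
  "mbar \<xi> \<nu> = (\<Sum>w\<in>weyl. wdet w * kostant (shifted w \<xi> - \<nu>))"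

definition m_coeff :: "(weight \<Rightarrow> weight) \<Rightarrow> (weight \<Rightarrow> weight) \<Rightarrow> int" where
  "m_coeff x v = mbar (iota x) (iota v)"

text \<open>\<open>N_coeff x y v\<close> is \<open>N\<close> with lower indices \<open>x, y\<close> and upper index \<open>v\<close>.\<close>

definition N_coeff ::
    "(weight \<Rightarrow> weight) \<Rightarrow> (weight \<Rightarrow> weight) \<Rightarrow> (weight \<Rightarrow> weight) \<Rightarrow> int" where
  "N_coeff x y v =
     (if v \<in> W_plus then \<Sum>w\<in>weyl. wdet w * m_coeff x (v \<circ> w \<circ> inv y) else 0)"

text \<open>The sum ranges over an infinite group but only finitely many terms are nonzero.\<close>

definition Np_coeff ::
    "int \<Rightarrow> (weight \<Rightarrow> weight) \<Rightarrow> (weight \<Rightarrow> weight) \<Rightarrow> (weight \<Rightarrow> weight) \<Rightarrow> int" where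
  "Np_coeff p x y z =
     (\<Sum>\<^sub>\<infinity>w'\<in>KW_group p z. wdet (horiz w') * m_coeff x (w' \<circ> z \<circ> inv y))"


section \<open>Characters and fusion coefficients\<close>

text \<open>Only finitely many \<open>mbar \<xi> \<nu>\<close> are nonzero for given \<open>\<xi>\<close>.\<close>

definition chibar :: "int \<Rightarrow> weight \<Rightarrow> weight \<Rightarrow> complex" where
  "chibar h \<xi> \<mu> = (\<Sum>\<^sub>\<infinity>\<nu>\<in>UNIV.
     of_int (mbar \<xi> \<nu>) * exp (- (2 * of_real pi * \<i> / of_int h) * of_real (ip \<nu> (\<mu> + \<rho>))))"

text \<open>The structure constants of the integrable fusion algebra at shifted level \<open>h\<close>:
  \<open>fusion h \<xi> \<nu> \<sigma>\<close> has lower indices \<open>\<xi>, \<nu>\<close> and upper index \<open>\<sigma>\<close>. They are unique because the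
  functions \<open>chibar h \<sigma>\<close> are linearly independent on \<open>dominant_level (h - 3)\<close>; the first
  conjunct makes the description unambiguous outside the index set.\<close>

definition fusion :: "int \<Rightarrow> weight \<Rightarrow> weight \<Rightarrow> weight \<Rightarrow> complex" where
  "fusion h \<xi> \<nu> = (THE N.
     (\<forall>\<sigma>. \<sigma> \<notin> dominant_level (h - 3) \<longrightarrow> N \<sigma> = 0) \<and>
     (\<forall>\<mu> \<in> dominant_level (h - 3).
        chibar h \<xi> \<mu> * chibar h \<nu> \<mu> = (\<Sum>\<sigma>\<in>dominant_level (h - 3). N \<sigma> * chibar h \<sigma> \<mu>)))"

definition E_set :: "int \<Rightarrow> weight set" where
  "E_set p = {\<mu> \<in> dominant. 0 \<le> ip \<mu> \<alpha>\<^sub>1 \<and> ip \<mu> \<alpha>\<^sub>1 \<le> of_int (p - 1) \<and>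
                            0 \<le> ip \<mu> \<alpha>\<^sub>2 \<and> ip \<mu> \<alpha>\<^sub>2 \<le> of_int (p - 1)}"

definition eps :: "int \<Rightarrow> weight \<Rightarrow> complex" where
  "eps p \<mu> = (if ip \<mu> \<theta> \<le> of_int (p - 2) then 1 else -1)"

text \<open>The radicand is a nonnegative real, where \<^const>\<open>csqrt\<close> is the nonnegative square root.\<close>

definition F_fun :: "int \<Rightarrow> weight \<Rightarrow> complex" where
  "F_fun p \<mu> = eps p \<mu> * csqrt (3 + chibar p \<Lambda>\<^sub>1 \<mu> + chibar p \<Lambda>\<^sub>2 \<mu>)"

definition chi :: "int \<Rightarrow> (weight \<Rightarrow> weight) \<Rightarrow> weight \<Rightarrow> complex" where
  "chi p y \<mu> =
    (let \<xi> = vert y;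
         c = (\<lambda>\<beta>. chibar p (\<xi> + shifted (inv (horiz y)) \<beta>) \<mu>)
     in exp (- (2 * of_real pi * \<i> * of_int p / 3) * of_int (triality \<mu>) * of_int (triality \<xi>)) *
        (c 0 + c (scale (-2) \<Lambda>\<^sub>1) + c (scale (-2) \<Lambda>\<^sub>2)
         + (F_fun p \<mu> + 2) * (c (- \<rho>) + c (- \<Lambda>\<^sub>2) + c (- \<Lambda>\<^sub>1))))"

end

theory Submission
  imports Defs
begin

text \<open>An element \<open>y\<close> of the affine Weyl group is encoded by the weight
\<open>\<iota>(y) + \<rho> = 3 y\<^sup>-\<^sup>1(\<rho>/3)\<close>, the barycentre of an alcove in the picture scaled by \<open>3\<close>. These
barycentres are the points of the root lattice outside three times the weight lattice; joining
neighbours by roots, they form a honeycomb whose hexagons surround the points of \<open>3P\<close>. In these terms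
\<open>m\<close> with indices \<open>x\<close> and \<open>u y\<^sup>-\<^sup>1\<close> is the multiplicity of the weight \<open>\<iota>(u) - \<iota>(y)\<close> in the module of
highest weight \<open>\<iota>(x)\<close> (lemma \<open>m_coeff_center\<close>), and right multiplication by the translations
in \<open>p Q\<close> is translation of barycentres by \<open>3 p Q\<close>. All forms of the structure constant therefore are one
alternating sum of weight multiplicities over the affine Weyl group of level \<open>3 p\<close>, namely
\<open>affine_sum\<close>; this is the Kac--Walton expression for the fusion coefficients at shifted level \<open>3 p\<close>
(lemmas \<open>kac_walton\<close> and \<open>fusion_eq\<close>).

For the product of quantised characters fix \<open>\<mu>\<close> and let \<open>C(\<kappa>)\<close> be the character of highest weight
\<open>\<kappa> - \<rho>\<close> at \<open>\<mu>\<close>. Around a barycentre \<open>\<tau>\<close> there are the three vertices of its alcove and their three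
mirror images in the opposite sides. With \<open>S\<^sub>1(\<tau>)\<close> and \<open>S\<^sub>2(\<tau>)\<close> the sums of \<open>C\<close> over these two triples (rescaled
to \<open>P\<close>), the quantised character of \<open>y\<close> is the value at its barycentre of
\<open>\<Phi> = (F + 2) S\<^sub>1 + S\<^sub>2\<close>, called \<open>mode\<close> below. Let \<open>A\<close> be the adjacency operator of the honeycomb. Then
\<open>A S\<^sub>1 = 2 S\<^sub>1 + S\<^sub>2\<close> and \<open>A S\<^sub>2 = (F\<^sup>2 - 4) S\<^sub>1 - 2 S\<^sub>2\<close>, because \<open>F\<^sup>2\<close> is \<open>3\<close> plus the two fundamental
characters; so \<open>\<Phi>\<close> is an eigenfunction of \<open>A\<close> with eigenvalue \<open>F\<close>.

Let \<open>X\<close> be the convolution of functions on the honeycomb with the weight multiplicities of highest weight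
\<open>\<iota>(x)\<close>. The recursions satisfied by \<open>C\<close> give \<open>X S\<^sub>1 = a S\<^sub>1 + b S\<^sub>2\<close> with constants \<open>a, b\<close>
(lemma \<open>convolution_shell1\<close>), and \<open>X\<close> commutes with \<open>A\<close> because \<open>\<iota>(x) + \<rho>\<close> is not in \<open>3P\<close>
(lemma \<open>convolution_commutes\<close>). Since \<open>S\<^sub>2 = (A - 2) S\<^sub>1\<close>, the operator \<open>X\<close> acts on the span of \<open>S\<^sub>1\<close> and
\<open>S\<^sub>2\<close> as \<open>a + b (A - 2)\<close>, and \<open>\<Phi>\<close> is an eigenfunction of \<open>X\<close>. Evaluation at \<open>\<rho>\<close>, where \<open>\<Phi> = 1\<close>, identifies
the eigenvalue as \<open>\<Phi>(\<iota>(x) + \<rho>)\<close> (lemma \<open>mode_product\<close>). As \<open>\<Phi>\<close> is antisymmetric under the affine Weyl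
group of level \<open>3 p\<close>, the convolution sum folds onto the fundamental alcove of that group
(lemma \<open>fold_onto_alcove\<close>), whose honeycomb points are the barycentres of the elements of the
index set; this is the product formula.

The antisymmetry of \<open>\<Phi>\<close> includes periodicity under \<open>3 p Q\<close>. That is immediate from the Weyl character formula
unless the Weyl denominator vanishes at \<open>\<mu>\<close>. In that case two of the three exponentials in the fundamental
character coincide, \<open>C\<close> grows polynomially and is not periodic, but \<open>F\<close> equals minus the sum
\<open>1 + x + 1/x\<close> for the repeated exponential \<open>x\<close> and \<open>\<Phi>\<close> is a combination of three pure exponentials
(lemma \<open>mode_singular\<close>). This is where the sign \<open>\<epsilon>\<close> in the definition of \<open>F\<close> matters.\<close>

section \<open>The finite Weyl group and the root lattice\<close>

lemma s1_pair: "s\<^sub>1 (a, b) = (- a, a + b)"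
  by (simp add: s\<^sub>1_def scale_def \<alpha>\<^sub>1_def)

lemma s2_pair: "s\<^sub>2 (a, b) = (a + b, - b)"
  by (simp add: s\<^sub>2_def scale_def \<alpha>\<^sub>2_def)

lemmas weight_simps = s1_pair s2_pair \<Lambda>\<^sub>1_def \<Lambda>\<^sub>2_def \<rho>_def \<alpha>\<^sub>1_def \<alpha>\<^sub>2_def \<theta>_def scale_def

lemma weyl_eq: "weyl = {id, s\<^sub>1, s\<^sub>2, s\<^sub>1 \<circ> s\<^sub>2, s\<^sub>2 \<circ> s\<^sub>1, s\<^sub>1 \<circ> s\<^sub>2 \<circ> s\<^sub>1}"
proof
  show "weyl \<subseteq> {id, s\<^sub>1, s\<^sub>2, s\<^sub>1 \<circ> s\<^sub>2, s\<^sub>2 \<circ> s\<^sub>1, s\<^sub>1 \<circ> s\<^sub>2 \<circ> s\<^sub>1}"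
  proof
    fix w assume "w \<in> weyl"
    then show "w \<in> {id, s\<^sub>1, s\<^sub>2, s\<^sub>1 \<circ> s\<^sub>2, s\<^sub>2 \<circ> s\<^sub>1, s\<^sub>1 \<circ> s\<^sub>2 \<circ> s\<^sub>1}"
    proof induction
      case (2 w)
      have "s\<^sub>1 \<circ> s\<^sub>1 = id" "s\<^sub>1 \<circ> (s\<^sub>2 \<circ> s\<^sub>1) = s\<^sub>1 \<circ> s\<^sub>2 \<circ> s\<^sub>1" "s\<^sub>1 \<circ> (s\<^sub>1 \<circ> s\<^sub>2) = s\<^sub>2" "s\<^sub>1 \<circ> (s\<^sub>1 \<circ> s\<^sub>2 \<circ> s\<^sub>1) = s\<^sub>2 \<circ> s\<^sub>1"
        by (auto simp: fun_eq_iff s1_pair s2_pair)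
      then show ?case using 2(2) by (elim insertE emptyE; simp only: insert_iff comp_id simp_thms)
    next
      case (3 w)
      have "s\<^sub>2 \<circ> s\<^sub>2 = id" "s\<^sub>2 \<circ> (s\<^sub>2 \<circ> s\<^sub>1) = s\<^sub>1" "s\<^sub>2 \<circ> (s\<^sub>1 \<circ> s\<^sub>2) = s\<^sub>1 \<circ> s\<^sub>2 \<circ> s\<^sub>1"
        "s\<^sub>2 \<circ> (s\<^sub>1 \<circ> s\<^sub>2 \<circ> s\<^sub>1) = s\<^sub>1 \<circ> s\<^sub>2"
        by (auto simp: fun_eq_iff s1_pair s2_pair)
      then show ?case using 3(2) by (elim insertE emptyE; simp only: insert_iff comp_id simp_thms)
    qed auto
  qed
  have "s\<^sub>1 \<in> weyl" "s\<^sub>2 \<in> weyl"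
    using weyl.intros(2)[OF weyl.intros(1)] weyl.intros(3)[OF weyl.intros(1)] by auto
  then show "{id, s\<^sub>1, s\<^sub>2, s\<^sub>1 \<circ> s\<^sub>2, s\<^sub>2 \<circ> s\<^sub>1, s\<^sub>1 \<circ> s\<^sub>2 \<circ> s\<^sub>1} \<subseteq> weyl"
    by (auto intro: weyl.intros simp: comp_assoc)
qed

lemma weyl_distinct:
  "distinct [id, s\<^sub>1, s\<^sub>2, s\<^sub>1 \<circ> s\<^sub>2, s\<^sub>2 \<circ> s\<^sub>1, s\<^sub>1 \<circ> s\<^sub>2 \<circ> s\<^sub>1]"
proof -
  have "distinct (map (\<lambda>w. w (1, 1)) [id, s\<^sub>1, s\<^sub>2, s\<^sub>1 \<circ> s\<^sub>2, s\<^sub>2 \<circ> s\<^sub>1, s\<^sub>1 \<circ> s\<^sub>2 \<circ> s\<^sub>1])"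
    by (simp add: s1_pair s2_pair)
  then show ?thesis using distinct_map by blast
qed

lemma finite_weyl [simp]: "finite weyl"
  by (simp add: weyl_eq)

lemma weyl_cases [consumes 1, case_names id s1 s2 s12 s21 s121]:
  assumes "w \<in> weyl"
  obtains "w = id" | "w = s\<^sub>1" | "w = s\<^sub>2" | "w = s\<^sub>1 \<circ> s\<^sub>2" | "w = s\<^sub>2 \<circ> s\<^sub>1" | "w = s\<^sub>1 \<circ> s\<^sub>2 \<circ> s\<^sub>1"
  using assms unfolding weyl_eq by blast

lemma sum_weyl:
  fixes f :: "_ \<Rightarrow> 'a::ab_group_add"
  shows "(\<Sum>w\<in>weyl. f w) = f id + f s\<^sub>1 + f s\<^sub>2 + f (s\<^sub>1 \<circ> s\<^sub>2) + f (s\<^sub>2 \<circ> s\<^sub>1) + f (s\<^sub>1 \<circ> s\<^sub>2 \<circ> s\<^sub>1)"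
proof -
  have "(\<Sum>w\<in>weyl. f w) = (\<Sum>w\<leftarrow>[id, s\<^sub>1, s\<^sub>2, s\<^sub>1 \<circ> s\<^sub>2, s\<^sub>2 \<circ> s\<^sub>1, s\<^sub>1 \<circ> s\<^sub>2 \<circ> s\<^sub>1]. f w)"
    using sum.distinct_set_conv_list[OF weyl_distinct, of f] by (simp add: weyl_eq)
  then show ?thesis by (simp add: add.assoc)
qed

lemma wdet_weyl [simp]:
  "wdet id = 1" "wdet s\<^sub>1 = -1" "wdet s\<^sub>2 = -1" "wdet (s\<^sub>1 \<circ> s\<^sub>2) = 1" "wdet (s\<^sub>2 \<circ> s\<^sub>1) = 1"
  "wdet (s\<^sub>1 \<circ> s\<^sub>2 \<circ> s\<^sub>1) = -1"
  by (simp_all add: wdet_def weight_simps)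

lemma weyl_id [simp]: "id \<in> weyl" and weyl_s1 [simp]: "s\<^sub>1 \<in> weyl" and weyl_s2 [simp]: "s\<^sub>2 \<in> weyl"
  by (auto simp: weyl_eq)

text \<open>A restatement of the generated rule, in which the compositions are eta-contracted so that the simplifier
leaves them intact.\<close>
lemma weyl_induct [consumes 1, case_names 1 2 3]:
  assumes "w \<in> weyl" and "P id" and "\<And>w. w \<in> weyl \<Longrightarrow> P w \<Longrightarrow> P (s\<^sub>1 \<circ> w)"
    and "\<And>w. w \<in> weyl \<Longrightarrow> P w \<Longrightarrow> P (s\<^sub>2 \<circ> w)"
  shows "P w"
  using assms(1) by (induction rule: weyl.induct) (fact assms)+

lemma weyl_comp: "v \<in> weyl \<Longrightarrow> w \<in> weyl \<Longrightarrow> v \<circ> w \<in> weyl"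
  by (induction rule: weyl_induct) (auto simp: comp_assoc intro: weyl.intros)

lemma s1_s1 [simp]: "s\<^sub>1 (s\<^sub>1 \<xi>) = \<xi>" and s2_s2 [simp]: "s\<^sub>2 (s\<^sub>2 \<xi>) = \<xi>"
  by (cases \<xi>; simp add: s1_pair s2_pair)+

lemma s1_add: "s\<^sub>1 (\<xi> + \<eta>) = s\<^sub>1 \<xi> + s\<^sub>1 \<eta>" and s2_add: "s\<^sub>2 (\<xi> + \<eta>) = s\<^sub>2 \<xi> + s\<^sub>2 \<eta>"
  by (cases \<xi>; cases \<eta>; simp add: s1_pair s2_pair)+

lemma s1_scale: "s\<^sub>1 (scale n \<xi>) = scale n (s\<^sub>1 \<xi>)" and s2_scale: "s\<^sub>2 (scale n \<xi>) = scale n (s\<^sub>2 \<xi>)"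
  by (cases \<xi>; simp add: s1_pair s2_pair scale_def algebra_simps)+

lemma weyl_bij: "w \<in> weyl \<Longrightarrow> bij w"
proof (induction rule: weyl_induct)
  case (2 w)
  then show ?case by (intro bij_comp o_bij[of s\<^sub>1 s\<^sub>1]) (simp_all add: fun_eq_iff s1_pair)
next
  case (3 w)
  then show ?case by (intro bij_comp o_bij[of s\<^sub>2 s\<^sub>2]) (simp_all add: fun_eq_iff s2_pair)
qed (rule bij_id)

lemma weyl_inv: "w \<in> weyl \<Longrightarrow> inv w \<in> weyl"
proof -
  have *: "inv s\<^sub>1 = s\<^sub>1" "inv s\<^sub>2 = s\<^sub>2" by (intro inv_unique_comp; simp add: fun_eq_iff s1_pair s2_pair)+
  have b: "bij s\<^sub>1" "bij s\<^sub>2" by (simp_all add: weyl_bij)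
  show "w \<in> weyl \<Longrightarrow> inv w \<in> weyl"
  proof (induction rule: weyl_induct)
    case 1
    show ?case by (simp only: inv_id weyl.intros)
  next
    case (2 w)
    have "inv (s\<^sub>1 \<circ> w) = inv w \<circ> s\<^sub>1" using o_inv_distrib[OF b(1) weyl_bij[OF 2(1)]] * by simp
    then show ?case using weyl_comp[OF 2(2) weyl_s1] by metis
  next
    case (3 w)
    have "inv (s\<^sub>2 \<circ> w) = inv w \<circ> s\<^sub>2" using o_inv_distrib[OF b(2) weyl_bij[OF 3(1)]] * by simp
    then show ?case using weyl_comp[OF 3(2) weyl_s2] by metis
  qed
qed

lemma weyl_inv_left [simp]: "w \<in> weyl \<Longrightarrow> inv w (w \<xi>) = \<xi>"
  and weyl_inv_right [simp]: "w \<in> weyl \<Longrightarrow> w (inv w \<xi>) = \<xi>"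
  using weyl_bij by (auto simp: bij_is_inj bij_is_surj surj_f_inv_f)

lemma weyl_add: "w \<in> weyl \<Longrightarrow> w (\<xi> + \<eta>) = w \<xi> + w \<eta>"
  by (induction rule: weyl_induct) (simp_all add: s1_add s2_add)

lemma weyl_scale: "w \<in> weyl \<Longrightarrow> w (scale n \<xi>) = scale n (w \<xi>)"
  by (induction rule: weyl_induct) (simp_all add: s1_scale s2_scale)

lemma scale_minus_one: "scale (-1) \<xi> = - \<xi>"
  by (cases \<xi>) (simp add: scale_def)

lemma weyl_minus: "w \<in> weyl \<Longrightarrow> w (- \<xi>) = - w \<xi>"
  using weyl_scale[of w "-1" \<xi>] by (simp add: scale_minus_one)

lemma weyl_diff: "w \<in> weyl \<Longrightarrow> w (\<xi> - \<eta>) = w \<xi> - w \<eta>"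
  using weyl_add[of w \<xi> "- \<eta>"] by (simp add: weyl_minus)

lemma weyl_pair: "w \<in> weyl \<Longrightarrow> w (a, b) = scale a (w \<Lambda>\<^sub>1) + scale b (w \<Lambda>\<^sub>2)"
proof -
  assume w: "w \<in> weyl"
  have "(a, b) = scale a \<Lambda>\<^sub>1 + scale b \<Lambda>\<^sub>2" by (simp add: weight_simps)
  then show ?thesis using w by (metis weyl_add weyl_scale)
qed

lemma wdet_comp: "v \<in> weyl \<Longrightarrow> w \<in> weyl \<Longrightarrow> wdet (v \<circ> w) = wdet v * wdet w"
  unfolding wdet_def o_def
  by (cases "w \<Lambda>\<^sub>1"; cases "w \<Lambda>\<^sub>2"; cases "v \<Lambda>\<^sub>1"; cases "v \<Lambda>\<^sub>2")
     (simp add: weyl_pair scale_def algebra_simps)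

lemma wdet_square: "w \<in> weyl \<Longrightarrow> wdet w * wdet w = 1"
  by (erule weyl_cases) auto

lemma wdet_inv: "w \<in> weyl \<Longrightarrow> wdet (inv w) = wdet w"
proof -
  assume w: "w \<in> weyl"
  have "inv w \<circ> w = id" using w by (simp add: fun_eq_iff)
  then have "wdet (inv w) * wdet w = 1"
    using wdet_comp[OF weyl_inv[OF w] w] by simp
  moreover have "wdet w = 1 \<or> wdet w = -1" using w by (auto elim: weyl_cases)
  ultimately show ?thesis by auto
qed

lemma weyl_comp_inv:
  assumes "u \<in> weyl"
  shows "w \<circ> u \<circ> inv u = w" "w \<circ> inv u \<circ> u = w" "u \<circ> (inv u \<circ> w) = w" "inv u \<circ> (u \<circ> w) = w"
  using assms by (simp_all add: fun_eq_iff)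

lemma sum_weyl_right: "u \<in> weyl \<Longrightarrow> (\<Sum>w\<in>weyl. f (w \<circ> u)) = (\<Sum>w\<in>weyl. f w)"
  by (rule sum.reindex_bij_witness[of _ "\<lambda>w. w \<circ> inv u" "\<lambda>w. w \<circ> u"])
     (simp_all only: weyl_comp weyl_inv weyl_comp_inv)

lemma sum_weyl_left: "u \<in> weyl \<Longrightarrow> (\<Sum>w\<in>weyl. f (u \<circ> w)) = (\<Sum>w\<in>weyl. f w)"
  by (rule sum.reindex_bij_witness[of _ "\<lambda>w. inv u \<circ> w" "\<lambda>w. u \<circ> w"])
     (simp_all only: weyl_comp weyl_inv weyl_comp_inv)

lemma sum_weyl_inv: "(\<Sum>w\<in>weyl. f (inv w)) = (\<Sum>w\<in>weyl. f w)"
  by (rule sum.reindex_bij_witness[of _ inv inv]) (auto simp: weyl_inv weyl_bij inv_inv_eq)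

lemma root_lattice_iff: "(a, b) \<in> root_lattice \<longleftrightarrow> 3 dvd (a - b)"
proof
  assume "(a, b) \<in> root_lattice"
  then obtain m n where "(a, b) = scale m \<alpha>\<^sub>1 + scale n \<alpha>\<^sub>2" by (auto simp: root_lattice_def)
  then have "a - b = 3 * (m - n)" by (simp add: weight_simps)
  then show "3 dvd (a - b)" by simp
next
  assume "3 dvd (a - b)"
  then obtain k where "a - b = 3 * k" by (auto elim: dvdE)
  then have "(a, b) = scale (b + 2 * k) \<alpha>\<^sub>1 + scale (b + k) \<alpha>\<^sub>2" by (simp add: weight_simps)
  then show "(a, b) \<in> root_lattice" unfolding root_lattice_def by blast
qed

lemma root_lattice_weyl: "w \<in> weyl \<Longrightarrow> \<beta> \<in> root_lattice \<Longrightarrow> w \<beta> \<in> root_lattice"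
proof (induction rule: weyl_induct)
  case (2 w)
  then show ?case by (cases "w \<beta>") (auto simp: s1_pair root_lattice_iff, presburger)
next
  case (3 w)
  then show ?case by (cases "w \<beta>") (auto simp: s2_pair root_lattice_iff, presburger)
qed auto

lemma root_lattice_minus: "\<beta> \<in> root_lattice \<Longrightarrow> - \<beta> \<in> root_lattice"
  by (cases \<beta>) (auto simp: root_lattice_iff dvd_diff_commute)

lemma root_lattice_add: "\<beta> \<in> root_lattice \<Longrightarrow> \<gamma> \<in> root_lattice \<Longrightarrow> \<beta> + \<gamma> \<in> root_lattice"
  by (cases \<beta>; cases \<gamma>; simp add: root_lattice_iff; presburger)

lemma root_lattice_scale: "\<beta> \<in> root_lattice \<Longrightarrow> scale n \<beta> \<in> root_lattice"
  by (cases \<beta>) (auto simp: root_lattice_iff scale_def right_diff_distrib[symmetric])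

section \<open>The Kostant partition function and weight multiplicities\<close>

text \<open>In terms of \<open>m \<alpha>\<^sub>1 + n \<alpha>\<^sub>2\<close> with \<open>m, n \<ge> 0\<close> the only freedom is the number of times \<open>\<theta>\<close> is used,
which ranges from \<open>0\<close> to the minimum of \<open>m\<close> and \<open>n\<close>.\<close>
lemma kostant_eq:
  "kostant (a, b) = (if 3 dvd (a - b) then max 0 (1 + min ((2 * a + b) div 3) ((a + 2 * b) div 3)) else 0)"
proof (cases "3 dvd (a - b)")
  case False
  have "{(i, j, k). scale (int i) \<alpha>\<^sub>1 + scale (int j) \<alpha>\<^sub>2 + scale (int k) \<theta> = (a, b)} = {}"
  proof (rule ccontr)
    assume "\<not> ?thesis"
    then obtain i j k where "scale (int i) \<alpha>\<^sub>1 + scale (int j) \<alpha>\<^sub>2 + scale (int k) \<theta> = (a, b)" by blast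
    then have "a - b = 3 * (int i - int j)" by (auto simp: weight_simps)
    with False show False by simp
  qed
  then have "kostant (a, b) = 0" unfolding kostant_def by (simp only: card.empty of_nat_0)
  with False show ?thesis by simp
next
  case True
  define m where "m = (2 * a + b) div 3"
  define n where "n = (a + 2 * b) div 3"
  have m: "2 * a + b = 3 * m" and n: "a + 2 * b = 3 * n"
    using True unfolding m_def n_def by presburger+
  then have ab: "a = 2 * m - n" "b = 2 * n - m" by simp_all
  define S where "S = {(i, j, k). scale (int i) \<alpha>\<^sub>1 + scale (int j) \<alpha>\<^sub>2 + scale (int k) \<theta> = (a, b)}"
  have mem: "(i, j, k) \<in> S \<longleftrightarrow> int i + int k = m \<and> int j + int k = n" for i j k
    unfolding S_def by (auto simp: weight_simps ab)
  have "bij_betw (\<lambda>k. (nat (m - k), nat (n - k), nat k)) {0..min m n} S"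
  proof (rule bij_betwI[of _ _ _ "\<lambda>(i, j, k). int k"])
    show "(\<lambda>k. (nat (m - k), nat (n - k), nat k)) \<in> {0..min m n} \<rightarrow> S"
      by (auto simp: mem)
    show "(\<lambda>(i, j, k). int k) \<in> S \<rightarrow> {0..min m n}"
    proof
      fix s assume "s \<in> S"
      then show "(\<lambda>(i, j, k). int k) s \<in> {0..min m n}"
        by (cases s rule: prod_cases3) (auto simp: mem)
    qed
    show "(\<lambda>(i, j, k). (int k :: int)) (nat (m - x), nat (n - x), nat x) = x" if "x \<in> {0..min m n}" for x
      using that by simp
    show "(\<lambda>k. (nat (m - k), nat (n - k), nat k)) ((\<lambda>(i, j, k). int k) s) = s" if "s \<in> S" for s
      using that by (cases s rule: prod_cases3) (auto simp: mem)
  qed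
  then have "card S = card {0..min m n}" using bij_betw_same_card by metis
  then show ?thesis using True
    unfolding kostant_def S_def[symmetric] m_def[symmetric] n_def[symmetric] by simp
qed

lemma kostant_outside: "\<beta> \<notin> root_lattice \<Longrightarrow> kostant \<beta> = 0"
  by (cases \<beta>) (simp add: kostant_eq root_lattice_iff)

lemma kostant_root: "kostant (2 * m - n, 2 * n - m) = max 0 (1 + min m n)"
proof -
  have "(2 * (2 * m - n) + (2 * n - m)) div 3 = m" "((2 * m - n) + 2 * (2 * n - m)) div 3 = n" by simp_all
  moreover have "3 dvd ((2 * m - n) - (2 * n - m))" by presburger
  ultimately show ?thesis by (simp add: kostant_eq)
qed

lemma root_lattice_coords:
  assumes "\<beta> \<in> root_lattice"
  obtains m n where "\<beta> = (2 * m - n, 2 * n - m)"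
proof -
  from assms obtain m n where "\<beta> = scale m \<alpha>\<^sub>1 + scale n \<alpha>\<^sub>2" unfolding root_lattice_def by blast
  then have "\<beta> = (2 * m - n, 2 * n - m)" by (simp add: weight_simps)
  then show thesis by (rule that)
qed

text \<open>Indexing by the highest weight plus \<open>\<rho>\<close> turns the shifted action into the linear one.\<close>
definition weight_mult :: "weight \<Rightarrow> weight \<Rightarrow> int" where
  "weight_mult \<kappa> \<nu> = mbar (\<kappa> - \<rho>) \<nu>"

lemma weight_mult_kostant: "weight_mult \<kappa> \<nu> = (\<Sum>w\<in>weyl. wdet w * kostant (w \<kappa> - \<rho> - \<nu>))"
  by (simp add: weight_mult_def mbar_def shifted_def)

lemma weight_mult_antisym:
  assumes "u \<in> weyl"
  shows "weight_mult (u \<kappa>) \<nu> = wdet u * weight_mult \<kappa> \<nu>"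
proof -
  have "weight_mult \<kappa> \<nu> = (\<Sum>w\<in>weyl. wdet (w \<circ> u) * kostant ((w \<circ> u) \<kappa> - \<rho> - \<nu>))"
    unfolding weight_mult_kostant by (rule sum_weyl_right[OF assms, symmetric])
  also have "\<dots> = (\<Sum>w\<in>weyl. wdet u * (wdet w * kostant (w (u \<kappa>) - \<rho> - \<nu>)))"
    by (intro sum.cong) (simp_all add: wdet_comp assms)
  also have "\<dots> = wdet u * weight_mult (u \<kappa>) \<nu>" by (simp only: weight_mult_kostant sum_distrib_left)
  finally have "weight_mult \<kappa> \<nu> = wdet u * weight_mult (u \<kappa>) \<nu>" .
  then have "wdet u * weight_mult \<kappa> \<nu> = (wdet u * wdet u) * weight_mult (u \<kappa>) \<nu>" by simp
  then show ?thesis by (simp add: wdet_square[OF assms])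
qed

text \<open>The value is \<open>max 0 (1 + n)\<close> for \<open>\<beta> = m \<alpha>\<^sub>1 + n \<alpha>\<^sub>2\<close>: along an \<open>\<alpha>\<^sub>1\<close>-string the partition function
increases with slope one up to \<open>m = n\<close> and is constant from there on, and the reflected term fills it up.\<close>
lemma kostant_string_s1:
  "kostant \<beta> + kostant (s\<^sub>1 (\<beta> + \<alpha>\<^sub>1)) =
   kostant (\<beta> + scale k \<alpha>\<^sub>1) + kostant (s\<^sub>1 (\<beta> + scale k \<alpha>\<^sub>1 + \<alpha>\<^sub>1))"
proof (cases "\<beta> \<in> root_lattice")
  case True
  then obtain m n where \<beta>: "\<beta> = (2 * m - n, 2 * n - m)" by (rule root_lattice_coords)
  have "kostant \<beta> + kostant (s\<^sub>1 (\<beta> + \<alpha>\<^sub>1)) = max 0 (1 + n)"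
    if \<beta>: "\<beta> = (2 * m - n, 2 * n - m)" for \<beta> m n
  proof -
    have "s\<^sub>1 (\<beta> + \<alpha>\<^sub>1) = (2 * (n - m - 1) - n, 2 * n - (n - m - 1))"
      by (simp add: \<beta> weight_simps)
    then show ?thesis unfolding \<beta> by (simp only: kostant_root)
  qed
  from this[OF \<beta>] this[of "\<beta> + scale k \<alpha>\<^sub>1" "m + k" n] show ?thesis
    by (simp add: \<beta> weight_simps algebra_simps)
next
  case False
  have "\<beta> + scale k \<alpha>\<^sub>1 \<notin> root_lattice" "s\<^sub>1 (\<beta> + \<alpha>\<^sub>1) \<notin> root_lattice"
    "s\<^sub>1 (\<beta> + scale k \<alpha>\<^sub>1 + \<alpha>\<^sub>1) \<notin> root_lattice"
    using False by (cases \<beta>; simp add: weight_simps root_lattice_iff; presburger)+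
  with False show ?thesis by (simp add: kostant_outside)
qed

lemma kostant_string_s2:
  "kostant \<beta> + kostant (s\<^sub>2 (\<beta> + \<alpha>\<^sub>2)) =
   kostant (\<beta> + scale k \<alpha>\<^sub>2) + kostant (s\<^sub>2 (\<beta> + scale k \<alpha>\<^sub>2 + \<alpha>\<^sub>2))"
proof (cases "\<beta> \<in> root_lattice")
  case True
  then obtain m n where \<beta>: "\<beta> = (2 * m - n, 2 * n - m)" by (rule root_lattice_coords)
  have "kostant \<beta> + kostant (s\<^sub>2 (\<beta> + \<alpha>\<^sub>2)) = max 0 (1 + m)"
    if \<beta>: "\<beta> = (2 * m - n, 2 * n - m)" for \<beta> m n
  proof -
    have "s\<^sub>2 (\<beta> + \<alpha>\<^sub>2) = (2 * m - (m - n - 1), 2 * (m - n - 1) - m)"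
      by (simp add: \<beta> weight_simps)
    then show ?thesis unfolding \<beta> by (simp only: kostant_root)
  qed
  from this[OF \<beta>] this[of "\<beta> + scale k \<alpha>\<^sub>2" m "n + k"] show ?thesis
    by (simp add: \<beta> weight_simps algebra_simps)
next
  case False
  have "\<beta> + scale k \<alpha>\<^sub>2 \<notin> root_lattice" "s\<^sub>2 (\<beta> + \<alpha>\<^sub>2) \<notin> root_lattice"
    "s\<^sub>2 (\<beta> + scale k \<alpha>\<^sub>2 + \<alpha>\<^sub>2) \<notin> root_lattice"
    using False by (cases \<beta>; simp add: weight_simps root_lattice_iff; presburger)+
  with False show ?thesis by (simp add: kostant_outside)
qed

text \<open>Pair the summand of \<open>w\<close> with that of \<open>s \<circ> w\<close>. The two arguments of the partition function lie on one
\<open>\<alpha>\<close>-string, and the string identity says that each pair is unchanged when \<open>\<nu>\<close> is reflected. This gives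
the Weyl invariance of weight multiplicities for arbitrary integral \<open>\<kappa>\<close>.\<close>
lemma weight_mult_reflect:
  assumes s: "s \<in> weyl" "wdet s = -1" "\<And>\<xi>. s (s \<xi>) = \<xi>" "s \<rho> = \<rho> - \<alpha>"
    and refl: "\<And>\<xi>. \<exists>k. s \<xi> = \<xi> + scale k \<alpha>"
    and string: "\<And>\<beta> k. kostant \<beta> + kostant (s (\<beta> + \<alpha>)) =
      kostant (\<beta> + scale k \<alpha>) + kostant (s (\<beta> + scale k \<alpha> + \<alpha>))"
  shows "weight_mult \<kappa> (s \<nu>) = weight_mult \<kappa> \<nu>"
proof -
  let ?K = "\<lambda>\<nu> w. kostant (w \<kappa> - \<rho> - \<nu>)"
  have double: "2 * weight_mult \<kappa> \<nu> = (\<Sum>w\<in>weyl. wdet w * (?K \<nu> w - ?K \<nu> (s \<circ> w)))" for \<nu>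
  proof -
    have "weight_mult \<kappa> \<nu> = (\<Sum>w\<in>weyl. wdet (s \<circ> w) * ?K \<nu> (s \<circ> w))"
      unfolding weight_mult_kostant by (rule sum_weyl_left[OF s(1), symmetric])
    also have "\<dots> = (\<Sum>w\<in>weyl. - (wdet w * ?K \<nu> (s \<circ> w)))"
      by (intro sum.cong) (simp_all add: wdet_comp s)
    finally have "2 * weight_mult \<kappa> \<nu> =
        (\<Sum>w\<in>weyl. wdet w * ?K \<nu> w) + (\<Sum>w\<in>weyl. - (wdet w * ?K \<nu> (s \<circ> w)))"
      using weight_mult_kostant[of \<kappa> \<nu>] by linarith
    then show ?thesis
      by (simp only: sum.distrib[symmetric] right_diff_distrib diff_conv_add_uminus)
         (simp only: right_diff_distrib diff_conv_add_uminus[symmetric])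
  qed
  \<comment> \<open>Apply the involution to \<open>s \<rho> = \<rho> - \<alpha>\<close>.\<close>
  have s\<alpha>: "s \<alpha> = - \<alpha>"
    using s(3)[of \<rho>] s(4) weyl_diff[OF s(1), of \<rho> \<alpha>] by (simp add: eq_neg_iff_add_eq_0 algebra_simps)
  have "?K (s \<nu>) w - ?K (s \<nu>) (s \<circ> w) = ?K \<nu> w - ?K \<nu> (s \<circ> w)" if "w \<in> weyl" for w
  proof -
    let ?\<beta> = "w \<kappa> - \<rho> - \<nu>"
    obtain k where k: "s (w \<kappa>) = w \<kappa> + scale k \<alpha>" using refl by blast
    have 1: "s (w \<kappa>) - \<rho> - s \<nu> = s (?\<beta> + \<alpha>)"
      using s(1) by (simp add: weyl_add weyl_diff s(4) s\<alpha>)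
    have 2: "s (w \<kappa>) - \<rho> - \<nu> = ?\<beta> + scale k \<alpha>" using k by (simp add: algebra_simps)
    have "s (?\<beta> + scale k \<alpha> + \<alpha>) = s (s (w \<kappa>) - \<rho> - \<nu> + \<alpha>)" unfolding 2[symmetric] by simp
    also have "\<dots> = w \<kappa> - \<rho> - s \<nu>"
      using s(1) by (simp add: weyl_add weyl_diff s(3) s(4) s\<alpha>)
    finally have 3: "s (?\<beta> + scale k \<alpha> + \<alpha>) = w \<kappa> - \<rho> - s \<nu>" .
    have "kostant ?\<beta> + kostant (s (w \<kappa>) - \<rho> - s \<nu>) =
        kostant (s (w \<kappa>) - \<rho> - \<nu>) + kostant (w \<kappa> - \<rho> - s \<nu>)"
      using string[of ?\<beta> k] by (simp only: 1 2 3)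
    then show ?thesis by simp
  qed
  then have "2 * weight_mult \<kappa> (s \<nu>) = 2 * weight_mult \<kappa> \<nu>"
    unfolding double by (intro sum.cong) simp_all
  then show ?thesis by simp
qed

lemma weight_mult_weyl:
  assumes "w \<in> weyl"
  shows "weight_mult \<kappa> (w \<nu>) = weight_mult \<kappa> \<nu>"
proof -
  have s1: "weight_mult \<kappa> (s\<^sub>1 \<nu>) = weight_mult \<kappa> \<nu>" for \<nu>
  proof (rule weight_mult_reflect[where \<alpha> = \<alpha>\<^sub>1])
    show "\<exists>k. s\<^sub>1 \<xi> = \<xi> + scale k \<alpha>\<^sub>1" for \<xi>
      by (rule exI[of _ "- fst \<xi>"]) (cases \<xi>; simp add: weight_simps)
  qed (use kostant_string_s1 in \<open>simp_all add: weight_simps\<close>)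
  have s2: "weight_mult \<kappa> (s\<^sub>2 \<nu>) = weight_mult \<kappa> \<nu>" for \<nu>
  proof (rule weight_mult_reflect[where \<alpha> = \<alpha>\<^sub>2])
    show "\<exists>k. s\<^sub>2 \<xi> = \<xi> + scale k \<alpha>\<^sub>2" for \<xi>
      by (rule exI[of _ "- snd \<xi>"]) (cases \<xi>; simp add: weight_simps)
  qed (use kostant_string_s2 in \<open>simp_all add: weight_simps\<close>)
  show ?thesis
    using assms by (induction rule: weyl_induct) (simp_all add: s1 s2)
qed

lemma kostant_support: "kostant (a, b) \<noteq> 0 \<Longrightarrow> 2 * a + b \<ge> 0"
  by (auto simp: kostant_eq split: if_splits)

text \<open>A nonzero summand forces \<open>\<nu>\<close> below some \<open>w \<kappa> - \<rho>\<close>; pairing with \<open>3 \<Lambda>\<^sub>1\<close> bounds \<open>\<nu>\<close> in one direction. Weyl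
invariance then bounds it in the other directions.\<close>
lemma weight_mult_support:
  assumes "weight_mult (a, b) (c, d) \<noteq> 0"
  shows "2 * c + d \<le> 2 * \<bar>a\<bar> + 2 * \<bar>b\<bar>"
proof -
  from assms obtain w where w: "w \<in> weyl" "kostant (w (a, b) - \<rho> - (c, d)) \<noteq> 0"
    unfolding weight_mult_kostant by (metis (mono_tags, lifting) mult_zero_right sum.neutral)
  from w(1) show ?thesis
  proof (cases rule: weyl_cases)
  qed (use w(2) kostant_support in \<open>force simp: s1_pair s2_pair \<rho>_def \<Lambda>\<^sub>1_def \<Lambda>\<^sub>2_def\<close>)+
qed

lemma finite_weight_mult: "finite {\<nu>. weight_mult \<kappa> \<nu> \<noteq> 0}"
proof -
  obtain a b where \<kappa>: "\<kappa> = (a, b)" by (cases \<kappa>)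
  \<comment> \<open>The three numbers bounded by \<open>B\<close> below are \<open>2 c + d\<close> on the orbit of \<open>\<nu>\<close>; their sum is zero, so they are bounded below as well.\<close>
  define B where "B = 2 * \<bar>a\<bar> + 2 * \<bar>b\<bar>"
  have "\<nu> \<in> {- 2 * B..2 * B} \<times> {- 2 * B..2 * B}" if "weight_mult \<kappa> \<nu> \<noteq> 0" for \<nu>
  proof -
    obtain c d where \<nu>: "\<nu> = (c, d)" by (cases \<nu>)
    have "weight_mult (a, b) (c, d) \<noteq> 0" "weight_mult (a, b) (s\<^sub>1 (c, d)) \<noteq> 0" "weight_mult (a, b) ((s\<^sub>1 \<circ> s\<^sub>2) (c, d)) \<noteq> 0"
      using that weyl_s1 weyl_comp[OF weyl_s1 weyl_s2] unfolding \<kappa> \<nu> by (simp_all only: weight_mult_weyl simp_thms)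
    then have "2 * c + d \<le> B" "- c + d \<le> B" "- c - 2 * d \<le> B"
      unfolding B_def using weight_mult_support[of a b] by (fastforce simp: s1_pair s2_pair)+
    then show ?thesis unfolding \<nu> by auto
  qed
  then show ?thesis by (intro finite_subset[OF _ finite_SigmaI[OF finite_atLeastAtMost_int finite_atLeastAtMost_int]]) auto
qed

text \<open>The partition function is inverse to the Weyl denominator, expanded over the Weyl group.\<close>
lemma kostant_denominator:
  "(\<Sum>w\<in>weyl. wdet w * kostant (\<beta> + w \<rho> - \<rho>)) = (if \<beta> = 0 then 1 else 0)"
proof (cases "\<beta> \<in> root_lattice")
  case True
  then obtain m n where \<beta>: "\<beta> = (2 * m - n, 2 * n - m)" by (rule root_lattice_coords)
  have "(\<Sum>w\<in>weyl. wdet w * kostant (\<beta> + w \<rho> - \<rho>)) =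
    max 0 (1 + min m n) - max 0 (1 + min (m - 1) n) - max 0 (1 + min m (n - 1))
    + max 0 (1 + min (m - 2) (n - 1)) + max 0 (1 + min (m - 1) (n - 2)) - max 0 (1 + min (m - 2) (n - 2))"
    using kostant_root[of m n] kostant_root[of "m - 1" n] kostant_root[of m "n - 1"]
      kostant_root[of "m - 2" "n - 1"] kostant_root[of "m - 1" "n - 2"] kostant_root[of "m - 2" "n - 2"]
    unfolding \<beta> by (simp add: sum_weyl weight_simps algebra_simps)
  also have "\<dots> = (if m = 0 \<and> n = 0 then 1 else 0)" by (simp add: max_def min_def)
  also have "(m = 0 \<and> n = 0) = (\<beta> = 0)" unfolding \<beta> zero_prod_def by auto
  finally show ?thesis .
next
  case False
  have "\<beta> + w \<rho> - \<rho> \<notin> root_lattice" if "w \<in> weyl" for w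
    using that False
    by (cases \<beta>; cases rule: weyl_cases; simp add: weight_simps root_lattice_iff; presburger)
  moreover have "\<beta> \<noteq> 0" using False by (auto simp: zero_prod_def root_lattice_iff)
  ultimately show ?thesis by (simp add: kostant_outside)
qed

text \<open>The Weyl character formula, coefficient by coefficient.\<close>
lemma weight_mult_denominator:
  "(\<Sum>v\<in>weyl. wdet v * weight_mult \<kappa> (\<delta> - v \<rho>)) = (\<Sum>w\<in>weyl. if \<delta> = w \<kappa> then wdet w else 0)"
proof -
  have "(\<Sum>v\<in>weyl. wdet v * weight_mult \<kappa> (\<delta> - v \<rho>)) =
    (\<Sum>v\<in>weyl. \<Sum>w\<in>weyl. wdet w * (wdet v * kostant ((w \<kappa> - \<delta>) + v \<rho> - \<rho>)))"
    unfolding weight_mult_kostant by (simp add: sum_distrib_left algebra_simps)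
  also have "\<dots> = (\<Sum>w\<in>weyl. wdet w * (\<Sum>v\<in>weyl. wdet v * kostant ((w \<kappa> - \<delta>) + v \<rho> - \<rho>)))"
    by (subst sum.swap) (simp add: sum_distrib_left)
  also have "\<dots> = (\<Sum>w\<in>weyl. if \<delta> = w \<kappa> then wdet w else 0)"
    unfolding kostant_denominator by (intro sum.cong) auto
  finally show ?thesis .
qed

lemma weight_mult_rho: "weight_mult \<rho> \<nu> = (if \<nu> = 0 then 1 else 0)"
  unfolding weight_mult_kostant using kostant_denominator[of "- \<nu>"] by (simp add: algebra_simps)

text \<open>Tensoring with the fundamental module of weights \<open>\<Lambda>\<^sub>1\<close>, \<open>\<Lambda>\<^sub>2 - \<Lambda>\<^sub>1\<close>, \<open>- \<Lambda>\<^sub>2\<close>. The Weyl group permutes these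
weights, so the identity holds summand by summand in the alternating formula.\<close>
lemma weight_mult_tensor_1:
  "weight_mult (\<kappa> + (1, 0)) \<nu> + weight_mult (\<kappa> + (-1, 1)) \<nu> + weight_mult (\<kappa> + (0, -1)) \<nu> =
   weight_mult \<kappa> (\<nu> - (1, 0)) + weight_mult \<kappa> (\<nu> - (-1, 1)) + weight_mult \<kappa> (\<nu> - (0, -1))"
  by (cases \<kappa>; cases \<nu>; simp add: weight_mult_kostant sum_weyl weight_simps algebra_simps)

lemma weight_mult_tensor_2:
  "weight_mult (\<kappa> + (0, 1)) \<nu> + weight_mult (\<kappa> + (1, -1)) \<nu> + weight_mult (\<kappa> + (-1, 0)) \<nu> =
   weight_mult \<kappa> (\<nu> - (0, 1)) + weight_mult \<kappa> (\<nu> - (1, -1)) + weight_mult \<kappa> (\<nu> - (-1, 0))"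
  by (cases \<kappa>; cases \<nu>; simp add: weight_mult_kostant sum_weyl weight_simps algebra_simps)

section \<open>Sums of functions against finitely supported multiplicities\<close>

definition pairing :: "(weight \<Rightarrow> int) \<Rightarrow> (weight \<Rightarrow> complex) \<Rightarrow> complex" where
  "pairing g f = (\<Sum>\<^sub>\<infinity>\<nu>\<in>UNIV. of_int (g \<nu>) * f \<nu>)"

lemma pairing_sum_support:
  assumes "finite S" "\<And>\<nu>. \<nu> \<notin> S \<Longrightarrow> g \<nu> = 0"
  shows "pairing g f = (\<Sum>\<nu>\<in>S. of_int (g \<nu>) * f \<nu>)"
proof -
  have "pairing g f = (\<Sum>\<^sub>\<infinity>\<nu>\<in>S. of_int (g \<nu>) * f \<nu>)"
    unfolding pairing_def by (rule infsum_cong_neutral) (use assms(2) in auto)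
  then show ?thesis using assms(1) by simp
qed

lemma pairing_support:
  assumes "finite {\<nu>. g \<nu> \<noteq> 0}"
  shows "pairing g f = (\<Sum>\<nu> | g \<nu> \<noteq> 0. of_int (g \<nu>) * f \<nu>)"
  using assms by (rule pairing_sum_support) auto

lemma pairing_add:
  "finite {\<nu>. g \<nu> \<noteq> 0} \<Longrightarrow> pairing g (\<lambda>\<nu>. f \<nu> + h \<nu>) = pairing g f + pairing g h"
  by (simp add: pairing_support sum.distrib distrib_left)

lemma pairing_cmult: "pairing g (\<lambda>\<nu>. c * f \<nu>) = c * pairing g f"
  unfolding pairing_def by (simp add: infsum_cmult_right'[symmetric] algebra_simps)

lemma pairing_sum:
  assumes "finite {\<nu>. g \<nu> \<noteq> 0}"
  shows "pairing g (\<lambda>\<nu>. \<Sum>a\<in>A. f a \<nu>) = (\<Sum>a\<in>A. pairing g (f a))"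
  unfolding pairing_support[OF assms] sum_distrib_left by (rule sum.swap)

lemma pairing_left_sum:
  assumes "finite A" "\<And>a. a \<in> A \<Longrightarrow> finite {\<nu>. g a \<nu> \<noteq> 0}"
  shows "pairing (\<lambda>\<nu>. \<Sum>a\<in>A. c a * g a \<nu>) f = (\<Sum>a\<in>A. of_int (c a) * pairing (g a) f)"
proof -
  define S where "S = (\<Union>a\<in>A. {\<nu>. g a \<nu> \<noteq> 0})"
  have S: "finite S" using assms unfolding S_def by blast
  have "pairing (\<lambda>\<nu>. \<Sum>a\<in>A. c a * g a \<nu>) f = (\<Sum>\<nu>\<in>S. of_int (\<Sum>a\<in>A. c a * g a \<nu>) * f \<nu>)"
    by (rule pairing_sum_support[OF S]) (auto simp: S_def intro!: sum.neutral)
  also have "\<dots> = (\<Sum>\<nu>\<in>S. \<Sum>a\<in>A. of_int (c a) * (of_int (g a \<nu>) * f \<nu>))"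
    by (simp add: sum_distrib_right mult.assoc)
  also have "\<dots> = (\<Sum>a\<in>A. of_int (c a) * (\<Sum>\<nu>\<in>S. of_int (g a \<nu>) * f \<nu>))"
    by (subst sum.swap) (simp add: sum_distrib_left)
  also have "\<dots> = (\<Sum>a\<in>A. of_int (c a) * pairing (g a) f)"
  proof (intro sum.cong refl arg_cong2[where f = "(*)"])
    fix a assume "a \<in> A"
    then show "(\<Sum>\<nu>\<in>S. of_int (g a \<nu>) * f \<nu>) = pairing (g a) f"
      by (intro pairing_sum_support[OF S, symmetric]) (auto simp: S_def)
  qed
  finally show ?thesis .
qed

lemma pairing_shift: "pairing (\<lambda>\<nu>. g (\<nu> - \<eta>)) f = pairing g (\<lambda>\<nu>. f (\<nu> + \<eta>))"
  unfolding pairing_def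
  by (rule infsum_reindex_bij_witness[of _ "\<lambda>\<nu>. \<nu> + \<eta>" "\<lambda>\<nu>. \<nu> - \<eta>"]) auto

lemma finite_shift: "finite {\<nu>. g \<nu> \<noteq> 0} \<Longrightarrow> finite {\<nu>::weight. g (\<nu> - \<eta>) \<noteq> 0}"
proof (rule finite_subset[of _ "(\<lambda>\<nu>. \<nu> + \<eta>) ` {\<nu>. g \<nu> \<noteq> 0}"])
  show "{\<nu>. g (\<nu> - \<eta>) \<noteq> 0} \<subseteq> (\<lambda>\<nu>. \<nu> + \<eta>) ` {\<nu>. g \<nu> \<noteq> 0}"
  proof
    fix \<nu> assume "\<nu> \<in> {\<nu>. g (\<nu> - \<eta>) \<noteq> 0}"
    then show "\<nu> \<in> (\<lambda>\<nu>. \<nu> + \<eta>) ` {\<nu>. g \<nu> \<noteq> 0}"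
      by (intro image_eqI[of _ _ "\<nu> - \<eta>"]) simp_all
  qed
qed simp

lemma pairing_weyl:
  assumes "w \<in> weyl" "\<And>\<nu>. g (w \<nu>) = g \<nu>"
  shows "pairing g (\<lambda>\<nu>. f (w \<nu>)) = pairing g f"
proof -
  have "pairing g f = (\<Sum>\<^sub>\<infinity>\<nu>\<in>UNIV. of_int (g (w \<nu>)) * f (w \<nu>))"
    unfolding pairing_def by (rule infsum_reindex_bij_betw[symmetric]) (rule weyl_bij[OF assms(1)])
  then show ?thesis unfolding pairing_def assms(2) by simp
qed

text \<open>The character formula against an arbitrary function instead of an exponential; applied to the
eigenfunction on the honeycomb it identifies an eigenvalue.\<close>
lemma pairing_mult_denominator:
  "(\<Sum>v\<in>weyl. of_int (wdet v) * pairing (weight_mult \<kappa>) (\<lambda>\<nu>. f (\<nu> + v \<rho>))) =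
   (\<Sum>w\<in>weyl. of_int (wdet w) * f (w \<kappa>))"
proof -
  have "(\<Sum>v\<in>weyl. of_int (wdet v) * pairing (weight_mult \<kappa>) (\<lambda>\<nu>. f (\<nu> + v \<rho>))) =
    pairing (\<lambda>\<delta>. \<Sum>v\<in>weyl. wdet v * weight_mult \<kappa> (\<delta> - v \<rho>)) f"
    by (subst pairing_left_sum) (simp_all add: finite_shift finite_weight_mult pairing_shift)
  also have "\<dots> = pairing (\<lambda>\<delta>. \<Sum>w\<in>weyl. wdet w * (if \<delta> = w \<kappa> then 1 else 0)) f"
    unfolding weight_mult_denominator by (intro arg_cong2[where f = pairing] ext sum.cong) auto
  also have "\<dots> = (\<Sum>w\<in>weyl. of_int (wdet w) * pairing (\<lambda>\<delta>. if \<delta> = w \<kappa> then 1 else 0) f)"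
    by (rule pairing_left_sum) auto
  also have "\<dots> = (\<Sum>w\<in>weyl. of_int (wdet w) * f (w \<kappa>))"
    by (intro sum.cong refl arg_cong2[where f = "(*)"], subst pairing_sum_support[of "{_}"]) auto
  finally show ?thesis .
qed

section \<open>Characters on the weight lattice and their recursions\<close>

text \<open>A function on the weight lattice on which both fundamental characters act by scalars is determined by six
values. Eliminating the neighbouring rows from the two recursions leaves a recursion of order three within
each row, so three consecutive values fill a row, and two rows fill the plane. With \<open>S\<close> the
span of two functions this yields spanning results, with \<open>S\<close> the zero function it yields uniqueness.\<close>
lemma lattice_recursion_closure:
  fixes G :: "weight \<Rightarrow> 'a \<Rightarrow> complex"
  assumes add: "\<And>f g. f \<in> S \<Longrightarrow> g \<in> S \<Longrightarrow> (\<lambda>t. f t + g t) \<in> S"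
    and scale: "\<And>f c. f \<in> S \<Longrightarrow> (\<lambda>t. c * f t) \<in> S"
    and rec1: "\<And>i j t. G (i + 1, j) t + G (i - 1, j + 1) t + G (i, j - 1) t = c1 * G (i, j) t"
    and rec2: "\<And>i j t. G (i, j + 1) t + G (i + 1, j - 1) t + G (i - 1, j) t = c2 * G (i, j) t"
    and base: "\<And>\<zeta>. \<zeta> \<in> {(-1, 0), (0, 0), (1, 0), (-1, 1), (0, 1), (1, 1)} \<Longrightarrow> G \<zeta> \<in> S"
  shows "G \<zeta> \<in> S"
proof -
  have lin3: "(\<lambda>t. a * f t + b * g t + c * h t) \<in> S" if "f \<in> S" "g \<in> S" "h \<in> S" for a b c f g h
    using that by (intro add scale)
  \<comment> \<open>Subtracting the second recursion at \<open>(i, j)\<close> from the first at \<open>(i + 1, j)\<close> removes the rows above and below.\<close>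
  have row: "G (i + 2, j) t = c1 * G (i + 1, j) t - c2 * G (i, j) t + G (i - 1, j) t" for i j t
  proof -
    have "G (i + 2, j) t = c1 * G (i + 1, j) t - (G (i, j + 1) t + G (i + 1, j - 1) t)"
      using rec1[of "i + 1" j t] by (simp add: algebra_simps)
    moreover have "G (i, j + 1) t + G (i + 1, j - 1) t = c2 * G (i, j) t - G (i - 1, j) t"
      using rec2[of i j t] by (simp add: algebra_simps)
    ultimately show ?thesis by simp
  qed
  have up: "G (i, j + 2) = (\<lambda>t. c1 * G (i + 1, j + 1) t + (-1) * G (i + 2, j + 1) t + (-1) * G (i + 1, j) t)" for i j
    using rec1[of "i + 1" "j + 1"] by (auto simp: fun_eq_iff algebra_simps)
  have down: "G (i, j - 1) = (\<lambda>t. c1 * G (i, j) t + (-1) * G (i + 1, j) t + (-1) * G (i - 1, j + 1) t)" for i j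
    using rec1[of i j] by (auto simp: fun_eq_iff algebra_simps)
  have whole_row: "G (i, j) \<in> S" if "G (-1, j) \<in> S" "G (0, j) \<in> S" "G (1, j) \<in> S" for i j
  proof -
    have "G (i - 1, j) \<in> S \<and> G (i, j) \<in> S \<and> G (i + 1, j) \<in> S"
    proof (induction i rule: int_induct[of _ 0])
      case base
      then show ?case using that by simp
    next
      case (step1 i)
      have "G (i + 2, j) = (\<lambda>t. c1 * G (i + 1, j) t + (- c2) * G (i, j) t + 1 * G (i - 1, j) t)"
        using row[of i j] by (auto simp: fun_eq_iff)
      then have "G (i + 2, j) \<in> S" using step1 by (simp only: lin3)
      then show ?case using step1 by (simp add: algebra_simps)
    next
      case (step2 i)
      have "G (i - 2, j) = (\<lambda>t. (- c1) * G (i, j) t + c2 * G (i - 1, j) t + 1 * G (i + 1, j) t)"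
        using row[of "i - 1" j] by (auto simp: fun_eq_iff algebra_simps)
      then have "G (i - 2, j) \<in> S" using step2 by (simp only: lin3)
      then show ?case using step2 by (simp add: algebra_simps)
    qed
    then show ?thesis by simp
  qed
  have "(\<forall>i. G (i, j) \<in> S) \<and> (\<forall>i. G (i, j + 1) \<in> S)" for j
  proof (induction j rule: int_induct[of _ 0])
    case base
    then show ?case using whole_row assms(5) by simp
  next
    case (step1 j)
    have "G (i, j + 2) \<in> S" for i
      unfolding up using step1 by (simp only: lin3)
    then show ?case using step1 by (simp add: algebra_simps)
  next
    case (step2 j)
    have "G (i, j - 1) \<in> S" for i
      unfolding down using step2 by (simp only: lin3)
    then show ?case using step2 by simp
  qed
  then show ?thesis by (cases \<zeta>) simp
qed

definition ev :: "complex \<Rightarrow> complex \<Rightarrow> weight \<Rightarrow> complex" where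
  "ev X Y \<nu> = X powi fst \<nu> * Y powi snd \<nu>"

text \<open>A point of the maximal torus, given by the values \<open>X\<close> and \<open>Y\<close> of the exponentials of \<open>\<Lambda>\<^sub>1\<close> and \<open>\<Lambda>\<^sub>2\<close>. The characters
are Laurent polynomials in these values and make sense at the zeros of the Weyl denominator too, which occur
for some points of \<open>E_set p\<close>.\<close>
locale torus_point =
  fixes X Y :: complex
  assumes nz: "X \<noteq> 0" "Y \<noteq> 0"
begin

lemma ev_add: "ev X Y (\<nu> + \<eta>) = ev X Y \<eta> * ev X Y \<nu>"
  using nz by (simp add: ev_def power_int_add)

definition sl3_char :: "weight \<Rightarrow> complex" where
  "sl3_char \<kappa> = pairing (weight_mult \<kappa>) (ev X Y)"

definition fund1 :: complex where "fund1 = X + Y / X + 1 / Y"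
definition fund2 :: complex where "fund2 = Y + X / Y + 1 / X"

lemma sl3_char_weyl: "w \<in> weyl \<Longrightarrow> sl3_char (w \<kappa>) = of_int (wdet w) * sl3_char \<kappa>"
  unfolding sl3_char_def pairing_def
  by (simp add: weight_mult_antisym infsum_cmult_right'[symmetric] mult.assoc)

lemma sl3_char_rho: "sl3_char (1, 1) = 1"
proof -
  have "sl3_char \<rho> = (\<Sum>\<nu>\<in>{0}. of_int (weight_mult \<rho> \<nu>) * ev X Y \<nu>)"
    unfolding sl3_char_def by (rule pairing_sum_support) (auto simp: weight_mult_rho)
  then show ?thesis by (simp add: weight_mult_rho ev_def) (simp add: weight_simps)
qed

lemma sl3_char_shift: "pairing (\<lambda>\<nu>. weight_mult \<kappa> (\<nu> - \<eta>)) (ev X Y) = ev X Y \<eta> * sl3_char \<kappa>"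
  by (simp add: pairing_shift ev_add pairing_cmult sl3_char_def)

lemma sl3_char_sum3:
  assumes "\<And>\<nu>. weight_mult \<kappa>1 \<nu> + weight_mult \<kappa>2 \<nu> + weight_mult \<kappa>3 \<nu> =
    weight_mult \<kappa> (\<nu> - \<eta>1) + weight_mult \<kappa> (\<nu> - \<eta>2) + weight_mult \<kappa> (\<nu> - \<eta>3)"
  shows "sl3_char \<kappa>1 + sl3_char \<kappa>2 + sl3_char \<kappa>3 = (ev X Y \<eta>1 + ev X Y \<eta>2 + ev X Y \<eta>3) * sl3_char \<kappa>"
proof -
  have three: "pairing (\<lambda>\<nu>. g1 \<nu> + g2 \<nu> + g3 \<nu>) f = pairing g1 f + pairing g2 f + pairing g3 f"
    if "finite {\<nu>. g1 \<nu> \<noteq> 0}" "finite {\<nu>. g2 \<nu> \<noteq> 0}" "finite {\<nu>. g3 \<nu> \<noteq> 0}" for g1 g2 g3 f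
    using pairing_left_sum[of "{0::nat, 1, 2}" "\<lambda>a. if a = 0 then g1 else if a = 1 then g2 else g3" "\<lambda>_. 1" f] that
    by (simp add: add.assoc)
  have "sl3_char \<kappa>1 + sl3_char \<kappa>2 + sl3_char \<kappa>3 =
    pairing (\<lambda>\<nu>. weight_mult \<kappa>1 \<nu> + weight_mult \<kappa>2 \<nu> + weight_mult \<kappa>3 \<nu>) (ev X Y)"
    by (simp add: three finite_weight_mult sl3_char_def)
  also have "\<dots> = (ev X Y \<eta>1 + ev X Y \<eta>2 + ev X Y \<eta>3) * sl3_char \<kappa>"
    unfolding assms by (subst three) (simp_all add: finite_weight_mult finite_shift sl3_char_shift algebra_simps)
  finally show ?thesis .
qed

lemma sl3_char_rec1: "sl3_char (i + 1, j) + sl3_char (i - 1, j + 1) + sl3_char (i, j - 1) = fund1 * sl3_char (i, j)"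
  using sl3_char_sum3[OF weight_mult_tensor_1[of "(i, j)"]] nz
  by (simp add: ev_def fund1_def field_simps)

lemma sl3_char_rec2: "sl3_char (i, j + 1) + sl3_char (i + 1, j - 1) + sl3_char (i - 1, j) = fund2 * sl3_char (i, j)"
  using sl3_char_sum3[OF weight_mult_tensor_2[of "(i, j)"]] nz
  by (simp add: ev_def fund2_def field_simps)

lemma sl3_char_denominator:
  "(\<Sum>v\<in>weyl. of_int (wdet v) * ev X Y (v \<rho>)) * sl3_char \<kappa> = (\<Sum>w\<in>weyl. of_int (wdet w) * ev X Y (w \<kappa>))"
  using pairing_mult_denominator[of \<kappa> "ev X Y"]
  by (simp add: ev_add pairing_cmult sl3_char_def sum_distrib_right mult.assoc)

lemma sl3_char_s1: "sl3_char (- a, a + b) = - sl3_char (a, b)" and sl3_char_s2: "sl3_char (a + b, - b) = - sl3_char (a, b)"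
  using sl3_char_weyl[OF weyl_s1, of "(a, b)"] sl3_char_weyl[OF weyl_s2, of "(a, b)"]
  by (simp_all add: s1_pair s2_pair)

lemma sl3_char_wall: "sl3_char (0, b) = 0" "sl3_char (a, 0) = 0" "sl3_char (a, - a) = 0"
  using sl3_char_s1[of 0 b] sl3_char_s2[of a 0] sl3_char_s1[of "- a" 0] sl3_char_s2[of a 0] sl3_char_s2[of "- a" 0] by simp_all

end

section \<open>The honeycomb and its adjacency operator\<close>

definition honeycomb :: "weight set" where
  "honeycomb = {(a, b). 3 dvd (a - b) \<and> \<not> 3 dvd a}"

lemma honeycomb_iff: "(a, b) \<in> honeycomb \<longleftrightarrow> 3 dvd (a - b) \<and> \<not> 3 dvd a"
  by (simp add: honeycomb_def)

lemma honeycomb_weyl: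
  assumes "w \<in> weyl" "\<tau> \<in> honeycomb"
  shows "w \<tau> \<in> honeycomb"
  using assms
proof (induction rule: weyl_induct)
  case (2 w)
  then show ?case by (cases "w \<tau>") (auto simp: s1_pair honeycomb_iff; presburger)
next
  case (3 w)
  then show ?case by (cases "w \<tau>") (auto simp: s2_pair honeycomb_iff; presburger)
qed auto

text \<open>The roots \<open>w \<rho>\<close> with \<open>det w = 1\<close> are \<open>(1, 1)\<close> modulo \<open>3\<close> and those with \<open>det w = -1\<close> are \<open>(2, 2)\<close>, while the
honeycomb is bipartite with the same two classes. From a given point three of the six roots thus lead to
neighbours and the other three to points of \<open>3P\<close>.\<close>
lemma honeycomb_neighbour:
  assumes "w \<in> weyl" "\<tau> \<in> honeycomb"
  shows "\<tau> + w \<rho> \<in> honeycomb \<longleftrightarrow> (wdet w = 1 \<longleftrightarrow> fst \<tau> mod 3 = 1)"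
    and "\<tau> - w \<rho> \<in> honeycomb \<longleftrightarrow> (wdet w = 1 \<longleftrightarrow> fst \<tau> mod 3 = 2)"
proof -
  obtain a b where \<tau>: "\<tau> = (a, b)" by (cases \<tau>)
  have ab: "3 dvd (a - b)" "\<not> 3 dvd a" using assms(2) by (auto simp: \<tau> honeycomb_iff)
  show "\<tau> + w \<rho> \<in> honeycomb \<longleftrightarrow> (wdet w = 1 \<longleftrightarrow> fst \<tau> mod 3 = 1)"
    using assms(1) by (cases rule: weyl_cases; use ab in \<open>simp add: \<tau> weight_simps honeycomb_iff; presburger\<close>)
  show "\<tau> - w \<rho> \<in> honeycomb \<longleftrightarrow> (wdet w = 1 \<longleftrightarrow> fst \<tau> mod 3 = 2)"
    using assms(1) by (cases rule: weyl_cases; use ab in \<open>simp add: \<tau> weight_simps honeycomb_iff; presburger\<close>)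
qed

lemma wdet_cases: "w \<in> weyl \<Longrightarrow> wdet w = 1 \<or> wdet w = -1"
  by (erule weyl_cases) auto

text \<open>The step from \<open>\<tau>\<close> to \<open>\<tau> + \<xi>\<close> is composed of a root \<open>w \<rho>\<close> and a weight \<open>\<xi> - w \<rho>\<close>. On the left the
root comes first and has to be an edge of the honeycomb at \<open>\<tau>\<close>, on the right it comes last and has to be an
edge at \<open>\<tau> + \<xi>\<close>. For end points of different classes the conditions coincide. For end points of the same
class they are complementary, and the difference is up to sign the alternating sum of all six multiplicities,
which by the character formula is nonzero only on the orbit of \<open>\<kappa>\<close>; but here \<open>\<xi>\<close> is in \<open>3P\<close>
and \<open>\<kappa>\<close> is not.\<close>
lemma weight_mult_root_balance:
  assumes \<kappa>: "\<kappa> \<in> honeycomb" and "\<tau> \<in> honeycomb" "\<tau> + \<xi> \<in> honeycomb"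
  shows "(\<Sum>w\<in>weyl. (if \<tau> + w \<rho> \<in> honeycomb then 1 else 0) * weight_mult \<kappa> (\<xi> - w \<rho>)) =
         (\<Sum>w\<in>weyl. (if \<tau> + \<xi> - w \<rho> \<in> honeycomb then 1 else 0) * weight_mult \<kappa> (\<xi> - w \<rho>))"
    (is "?L = ?R")
proof (cases "fst \<tau> mod 3 = fst (\<tau> + \<xi>) mod 3")
  case False
  have "fst \<tau> mod 3 \<noteq> 0" "fst (\<tau> + \<xi>) mod 3 \<noteq> 0"
    using assms(2,3) by (cases \<tau>; cases \<xi>; simp add: honeycomb_iff dvd_eq_mod_eq_0)+
  with False have "fst \<tau> mod 3 = 1 \<longleftrightarrow> fst (\<tau> + \<xi>) mod 3 = 2" by presburger
  then show ?thesis
    by (intro sum.cong) (simp_all add: honeycomb_neighbour assms)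
next
  case True
  have nz: "fst \<tau> mod 3 = 1 \<or> fst \<tau> mod 3 = 2"
    using assms(2) by (cases \<tau>; simp add: honeycomb_iff; presburger)
  have "\<xi> \<noteq> w \<kappa>" if "w \<in> weyl" for w
  proof
    assume "\<xi> = w \<kappa>"
    then have "\<xi> \<in> honeycomb" using honeycomb_weyl[OF that \<kappa>] by simp
    moreover have "3 dvd fst \<xi>" using True by (cases \<tau>; cases \<xi>; simp; presburger)
    ultimately show False by (cases \<xi>) (simp add: honeycomb_iff)
  qed
  then have "(\<Sum>w\<in>weyl. wdet w * weight_mult \<kappa> (\<xi> - w \<rho>)) = 0"
    unfolding weight_mult_denominator by (intro sum.neutral) auto
  moreover have "?L - ?R = (if fst \<tau> mod 3 = 1 then 1 else -1) *
      (\<Sum>w\<in>weyl. wdet w * weight_mult \<kappa> (\<xi> - w \<rho>))"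
    unfolding sum_subtractf[symmetric] sum_distrib_left
  proof (intro sum.cong refl)
    fix w assume w: "w \<in> weyl"
    show "(if \<tau> + w \<rho> \<in> honeycomb then 1 else 0) * weight_mult \<kappa> (\<xi> - w \<rho>) -
        (if \<tau> + \<xi> - w \<rho> \<in> honeycomb then 1 else 0) * weight_mult \<kappa> (\<xi> - w \<rho>) =
        (if fst \<tau> mod 3 = 1 then 1 else - 1) * (wdet w * weight_mult \<kappa> (\<xi> - w \<rho>))"
      unfolding honeycomb_neighbour(1)[OF w assms(2)] honeycomb_neighbour(2)[OF w assms(3)] True[symmetric]
      using nz wdet_cases[OF w] by auto
  qed
  ultimately show ?thesis by simp
qed

text \<open>The adjacency operator of the honeycomb commutes with convolution by the multiplicities of a highest
weight whose shift by \<open>\<rho>\<close> lies in the honeycomb.\<close>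
lemma convolution_commutes:
  assumes \<kappa>: "\<kappa> \<in> honeycomb" and \<tau>: "\<tau> \<in> honeycomb"
    and f: "\<And>\<xi>. \<xi> \<notin> honeycomb \<Longrightarrow> f \<xi> = 0"
  shows "pairing (weight_mult \<kappa>)
      (\<lambda>\<eta>. (if \<tau> + \<eta> \<in> honeycomb then 1 else 0) * (\<Sum>w\<in>weyl. f (\<tau> + \<eta> + w \<rho>))) =
    (\<Sum>w\<in>weyl. (if \<tau> + w \<rho> \<in> honeycomb then 1 else 0) * pairing (weight_mult \<kappa>) (\<lambda>\<eta>. f (\<tau> + w \<rho> + \<eta>)))"
    (is "?L = ?R")
proof -
  let ?h = "\<lambda>\<xi>. if \<xi> \<in> honeycomb then 1 else 0"
  have "?L = (\<Sum>w\<in>weyl. pairing (weight_mult \<kappa>) (\<lambda>\<eta>. ?h (\<tau> + \<eta>) * f (\<tau> + \<eta> + w \<rho>)))"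
    by (simp only: pairing_sum[OF finite_weight_mult, symmetric] sum_distrib_left)
  also have "\<dots> = (\<Sum>w\<in>weyl. pairing (\<lambda>\<xi>. weight_mult \<kappa> (\<xi> - w \<rho>)) (\<lambda>\<xi>. ?h (\<tau> + \<xi> - w \<rho>) * f (\<tau> + \<xi>)))"
    by (simp add: pairing_shift algebra_simps)
  also have "\<dots> = (\<Sum>w\<in>weyl. pairing (\<lambda>\<xi>. ?h (\<tau> + \<xi> - w \<rho>) * weight_mult \<kappa> (\<xi> - w \<rho>)) (\<lambda>\<xi>. f (\<tau> + \<xi>)))"
    unfolding pairing_def by (intro sum.cong refl infsum_cong) simp
  also have "\<dots> = pairing (\<lambda>\<xi>. \<Sum>w\<in>weyl. 1 * (?h (\<tau> + \<xi> - w \<rho>) * weight_mult \<kappa> (\<xi> - w \<rho>))) (\<lambda>\<xi>. f (\<tau> + \<xi>))"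
  proof (subst pairing_left_sum)
    show "finite {\<xi>. ?h (\<tau> + \<xi> - w \<rho>) * weight_mult \<kappa> (\<xi> - w \<rho>) \<noteq> 0}" for w
      by (rule finite_subset[OF _ finite_shift[OF finite_weight_mult[of \<kappa>], of "w \<rho>"]]) auto
  qed simp_all
  also have "\<dots> = pairing (\<lambda>\<xi>. \<Sum>w\<in>weyl. ?h (\<tau> + w \<rho>) * weight_mult \<kappa> (\<xi> - w \<rho>)) (\<lambda>\<xi>. f (\<tau> + \<xi>))"
    unfolding pairing_def
  proof (intro infsum_cong)
    fix \<xi>
    show "of_int (\<Sum>w\<in>weyl. 1 * (?h (\<tau> + \<xi> - w \<rho>) * weight_mult \<kappa> (\<xi> - w \<rho>))) * f (\<tau> + \<xi>) =
      of_int (\<Sum>w\<in>weyl. ?h (\<tau> + w \<rho>) * weight_mult \<kappa> (\<xi> - w \<rho>)) * f (\<tau> + \<xi>)"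
    proof (cases "\<tau> + \<xi> \<in> honeycomb")
      case True
      then show ?thesis using weight_mult_root_balance[OF \<kappa> \<tau> True] by simp
    next
      case False
      then show ?thesis by (simp add: f)
    qed
  qed
  also have "\<dots> = (\<Sum>w\<in>weyl. of_int (?h (\<tau> + w \<rho>)) * pairing (\<lambda>\<xi>. weight_mult \<kappa> (\<xi> - w \<rho>)) (\<lambda>\<xi>. f (\<tau> + \<xi>)))"
    by (rule pairing_left_sum) (simp_all add: finite_shift finite_weight_mult)
  also have "\<dots> = ?R"
    by (intro sum.cong refl) (simp add: pairing_shift algebra_simps)
  finally show ?thesis .
qed

context torus_point
begin

text \<open>The character function transported to \<open>3P\<close> and extended by zero, so that sums over all six roots
pick out the relevant vertices automatically.\<close>
definition char3 :: "weight \<Rightarrow> complex" where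
  "char3 \<xi> = (if 3 dvd fst \<xi> \<and> 3 dvd snd \<xi> then sl3_char (fst \<xi> div 3, snd \<xi> div 3) else 0)"

lemma char3_scale: "char3 (3 * i, 3 * j) = sl3_char (i, j)"
  by (simp add: char3_def)

lemma char3_weyl: "w \<in> weyl \<Longrightarrow> char3 (w \<xi>) = of_int (wdet w) * char3 \<xi>"
proof -
  have s1: "char3 (s\<^sub>1 \<xi>) = - char3 \<xi>" for \<xi>
  proof (cases "3 dvd fst \<xi> \<and> 3 dvd snd \<xi>")
    case True
    then obtain i j where "\<xi> = (3 * i, 3 * j)" by (cases \<xi>) (auto elim!: dvdE)
    then show ?thesis
      using char3_scale[of "- i" "i + j"] char3_scale[of i j] sl3_char_s1[of i j] by (simp add: s1_pair algebra_simps)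
  next
    case False
    then show ?thesis by (cases \<xi>) (auto simp: char3_def s1_pair dvd_add_right_iff)
  qed
  have s2: "char3 (s\<^sub>2 \<xi>) = - char3 \<xi>" for \<xi>
  proof (cases "3 dvd fst \<xi> \<and> 3 dvd snd \<xi>")
    case True
    then obtain i j where "\<xi> = (3 * i, 3 * j)" by (cases \<xi>) (auto elim!: dvdE)
    then show ?thesis
      using char3_scale[of "i + j" "- j"] char3_scale[of i j] sl3_char_s2[of i j] by (simp add: s2_pair algebra_simps)
  next
    case False
    then show ?thesis by (cases \<xi>) (auto simp: char3_def s2_pair dvd_add_left_iff)
  qed
  show "w \<in> weyl \<Longrightarrow> char3 (w \<xi>) = of_int (wdet w) * char3 \<xi>"
  proof (induction rule: weyl_induct)
    case (2 w)
    have "char3 ((s\<^sub>1 \<circ> w) \<xi>) = of_int (wdet (s\<^sub>1 \<circ> w)) * char3 \<xi>"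
      using 2 by (simp add: s1 wdet_comp)
    then show ?case .
  next
    case (3 w)
    have "char3 ((s\<^sub>2 \<circ> w) \<xi>) = of_int (wdet (s\<^sub>2 \<circ> w)) * char3 \<xi>"
      using 3 by (simp add: s2 wdet_comp)
    then show ?case .
  next
    case 1
    have "char3 (id \<xi>) = of_int (wdet id) * char3 \<xi>" by simp
    then show ?case .
  qed
qed

lemma char3_rec:
  shows "char3 (\<xi> + (3, 0)) + char3 (\<xi> + (-3, 3)) + char3 (\<xi> + (0, -3)) = fund1 * char3 \<xi>" (is ?A)
    and "char3 (\<xi> + (0, 3)) + char3 (\<xi> + (3, -3)) + char3 (\<xi> + (-3, 0)) = fund2 * char3 \<xi>" (is ?B)
proof -
  have "?A \<and> ?B"
  proof (cases "3 dvd fst \<xi> \<and> 3 dvd snd \<xi>")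
    case True
    then obtain i j where \<xi>: "\<xi> = (3 * i, 3 * j)" by (cases \<xi>) (auto elim!: dvdE)
    have "\<xi> + (3, 0) = (3 * (i + 1), 3 * j)" "\<xi> + (-3, 3) = (3 * (i - 1), 3 * (j + 1))"
      "\<xi> + (0, -3) = (3 * i, 3 * (j - 1))" "\<xi> + (0, 3) = (3 * i, 3 * (j + 1))"
      "\<xi> + (3, -3) = (3 * (i + 1), 3 * (j - 1))" "\<xi> + (-3, 0) = (3 * (i - 1), 3 * j)"
      by (simp_all add: \<xi>)
    then show ?thesis
      using sl3_char_rec1[of i j] sl3_char_rec2[of i j] by (simp only: \<xi> char3_scale)
  next
    case False
    have "char3 (\<xi> + (x, y)) = 0" if "3 dvd x" "3 dvd y" for x y
      using that False by (cases \<xi>) (auto simp: char3_def dvd_add_left_iff)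
    moreover have "char3 \<xi> = 0" using False by (auto simp: char3_def)
    ultimately show ?thesis by simp
  qed
  then show ?A ?B by simp_all
qed

definition orbit_sum :: "weight \<Rightarrow> weight \<Rightarrow> complex" where
  "orbit_sum \<tau> \<eta> = (\<Sum>w\<in>weyl. char3 (\<tau> + w \<eta>))"

lemma orbit_sum_weyl: "u \<in> weyl \<Longrightarrow> orbit_sum \<tau> (u \<eta>) = orbit_sum \<tau> \<eta>"
  unfolding orbit_sum_def using sum_weyl_right[of u "\<lambda>w. char3 (\<tau> + w \<eta>)"] by simp

lemma orbit_sum_weyl_left: "u \<in> weyl \<Longrightarrow> orbit_sum (u \<tau>) \<eta> = of_int (wdet u) * orbit_sum \<tau> \<eta>"
proof -
  assume u: "u \<in> weyl"
  have "orbit_sum (u \<tau>) \<eta> = (\<Sum>w\<in>weyl. char3 (u \<tau> + (u \<circ> w) \<eta>))"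
    unfolding orbit_sum_def using sum_weyl_left[OF u, of "\<lambda>w. char3 (u \<tau> + w \<eta>)"] by simp
  also have "\<dots> = of_int (wdet u) * orbit_sum \<tau> \<eta>"
    by (simp add: orbit_sum_def weyl_add[OF u, symmetric] char3_weyl[OF u] sum_distrib_left)
  finally show ?thesis .
qed

text \<open>A summand can be nonzero only if \<open>w \<eta>\<close> is congruent to \<open>- \<tau>\<close> modulo \<open>3P\<close>, and the honeycomb is a union of
classes modulo \<open>3P\<close>, stable under negation and under the Weyl group.\<close>
lemma orbit_sum_outside:
  assumes "\<tau> \<in> honeycomb" "\<eta> \<notin> honeycomb"
  shows "orbit_sum \<tau> \<eta> = 0"
  unfolding orbit_sum_def
proof (intro sum.neutral ballI)
  fix w assume w: "w \<in> weyl"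
  have "w \<eta> \<notin> honeycomb" using honeycomb_weyl[OF weyl_inv[OF w], of "w \<eta>"] assms(2) w by auto
  then show "char3 (\<tau> + w \<eta>) = 0"
    using assms(1) by (cases \<tau>; cases "w \<eta>"; simp add: char3_def honeycomb_iff; presburger)
qed

lemma orbit_sum_outside_left:
  assumes "\<tau> \<notin> honeycomb" "\<eta> \<in> honeycomb"
  shows "orbit_sum \<tau> \<eta> = 0"
  unfolding orbit_sum_def
proof (intro sum.neutral ballI)
  fix w assume w: "w \<in> weyl"
  have "w \<eta> \<in> honeycomb" using honeycomb_weyl[OF w assms(2)] .
  then show "char3 (\<tau> + w \<eta>) = 0"
    using assms(1) by (cases \<tau>; cases "w \<eta>"; simp add: char3_def honeycomb_iff; presburger)
qed

lemma orbit_sum_rec: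
  shows "orbit_sum \<tau> (\<eta> + (3, 0)) + orbit_sum \<tau> (\<eta> + (-3, 3)) + orbit_sum \<tau> (\<eta> + (0, -3)) = fund1 * orbit_sum \<tau> \<eta>"
    and "orbit_sum \<tau> (\<eta> + (0, 3)) + orbit_sum \<tau> (\<eta> + (3, -3)) + orbit_sum \<tau> (\<eta> + (-3, 0)) = fund2 * orbit_sum \<tau> \<eta>"
proof -
  show "orbit_sum \<tau> (\<eta> + (3, 0)) + orbit_sum \<tau> (\<eta> + (-3, 3)) + orbit_sum \<tau> (\<eta> + (0, -3)) = fund1 * orbit_sum \<tau> \<eta>"
    unfolding orbit_sum_def sum.distrib[symmetric] sum_distrib_left
  proof (intro sum.cong refl)
    fix w assume w: "w \<in> weyl"
    show "char3 (\<tau> + w (\<eta> + (3, 0))) + char3 (\<tau> + w (\<eta> + (- 3, 3))) + char3 (\<tau> + w (\<eta> + (0, - 3))) =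
        fund1 * char3 (\<tau> + w \<eta>)"
      unfolding char3_rec(1)[symmetric] weyl_add[OF w] add.assoc[symmetric]
      using w by (cases rule: weyl_cases) (simp_all add: s1_pair s2_pair)
  qed
  show "orbit_sum \<tau> (\<eta> + (0, 3)) + orbit_sum \<tau> (\<eta> + (3, -3)) + orbit_sum \<tau> (\<eta> + (-3, 0)) = fund2 * orbit_sum \<tau> \<eta>"
    unfolding orbit_sum_def sum.distrib[symmetric] sum_distrib_left
  proof (intro sum.cong refl)
    fix w assume w: "w \<in> weyl"
    show "char3 (\<tau> + w (\<eta> + (0, 3))) + char3 (\<tau> + w (\<eta> + (3, - 3))) + char3 (\<tau> + w (\<eta> + (- 3, 0))) =
        fund2 * char3 (\<tau> + w \<eta>)"
      unfolding char3_rec(2)[symmetric] weyl_add[OF w] add.assoc[symmetric]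
      using w by (cases rule: weyl_cases) (simp_all add: s1_pair s2_pair)
  qed
qed

text \<open>For \<open>\<tau>\<close> in the honeycomb, three of the six summands vanish because their arguments are not in \<open>3P\<close>. The
other three belong, in \<open>shell1\<close>, to the vertices of the alcove around \<open>\<tau>\<close>, and in \<open>shell2\<close> to the mirror
images of these vertices in the opposite sides.\<close>
abbreviation shell1 :: "weight \<Rightarrow> complex" where "shell1 \<tau> \<equiv> orbit_sum \<tau> (1, 1)"
abbreviation shell2 :: "weight \<Rightarrow> complex" where "shell2 \<tau> \<equiv> orbit_sum \<tau> (2, 2)"

lemma orbit_sum_roots:
  "orbit_sum \<tau> (2, -1) = shell1 \<tau>" "orbit_sum \<tau> (-1, 2) = shell1 \<tau>" "orbit_sum \<tau> (-2, 1) = shell1 \<tau>"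
  "orbit_sum \<tau> (1, -2) = shell1 \<tau>" "orbit_sum \<tau> (-1, -1) = shell1 \<tau>"
  "orbit_sum \<tau> (4, -2) = shell2 \<tau>" "orbit_sum \<tau> (-2, 4) = shell2 \<tau>" "orbit_sum \<tau> (-4, 2) = shell2 \<tau>"
  "orbit_sum \<tau> (2, -4) = shell2 \<tau>" "orbit_sum \<tau> (-2, -2) = shell2 \<tau>"
proof -
  have 1: "orbit_sum \<tau> (- a, a + b) = orbit_sum \<tau> (a, b)"
    and 2: "orbit_sum \<tau> (a + b, - b) = orbit_sum \<tau> (a, b)" for a b
    using orbit_sum_weyl[OF weyl_s1, of \<tau> "(a, b)"] orbit_sum_weyl[OF weyl_s2, of \<tau> "(a, b)"]
    by (simp_all add: s1_pair s2_pair)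
  show "orbit_sum \<tau> (2, -1) = shell1 \<tau>" "orbit_sum \<tau> (-1, 2) = shell1 \<tau>"
    "orbit_sum \<tau> (-2, 1) = shell1 \<tau>" "orbit_sum \<tau> (1, -2) = shell1 \<tau>"
    "orbit_sum \<tau> (-1, -1) = shell1 \<tau>"
    using 2[of 1 1] 1[of 1 1] 1[of 2 "-1"] 2[of "-1" 2] 1[of 1 "-2"] by simp_all
  show "orbit_sum \<tau> (4, -2) = shell2 \<tau>" "orbit_sum \<tau> (-2, 4) = shell2 \<tau>"
    "orbit_sum \<tau> (-4, 2) = shell2 \<tau>" "orbit_sum \<tau> (2, -4) = shell2 \<tau>"
    "orbit_sum \<tau> (-2, -2) = shell2 \<tau>"
    using 2[of 2 2] 1[of 2 2] 1[of 4 "-2"] 2[of "-2" 4] 1[of 2 "-4"] by simp_all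
qed

end

section \<open>The eigenfunction of the adjacency operator and its product formula\<close>

lemma card_weyl [simp]: "card weyl = 6"
  using sum_weyl[of "\<lambda>_. 1::int"] by simp

context torus_point
begin

text \<open>As a function of \<open>\<eta>\<close> the orbit sum satisfies the two fundamental recursions with step \<open>3\<close>, and at the six
initial positions around \<open>- \<rho>\<close> it is a shell, or a combination of shells by one recursion step. The coefficients do not depend
on \<open>\<tau>\<close>, since the recursions do not.\<close>
lemma orbit_sum_span:
  "\<exists>a b. \<forall>\<tau>\<in>honeycomb. orbit_sum \<tau> \<eta> = a * shell1 \<tau> + b * shell2 \<tau>"
proof -
  define S where "S = {f. \<exists>a b. \<forall>\<tau>\<in>honeycomb. f \<tau> = a * shell1 \<tau> + b * shell2 \<tau>}"
  define G where "G = (\<lambda>\<zeta> \<tau>. orbit_sum \<tau> (3 * fst \<zeta> - 1, 3 * snd \<zeta> - 1))"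
  have mem: "f \<in> S" if "\<And>\<tau>. \<tau> \<in> honeycomb \<Longrightarrow> f \<tau> = a * shell1 \<tau> + b * shell2 \<tau>" for f a b
    using that unfolding S_def by blast
  have G: "G \<zeta> \<in> S" for \<zeta>
  proof (rule lattice_recursion_closure[of S G fund1 fund2])
    fix f g assume "f \<in> S" "g \<in> S"
    then obtain a b a' b' where "\<forall>\<tau>\<in>honeycomb. f \<tau> = a * shell1 \<tau> + b * shell2 \<tau>"
      "\<forall>\<tau>\<in>honeycomb. g \<tau> = a' * shell1 \<tau> + b' * shell2 \<tau>" unfolding S_def by blast
    then show "(\<lambda>\<tau>. f \<tau> + g \<tau>) \<in> S"
      by (intro mem[of _ "a + a'" "b + b'"]) (simp add: algebra_simps)
  next
    fix f c assume "f \<in> S"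
    then obtain a b where "\<forall>\<tau>\<in>honeycomb. f \<tau> = a * shell1 \<tau> + b * shell2 \<tau>" unfolding S_def by blast
    then show "(\<lambda>\<tau>. c * f \<tau>) \<in> S"
      by (intro mem[of _ "c * a" "c * b"]) (simp add: algebra_simps)
  next
    fix i j \<tau>
    show "G (i + 1, j) \<tau> + G (i - 1, j + 1) \<tau> + G (i, j - 1) \<tau> = fund1 * G (i, j) \<tau>"
      using orbit_sum_rec(1)[of \<tau> "(3 * i - 1, 3 * j - 1)"] by (simp add: G_def algebra_simps)
    show "G (i, j + 1) \<tau> + G (i + 1, j - 1) \<tau> + G (i - 1, j) \<tau> = fund2 * G (i, j) \<tau>"
      using orbit_sum_rec(2)[of \<tau> "(3 * i - 1, 3 * j - 1)"] by (simp add: G_def algebra_simps)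
  next
    have s1: "(\<lambda>\<tau>. shell1 \<tau>) \<in> S" by (rule mem[of _ 1 0]) simp
    have s2: "(\<lambda>\<tau>. shell2 \<tau>) \<in> S" by (rule mem[of _ 0 1]) simp
    \<comment> \<open>The position \<open>\<zeta> = (-1, 0)\<close> is reached from \<open>\<zeta> = (0, 0)\<close> by one recursion step.\<close>
    have s3: "(\<lambda>\<tau>. orbit_sum \<tau> (-4, -1)) \<in> S"
    proof (rule mem[of _ "fund2 - 1" "-1"])
      show "orbit_sum \<tau> (-4, -1) = (fund2 - 1) * shell1 \<tau> + -1 * shell2 \<tau>" for \<tau>
        using orbit_sum_rec(2)[of \<tau> "(-1, -1)"] by (simp add: orbit_sum_roots algebra_simps)
    qed
    fix \<zeta> :: weight assume "\<zeta> \<in> {(-1, 0), (0, 0), (1, 0), (-1, 1), (0, 1), (1, 1)}"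
    then show "G \<zeta> \<in> S" using s1 s2 s3 by (auto simp: G_def orbit_sum_roots)
  qed
  obtain a b where \<eta>: "\<eta> = (a, b)" by (cases \<eta>)
  consider "\<eta> \<notin> honeycomb" | "\<eta> \<in> honeycomb" "a mod 3 = 2" | "\<eta> \<in> honeycomb" "a mod 3 = 1"
  proof -
    have "a mod 3 = 1 \<or> a mod 3 = 2" if "\<eta> \<in> honeycomb"
      using that unfolding \<eta> honeycomb_iff by presburger
    then show thesis using that by blast
  qed
  then have "(\<lambda>\<tau>. orbit_sum \<tau> \<eta>) \<in> S"
  proof cases
    case 1
    then show ?thesis by (intro mem[of _ 0 0]) (simp add: orbit_sum_outside)
  next
    case 2
    then have "a = 3 * ((a + 1) div 3) - 1" "b = 3 * ((b + 1) div 3) - 1"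
      unfolding \<eta> honeycomb_iff by presburger+
    then have "(\<lambda>\<tau>. orbit_sum \<tau> \<eta>) = G ((a + 1) div 3, (b + 1) div 3)"
      by (simp add: G_def \<eta>)
    then show ?thesis using G by simp
  next
    case 3
    then have "- a = 3 * ((- a + 1) div 3) - 1" "a + b = 3 * ((a + b + 1) div 3) - 1"
      unfolding \<eta> honeycomb_iff by presburger+
    then have "(\<lambda>\<tau>. orbit_sum \<tau> (s\<^sub>1 \<eta>)) = G ((- a + 1) div 3, (a + b + 1) div 3)"
      by (simp add: G_def \<eta> s1_pair)
    then show ?thesis using G by (simp add: orbit_sum_weyl)
  qed
  then show ?thesis unfolding S_def by simp
qed

text \<open>Replace the inner summation variable by \<open>w \<circ> v\<close> and exchange the sums.\<close>
lemma orbit_sum_average: "(\<Sum>w\<in>weyl. orbit_sum (\<tau> + w \<eta>) \<xi>) = (\<Sum>v\<in>weyl. orbit_sum \<tau> (\<eta> + v \<xi>))"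
proof -
  have "(\<Sum>w\<in>weyl. orbit_sum (\<tau> + w \<eta>) \<xi>) = (\<Sum>w\<in>weyl. \<Sum>v\<in>weyl. char3 (\<tau> + w \<eta> + (w \<circ> v) \<xi>))"
    unfolding orbit_sum_def
  proof (rule sum.cong[OF refl])
    fix w assume "w \<in> weyl"
    then show "(\<Sum>v\<in>weyl. char3 (\<tau> + w \<eta> + v \<xi>)) = (\<Sum>v\<in>weyl. char3 (\<tau> + w \<eta> + (w \<circ> v) \<xi>))"
      using sum_weyl_left[of w "\<lambda>v. char3 (\<tau> + w \<eta> + v \<xi>)"] by simp
  qed
  also have "\<dots> = (\<Sum>v\<in>weyl. \<Sum>w\<in>weyl. char3 (\<tau> + w \<eta> + (w \<circ> v) \<xi>))" by (rule sum.swap)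
  also have "\<dots> = (\<Sum>v\<in>weyl. orbit_sum \<tau> (\<eta> + v \<xi>))"
    unfolding orbit_sum_def by (intro sum.cong refl) (simp add: weyl_add add.assoc)
  finally show ?thesis .
qed

text \<open>The adjacency operator on the first shell: among the weights \<open>\<rho> + v \<rho>\<close> one is \<open>2 \<rho>\<close>, two are roots,
and the others lie in \<open>3P\<close> and contribute nothing.\<close>
lemma neighbour_sum_shell1:
  assumes "\<tau> \<in> honeycomb"
  shows "(\<Sum>w\<in>weyl. shell1 (\<tau> + w \<rho>)) = 2 * shell1 \<tau> + shell2 \<tau>"
proof -
  have "orbit_sum \<tau> (0, 3) = 0" "orbit_sum \<tau> (3, 0) = 0" "orbit_sum \<tau> (0, 0) = 0"
    using assms by (auto intro!: orbit_sum_outside simp: honeycomb_iff)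
  then show ?thesis
    unfolding orbit_sum_average by (simp add: sum_weyl weight_simps orbit_sum_roots)
qed

lemma neighbour_sum_shell2:
  assumes "\<tau> \<in> honeycomb"
  shows "(\<Sum>w\<in>weyl. shell2 (\<tau> + w \<rho>)) = (fund1 + fund2 - 1) * shell1 \<tau> - 2 * shell2 \<tau>"
proof -
  have 0: "orbit_sum \<tau> (3, 3) = 0" "orbit_sum \<tau> (-3, 3) = 0" "orbit_sum \<tau> (3, -3) = 0"
    using assms by (auto intro!: orbit_sum_outside simp: honeycomb_iff)
  have e: "orbit_sum \<tau> (5, -1) = orbit_sum \<tau> (4, 1)" "orbit_sum \<tau> (-1, 5) = orbit_sum \<tau> (1, 4)"
    using orbit_sum_weyl[OF weyl_s2, of \<tau> "(4, 1)"] orbit_sum_weyl[OF weyl_s1, of \<tau> "(1, 4)"]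
    by (simp_all add: s1_pair s2_pair)
  have o1: "orbit_sum \<tau> (4, 1) = fund1 * shell1 \<tau> - shell2 \<tau> - shell1 \<tau>"
    using orbit_sum_rec(1)[of \<tau> "(1, 1)"] by (simp add: orbit_sum_roots algebra_simps)
  have o2: "orbit_sum \<tau> (1, 4) = fund2 * shell1 \<tau> - shell2 \<tau> - shell1 \<tau>"
    using orbit_sum_rec(2)[of \<tau> "(1, 1)"] by (simp add: orbit_sum_roots algebra_simps)
  have "(\<Sum>w\<in>weyl. shell2 (\<tau> + w \<rho>)) = orbit_sum \<tau> (-1, 5) + orbit_sum \<tau> (5, -1) + shell1 \<tau>"
    unfolding orbit_sum_average by (simp add: sum_weyl weight_simps orbit_sum_roots 0)
  then show ?thesis unfolding e o1 o2 by (simp add: algebra_simps)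
qed

lemma shell_outside: "\<tau> \<notin> honeycomb \<Longrightarrow> shell1 \<tau> = 0" "\<tau> \<notin> honeycomb \<Longrightarrow> shell2 \<tau> = 0"
  by (auto intro!: orbit_sum_outside_left simp: honeycomb_iff)

text \<open>By Weyl invariance of the multiplicities the convolution is the pairing with an average over the Weyl group, that is with
orbit sums, each of which is a combination of the two shells.\<close>
lemma convolution_shell1:
  "\<exists>a b. \<forall>\<tau>\<in>honeycomb. pairing (weight_mult \<kappa>) (\<lambda>\<eta>. shell1 (\<tau> + \<eta>)) = a * shell1 \<tau> + b * shell2 \<tau>"
proof -
  obtain A B where AB: "\<And>\<tau> \<eta>. \<tau> \<in> honeycomb \<Longrightarrow> orbit_sum \<tau> \<eta> = A \<eta> * shell1 \<tau> + B \<eta> * shell2 \<tau>"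
    using orbit_sum_span by metis
  define a where "a = (\<Sum>v\<in>weyl. pairing (weight_mult \<kappa>) (\<lambda>\<eta>. A (\<eta> + v (1, 1)))) / 6"
  define b where "b = (\<Sum>v\<in>weyl. pairing (weight_mult \<kappa>) (\<lambda>\<eta>. B (\<eta> + v (1, 1)))) / 6"
  have "pairing (weight_mult \<kappa>) (\<lambda>\<eta>. shell1 (\<tau> + \<eta>)) = a * shell1 \<tau> + b * shell2 \<tau>"
    if \<tau>: "\<tau> \<in> honeycomb" for \<tau>
  proof -
    have "6 * pairing (weight_mult \<kappa>) (\<lambda>\<eta>. shell1 (\<tau> + \<eta>)) =
        (\<Sum>w\<in>weyl. pairing (weight_mult \<kappa>) (\<lambda>\<eta>. shell1 (\<tau> + \<eta>)))"
      by (simp add: sum_weyl)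
    also have "\<dots> = (\<Sum>w\<in>weyl. pairing (weight_mult \<kappa>) (\<lambda>\<eta>. shell1 (\<tau> + w \<eta>)))"
      by (intro sum.cong refl pairing_weyl[symmetric]) (simp_all add: weight_mult_weyl)
    also have "\<dots> = pairing (weight_mult \<kappa>) (\<lambda>\<eta>. \<Sum>v\<in>weyl. orbit_sum \<tau> (\<eta> + v (1, 1)))"
      by (simp add: pairing_sum[OF finite_weight_mult, symmetric] orbit_sum_average)
    also have "\<dots> = (\<Sum>v\<in>weyl. pairing (weight_mult \<kappa>) (\<lambda>\<eta>. shell1 \<tau> * A (\<eta> + v (1, 1)) + shell2 \<tau> * B (\<eta> + v (1, 1))))"
      unfolding AB[OF \<tau>, of "_ + _"] pairing_sum[OF finite_weight_mult] by (simp add: mult.commute)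
    also have "\<dots> = 6 * (a * shell1 \<tau> + b * shell2 \<tau>)"
      by (simp add: pairing_add[OF finite_weight_mult] pairing_cmult sum.distrib sum_distrib_left[symmetric] a_def b_def)
    finally show ?thesis by (subst (asm) mult_cancel_left) simp
  qed
  then show ?thesis by blast
qed

end

text \<open>The adjacency operator has trace \<open>0\<close> and determinant \<open>- F\<^sup>2\<close> on the span of the two shells, so its
eigenvalues there are the two square roots of \<open>3 + fund1 + fund2\<close>; \<open>F\<close> is a choice of one of them.\<close>
locale honeycomb_mode = torus_point +
  fixes F :: complex
  assumes F_sq: "F ^ 2 = 3 + fund1 + fund2"
begin

definition mode :: "weight \<Rightarrow> complex" where
  "mode \<tau> = (F + 2) * shell1 \<tau> + shell2 \<tau>"

lemma mode_outside: "\<tau> \<notin> honeycomb \<Longrightarrow> mode \<tau> = 0"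
  by (simp add: mode_def shell_outside)

lemma mode_weyl: "w \<in> weyl \<Longrightarrow> mode (w \<tau>) = of_int (wdet w) * mode \<tau>"
  by (simp add: mode_def orbit_sum_weyl_left algebra_simps)

lemma mode_rho: "mode \<rho> = 1"
  using sl3_char_wall(3)[of "-1"]
  by (simp add: mode_def orbit_sum_def sum_weyl weight_simps char3_def sl3_char_wall sl3_char_rho)

text \<open>Convolution commutes with the adjacency operator, for which the first shell is a cyclic vector of the
span of the two shells. It acts there as \<open>a + b (A - 2)\<close>, where \<open>a\<close> and \<open>b\<close> express its value on the first
shell.\<close>
lemma convolution_mode:
  assumes \<kappa>: "\<kappa> \<in> honeycomb"
  shows "\<exists>c. \<forall>\<tau>\<in>honeycomb. pairing (weight_mult \<kappa>) (\<lambda>\<eta>. mode (\<tau> + \<eta>)) = c * mode \<tau>"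
proof -
  obtain a b where ab: "\<And>\<tau>. \<tau> \<in> honeycomb \<Longrightarrow>
      pairing (weight_mult \<kappa>) (\<lambda>\<eta>. shell1 (\<tau> + \<eta>)) = a * shell1 \<tau> + b * shell2 \<tau>"
    using convolution_shell1[of \<kappa>] by blast
  have "pairing (weight_mult \<kappa>) (\<lambda>\<eta>. mode (\<tau> + \<eta>)) = (a + b * (F - 2)) * mode \<tau>"
    if \<tau>: "\<tau> \<in> honeycomb" for \<tau>
  proof -
    let ?h = "\<lambda>\<xi>. if \<xi> \<in> honeycomb then 1 else 0 :: complex"
    have "2 * pairing (weight_mult \<kappa>) (\<lambda>\<eta>. shell1 (\<tau> + \<eta>)) + pairing (weight_mult \<kappa>) (\<lambda>\<eta>. shell2 (\<tau> + \<eta>)) =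
        pairing (weight_mult \<kappa>) (\<lambda>\<eta>. 2 * shell1 (\<tau> + \<eta>) + shell2 (\<tau> + \<eta>))"
      by (simp add: pairing_add[OF finite_weight_mult] pairing_cmult)
    also have "\<dots> = pairing (weight_mult \<kappa>) (\<lambda>\<eta>. ?h (\<tau> + \<eta>) * (\<Sum>w\<in>weyl. shell1 (\<tau> + \<eta> + w \<rho>)))"
      by (intro arg_cong2[where f = pairing] ext refl) (auto simp: neighbour_sum_shell1 shell_outside)
    also have "\<dots> = (\<Sum>w\<in>weyl. ?h (\<tau> + w \<rho>) * pairing (weight_mult \<kappa>) (\<lambda>\<eta>. shell1 (\<tau> + w \<rho> + \<eta>)))"
      by (rule convolution_commutes[OF \<kappa> \<tau> shell_outside(1)])
    also have "\<dots> = (\<Sum>w\<in>weyl. a * shell1 (\<tau> + w \<rho>) + b * shell2 (\<tau> + w \<rho>))"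
      by (intro sum.cong refl) (auto simp: ab shell_outside)
    also have "\<dots> = a * (2 * shell1 \<tau> + shell2 \<tau>) + b * ((F ^ 2 - 4) * shell1 \<tau> - 2 * shell2 \<tau>)"
      by (simp add: sum.distrib sum_distrib_left[symmetric] neighbour_sum_shell1 neighbour_sum_shell2 \<tau> F_sq)
    finally have 1: "2 * pairing (weight_mult \<kappa>) (\<lambda>\<eta>. shell1 (\<tau> + \<eta>)) + pairing (weight_mult \<kappa>) (\<lambda>\<eta>. shell2 (\<tau> + \<eta>)) =
        a * (2 * shell1 \<tau> + shell2 \<tau>) + b * ((F ^ 2 - 4) * shell1 \<tau> - 2 * shell2 \<tau>)" .
    have "pairing (weight_mult \<kappa>) (\<lambda>\<eta>. shell2 (\<tau> + \<eta>)) =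
        (a * (2 * shell1 \<tau> + shell2 \<tau>) + b * ((F ^ 2 - 4) * shell1 \<tau> - 2 * shell2 \<tau>)) -
        2 * (a * shell1 \<tau> + b * shell2 \<tau>)"
      unfolding 1[symmetric] ab[OF \<tau>, symmetric] by simp
    then have 2: "pairing (weight_mult \<kappa>) (\<lambda>\<eta>. shell2 (\<tau> + \<eta>)) =
        a * shell2 \<tau> + b * ((F ^ 2 - 4) * shell1 \<tau> - 4 * shell2 \<tau>)"
      by (simp add: algebra_simps)
    have "pairing (weight_mult \<kappa>) (\<lambda>\<eta>. mode (\<tau> + \<eta>)) =
        (F + 2) * (a * shell1 \<tau> + b * shell2 \<tau>) + (a * shell2 \<tau> + b * ((F ^ 2 - 4) * shell1 \<tau> - 4 * shell2 \<tau>))"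
      unfolding mode_def by (simp only: pairing_add[OF finite_weight_mult] pairing_cmult 2 ab[OF \<tau>])
    also have "\<dots> = (a + b * (F - 2)) * mode \<tau>"
      by (simp add: mode_def algebra_simps power2_eq_square)
    finally show ?thesis .
  qed
  then show ?thesis by blast
qed

text \<open>The eigenvalue can be read off at \<open>\<tau> = \<rho>\<close>, where the eigenfunction is \<open>1\<close>: averaging over the Weyl group turns
the convolution at \<open>\<rho>\<close> into the character formula against the eigenfunction, which evaluates it
at \<open>\<kappa>\<close>.\<close>
theorem mode_product:
  assumes \<kappa>: "\<kappa> \<in> honeycomb" and \<tau>: "\<tau> \<in> honeycomb"
  shows "pairing (weight_mult \<kappa>) (\<lambda>\<eta>. mode (\<tau> + \<eta>)) = mode \<kappa> * mode \<tau>"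
proof -
  obtain c where c: "\<And>\<tau>. \<tau> \<in> honeycomb \<Longrightarrow> pairing (weight_mult \<kappa>) (\<lambda>\<eta>. mode (\<tau> + \<eta>)) = c * mode \<tau>"
    using convolution_mode[OF \<kappa>] by blast
  have "\<rho> \<in> honeycomb" by (simp add: weight_simps honeycomb_iff)
  from c[OF this] have c\<rho>: "pairing (weight_mult \<kappa>) (\<lambda>\<eta>. mode (\<eta> + \<rho>)) = c"
    by (simp add: mode_rho add.commute)
  have "of_int (wdet v) * pairing (weight_mult \<kappa>) (\<lambda>\<eta>. mode (\<eta> + v \<rho>)) = c" if v: "v \<in> weyl" for v
  proof -
    have "pairing (weight_mult \<kappa>) (\<lambda>\<eta>. mode (\<eta> + v \<rho>)) = pairing (weight_mult \<kappa>) (\<lambda>\<eta>. mode (v \<eta> + v \<rho>))"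
      by (rule pairing_weyl[OF v, symmetric]) (simp add: weight_mult_weyl v)
    also have "\<dots> = of_int (wdet v) * c"
      by (simp add: weyl_add[OF v, symmetric] mode_weyl[OF v] pairing_cmult c\<rho>)
    finally show ?thesis
      using wdet_square[OF v] by (metis mult.assoc mult_1 of_int_1 of_int_mult)
  qed
  then have "(\<Sum>v\<in>weyl. of_int (wdet v) * pairing (weight_mult \<kappa>) (\<lambda>\<eta>. mode (\<eta> + v \<rho>))) = 6 * c"
    by (simp add: sum_weyl)
  moreover have "(\<Sum>w\<in>weyl. of_int (wdet w) * mode (w \<kappa>)) = 6 * mode \<kappa>"
  proof -
    have "of_int (wdet w) * mode (w \<kappa>) = mode \<kappa>" if "w \<in> weyl" for w
      using wdet_square[OF that] by (metis mode_weyl[OF that] mult.assoc mult_1 of_int_1 of_int_mult)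
    then show ?thesis by (simp add: sum_weyl)
  qed
  ultimately have "c = mode \<kappa>" using pairing_mult_denominator[of \<kappa> mode] by simp
  then show ?thesis using c[OF \<tau>] by simp
qed

end

section \<open>Folding sums onto the fundamental alcove\<close>

definition alcove :: "int \<Rightarrow> weight set" where
  "alcove h = {(a, b). 0 < a \<and> 0 < b \<and> a + b < h}"

lemma alcove_iff: "(a, b) \<in> alcove h \<longleftrightarrow> 0 < a \<and> 0 < b \<and> a + b < h"
  by (simp add: alcove_def)

lemma finite_alcove [simp]: "finite (alcove h)"
  by (rule finite_subset[of _ "{0..h} \<times> {0..h}"]) (auto simp: alcove_def)

lemma multiple_between:
  fixes h k :: int
  assumes "h > 0"
  shows "- h < h * k \<Longrightarrow> h * k < h \<Longrightarrow> k = 0" and "0 < h * k \<Longrightarrow> h * k < 2 * h \<Longrightarrow> k = 1"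
proof -
  have "h * i < h * j \<longleftrightarrow> i < j" for i j using assms by simp
  from this[of "-1" k] this[of k 1] show "- h < h * k \<Longrightarrow> h * k < h \<Longrightarrow> k = 0" by simp
  have "h * i < h * j \<longleftrightarrow> i < j" for i j using assms by simp
  from this[of 0 k] this[of k 2] show "0 < h * k \<Longrightarrow> h * k < 2 * h \<Longrightarrow> k = 1"
    by (simp add: mult.commute)
qed

text \<open>Every equation between coordinates has the form \<open>h k = c\<close> with \<open>c\<close> confined to an interval of length \<open>2 h\<close>, so
each of \<open>k\<close> and \<open>l\<close> is \<open>0\<close> or \<open>1\<close>. For a nontrivial \<open>w\<close> the resulting pair is not in the root lattice, or,
for the longest element, violates the bound on the sum of the coordinates.\<close>
lemma alcove_fundamental:
  assumes h: "h > 0" and w: "w \<in> weyl" and \<beta>: "\<beta> \<in> root_lattice"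
    and \<zeta>: "\<zeta> \<in> alcove h" "w \<zeta> + scale h \<beta> \<in> alcove h"
  shows "w = id \<and> \<beta> = 0"
proof -
  obtain a b where ab: "\<zeta> = (a, b)" by (cases \<zeta>)
  obtain m n where mn: "\<beta> = (2 * m - n, 2 * n - m)" using \<beta> by (rule root_lattice_coords)
  define k where "k = 2 * m - n"
  define l where "l = 2 * n - m"
  \<comment> \<open>These pairs are the labels of \<open>\<Lambda>\<^sub>1\<close> and \<open>\<Lambda>\<^sub>2\<close>, which are not in the root lattice.\<close>
  have kl: "(k, l) \<noteq> (1, 0)" "(k, l) \<noteq> (0, 1)" unfolding k_def l_def by (simp_all, presburger+)
  have pos: "a > 0" "b > 0" "a + b < h" using \<zeta>(1) by (auto simp: ab alcove_iff)
  define K where "K = h * k"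
  define L where "L = h * l"
  note zero = multiple_between(1)[OF h, of k, folded K_def] multiple_between(1)[OF h, of l, folded L_def]
    and one = multiple_between(2)[OF h, of k, folded K_def] multiple_between(2)[OF h, of l, folded L_def]
  from \<zeta>(2) have w2: "w (a, b) + (K, L) \<in> alcove h"
    by (simp add: ab mn scale_def k_def l_def K_def L_def)
  show ?thesis
  proof (use w in \<open>cases rule: weyl_cases\<close>)
    case id
    then have "k = 0" "l = 0" using w2 pos by (auto simp: alcove_iff intro!: zero)
    then show ?thesis using id by (simp add: mn k_def l_def zero_prod_def)
  next
    case s1
    then have "k = 1" "l = 0" using w2 pos by (auto simp: alcove_iff s1_pair intro!: zero one)
    then show ?thesis using kl by simp
  next
    case s2
    then have "k = 0" "l = 1" using w2 pos by (auto simp: alcove_iff s2_pair intro!: zero one)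
    then show ?thesis using kl by simp
  next
    case s12
    then have "k = 1" "l = 0" using w2 pos by (auto simp: alcove_iff s1_pair s2_pair intro!: zero one)
    then show ?thesis using kl by simp
  next
    case s21
    then have "k = 0" "l = 1" using w2 pos by (auto simp: alcove_iff s1_pair s2_pair intro!: zero one)
    then show ?thesis using kl by simp
  next
    case s121
    then have "k = 1" "l = 1" using w2 pos by (auto simp: alcove_iff s1_pair s2_pair intro!: one)
    then have "K = h" "L = h" by (simp_all add: K_def L_def)
    then show ?thesis using w2 pos s121 by (auto simp: alcove_iff s1_pair s2_pair)
  qed
qed

text \<open>Induction on the squared distance to the barycentre \<open>(h/3, h/3)\<close>, up to a constant factor: reflection in a wall that
separates \<open>\<kappa>\<close> from the alcove decreases it.\<close>
lemma closed_alcove_exists: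
  assumes h: "h > 0"
  shows "\<exists>w\<in>weyl. \<exists>\<beta>\<in>root_lattice. \<exists>a b. 0 \<le> a \<and> 0 \<le> b \<and> a + b \<le> h \<and> \<kappa> = w (a, b) + scale h \<beta>"
proof (induction "nat ((3 * fst \<kappa> - h)^2 + (3 * fst \<kappa> - h) * (3 * snd \<kappa> - h) + (3 * snd \<kappa> - h)^2)"
    arbitrary: \<kappa> rule: less_induct)
  case less
  define D where "D = (\<lambda>\<kappa>::weight. (3 * fst \<kappa> - h)^2 + (3 * fst \<kappa> - h) * (3 * snd \<kappa> - h) + (3 * snd \<kappa> - h)^2)"
  have D_nonneg: "D \<kappa> \<ge> 0" for \<kappa>
  proof -
    have "2 * D \<kappa> = (3 * fst \<kappa> - h)^2 + (3 * snd \<kappa> - h)^2 + ((3 * fst \<kappa> - h) + (3 * snd \<kappa> - h))^2"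
      unfolding D_def by algebra
    then show ?thesis by (smt (verit) zero_le_power2)
  qed
  have IH: "\<exists>w\<in>weyl. \<exists>\<beta>\<in>root_lattice. \<exists>a b. 0 \<le> a \<and> 0 \<le> b \<and> a + b \<le> h \<and> \<kappa> = w (a, b) + scale h \<beta>"
    if "\<kappa>' = u \<kappa> + scale h \<gamma>" "u \<in> weyl" "\<gamma> \<in> root_lattice" "D \<kappa>' < D \<kappa>" for \<kappa>' u \<gamma>
  proof -
    have "nat (D \<kappa>') < nat (D \<kappa>)" using that(4) D_nonneg[of \<kappa>'] by linarith
    then obtain w \<beta> a b where w: "w \<in> weyl" "\<beta> \<in> root_lattice" "0 \<le> a" "0 \<le> b" "a + b \<le> h"
      "\<kappa>' = w (a, b) + scale h \<beta>" using less[of \<kappa>'] unfolding D_def by blast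
    have "\<kappa> = inv u (\<kappa>' - scale h \<gamma>)" using that by simp
    also have "\<dots> = (inv u \<circ> w) (a, b) + scale h (inv u (\<beta> - \<gamma>))"
    proof -
      have "scale h (\<beta> - \<gamma>) = scale h \<beta> - scale h \<gamma>" by (simp add: scale_def algebra_simps)
      then have "\<kappa>' - scale h \<gamma> = w (a, b) + scale h (\<beta> - \<gamma>)" using w by simp
      then show ?thesis using weyl_inv[OF that(2)] by (simp add: weyl_add weyl_scale)
    qed
    finally have "\<kappa> = (inv u \<circ> w) (a, b) + scale h (inv u (\<beta> - \<gamma>))" .
    moreover have "inv u \<circ> w \<in> weyl" using w that weyl_comp weyl_inv by blast
    moreover have "inv u (\<beta> - \<gamma>) \<in> root_lattice"
      using root_lattice_add[OF w(2) root_lattice_minus[OF that(3)]] root_lattice_weyl[OF weyl_inv[OF that(2)]]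
      by simp
    ultimately show ?thesis using w by blast
  qed
  obtain a b where ab: "\<kappa> = (a, b)" by (cases \<kappa>)
  have s121: "s\<^sub>1 \<circ> s\<^sub>2 \<circ> s\<^sub>1 \<in> weyl" by (simp add: weyl_eq)
  have zero: "(0, 0) \<in> root_lattice" and one: "(1, 1) \<in> root_lattice" by (simp_all add: root_lattice_iff)
  consider "a < 0" | "b < 0" | "a + b > h" | "0 \<le> a" "0 \<le> b" "a + b \<le> h" by linarith
  then show ?case
  proof cases
    case 1
    have "D (- a, a + b) = D \<kappa> + 9 * (h * a)" unfolding D_def ab by (simp add: power2_eq_square algebra_simps)
    moreover have "h * a < 0" using h 1 by (simp add: mult_pos_neg)
    ultimately show ?thesis
      by (intro IH[of "(- a, a + b)" s\<^sub>1 "(0, 0)"] zero weyl_s1) (simp_all add: ab s1_pair scale_def mult.commute)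
  next
    case 2
    have "D (a + b, - b) = D \<kappa> + 9 * (h * b)" unfolding D_def ab by (simp add: power2_eq_square algebra_simps)
    moreover have "h * b < 0" using h 2 by (simp add: mult_pos_neg)
    ultimately show ?thesis
      by (intro IH[of "(a + b, - b)" s\<^sub>2 "(0, 0)"] zero weyl_s2) (simp_all add: ab s2_pair scale_def mult.commute)
  next
    case 3
    have "D (h - b, h - a) = D \<kappa> - 9 * (h * (a + b - h))" unfolding D_def ab by (simp add: power2_eq_square algebra_simps)
    moreover have "h * (a + b - h) > 0" using h 3 by simp
    ultimately show ?thesis
      by (intro IH[of "(h - b, h - a)" "s\<^sub>1 \<circ> s\<^sub>2 \<circ> s\<^sub>1" "(1, 1)"] one s121) (simp_all add: ab s1_pair s2_pair scale_def mult.commute)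
  next
    case 4
    then have "0 \<le> a \<and> 0 \<le> b \<and> a + b \<le> h \<and> \<kappa> = id (a, b) + scale h (0, 0)"
      by (simp add: ab scale_def)
    then show ?thesis using zero weyl_id by blast
  qed
qed

definition affine_antisym :: "int \<Rightarrow> (weight \<Rightarrow> complex) \<Rightarrow> bool" where
  "affine_antisym h \<Phi> \<longleftrightarrow>
     (\<forall>w\<in>weyl. \<forall>\<kappa>. \<Phi> (w \<kappa>) = of_int (wdet w) * \<Phi> \<kappa>) \<and>
     (\<forall>\<beta>\<in>root_lattice. \<forall>\<kappa>. \<Phi> (\<kappa> + scale h \<beta>) = \<Phi> \<kappa>)"

lemma affine_antisym_orbit:
  assumes "affine_antisym h \<Phi>" "w \<in> weyl" "\<beta> \<in> root_lattice"
  shows "\<Phi> (w \<kappa> + scale h \<beta>) = of_int (wdet w) * \<Phi> \<kappa>"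
  using assms unfolding affine_antisym_def by metis

text \<open>Such a \<open>\<kappa>\<close> is equivalent to a point on a wall of the alcove, and a reflection fixes it.\<close>
lemma affine_antisym_zero:
  assumes h: "h > 0" and \<Phi>: "affine_antisym h \<Phi>"
    and out: "\<And>w \<beta> \<zeta>. w \<in> weyl \<Longrightarrow> \<beta> \<in> root_lattice \<Longrightarrow> \<zeta> \<in> alcove h \<Longrightarrow> \<kappa> \<noteq> w \<zeta> + scale h \<beta>"
  shows "\<Phi> \<kappa> = 0"
proof -
  obtain w \<beta> a b where w: "w \<in> weyl" "\<beta> \<in> root_lattice" "0 \<le> a" "0 \<le> b" "a + b \<le> h"
    "\<kappa> = w (a, b) + scale h \<beta>" using closed_alcove_exists[OF h] by blast
  then have "(a, b) \<notin> alcove h" using out by blast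
  with w consider "a = 0" | "b = 0" | "a + b = h" by (force simp: alcove_iff)
  then have "\<Phi> (a, b) = 0"
  proof cases
    case 1
    then have "\<Phi> (a, b) = - \<Phi> (a, b)"
      using \<Phi> weyl_s1 s1_pair[of a b] unfolding affine_antisym_def
      by (metis add_0 add.inverse_neutral mult_minus_left mult_1 of_int_1 of_int_minus wdet_weyl(2))
    then show ?thesis by simp
  next
    case 2
    then have "\<Phi> (a, b) = - \<Phi> (a, b)"
      using \<Phi> weyl_s2 s2_pair[of a b] unfolding affine_antisym_def
      by (metis add.right_neutral add.inverse_neutral mult_minus_left mult_1 of_int_1 of_int_minus wdet_weyl(3))
    then show ?thesis by simp
  next
    case 3
    have "\<Phi> ((s\<^sub>1 \<circ> s\<^sub>2 \<circ> s\<^sub>1) (a, b)) = - \<Phi> (a, b)"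
      using \<Phi> unfolding affine_antisym_def by (simp add: weyl_eq)
    moreover have "(1, 1) \<in> root_lattice" by (simp add: root_lattice_iff)
    then have "\<Phi> ((s\<^sub>1 \<circ> s\<^sub>2 \<circ> s\<^sub>1) (a, b) + scale h (1, 1)) = \<Phi> ((s\<^sub>1 \<circ> s\<^sub>2 \<circ> s\<^sub>1) (a, b))"
      using \<Phi> unfolding affine_antisym_def by blast
    moreover have "(s\<^sub>1 \<circ> s\<^sub>2 \<circ> s\<^sub>1) (a, b) + scale h (1, 1) = (a, b)"
      using 3 by (simp add: s1_pair s2_pair scale_def)
    ultimately have "\<Phi> (a, b) = - \<Phi> (a, b)" by simp
    then show ?thesis by simp
  qed
  moreover have "\<Phi> \<kappa> = of_int (wdet w) * \<Phi> (a, b)"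
    using w affine_antisym_orbit[OF \<Phi>] by metis
  ultimately show ?thesis by simp
qed

lemma alcove_orbit_inj:
  assumes h: "h > 0"
  shows "inj_on (\<lambda>(\<zeta>, w, \<beta>). w \<zeta> + scale h \<beta>) (alcove h \<times> (weyl \<times> root_lattice))"
proof (rule inj_onI)
  fix d d' assume d: "d \<in> alcove h \<times> (weyl \<times> root_lattice)" "d' \<in> alcove h \<times> (weyl \<times> root_lattice)"
    and eq0: "(\<lambda>(\<zeta>, w, \<beta>). w \<zeta> + scale h \<beta>) d = (\<lambda>(\<zeta>, w, \<beta>). w \<zeta> + scale h \<beta>) d'"
  obtain \<zeta> w \<beta> \<zeta>' w' \<beta>' where dd: "d = (\<zeta>, w, \<beta>)" "d' = (\<zeta>', w', \<beta>')"
    by (metis prod_cases3)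
  have 1: "\<zeta> \<in> alcove h" "w \<in> weyl" "\<beta> \<in> root_lattice"
    and 2: "\<zeta>' \<in> alcove h" "w' \<in> weyl" "\<beta>' \<in> root_lattice"
    and eq: "w \<zeta> + scale h \<beta> = w' \<zeta>' + scale h \<beta>'"
    using d eq0 by (auto simp: dd)
  have "scale h (\<beta> - \<beta>') = scale h \<beta> - scale h \<beta>'" by (simp add: scale_def algebra_simps)
  then have "w \<zeta> + scale h (\<beta> - \<beta>') = w' \<zeta>'" using eq by (simp add: add_diff_eq)
  then have *: "(inv w' \<circ> w) \<zeta> + scale h (inv w' (\<beta> - \<beta>')) = \<zeta>'"
    using weyl_inv[OF 2(2)] weyl_inv_left[OF 2(2)] by (metis o_apply weyl_add weyl_scale)
  have "inv w' \<circ> w = id \<and> inv w' (\<beta> - \<beta>') = 0"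
  proof (rule alcove_fundamental[OF h _ _ 1(1)])
    show "inv w' \<circ> w \<in> weyl" by (rule weyl_comp[OF weyl_inv[OF 2(2)] 1(2)])
    show "inv w' (\<beta> - \<beta>') \<in> root_lattice"
      using root_lattice_add[OF 1(3) root_lattice_minus[OF 2(3)]] root_lattice_weyl[OF weyl_inv[OF 2(2)]] by simp
    show "(inv w' \<circ> w) \<zeta> + scale h (inv w' (\<beta> - \<beta>')) \<in> alcove h" using * 2(1) by simp
  qed
  then have i: "inv w' \<circ> w = id" and b: "inv w' (\<beta> - \<beta>') = 0" by simp_all
  have "w = w' \<circ> (inv w' \<circ> w)" using weyl_comp_inv(3)[OF 2(2)] by simp
  then have w: "w = w'" unfolding i by simp
  have "\<beta> - \<beta>' = w' 0" using b weyl_inv_right[OF 2(2), of "\<beta> - \<beta>'"] by simp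
  moreover have "w' 0 = 0" using weyl_diff[OF 2(2), of 0 0] by simp
  ultimately have "\<beta> = \<beta>'" by simp
  moreover have "\<zeta> = \<zeta>'" using * i b by (simp add: scale_def flip: zero_prod_def)
  ultimately show "d = d'" using w by (simp add: dd)
qed

text \<open>The alternating sum over the affine Weyl group of level \<open>h\<close> in the Kac--Walton formula.\<close>
definition affine_sum :: "int \<Rightarrow> (weight \<Rightarrow> int) \<Rightarrow> weight \<Rightarrow> int" where
  "affine_sum h g \<zeta> = (\<Sum>\<^sub>\<infinity>(w, \<beta>)\<in>weyl \<times> root_lattice. wdet w * g (w \<zeta> + scale h \<beta>))"

lemma scale_inj: "h \<noteq> 0 \<Longrightarrow> scale h \<beta> = scale h \<gamma> \<longleftrightarrow> \<beta> = \<gamma>"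
  by (cases \<beta>; cases \<gamma>) (simp add: scale_def)

lemma affine_sum_finite:
  assumes "h \<noteq> 0" "finite {\<nu>. g \<nu> \<noteq> 0}"
  shows "finite {e \<in> weyl \<times> root_lattice. (case e of (w, \<beta>) \<Rightarrow> wdet w * g (w \<zeta> + scale h \<beta>)) \<noteq> 0}"
proof -
  have "finite {\<beta>. g (w \<zeta> + scale h \<beta>) \<noteq> 0}" for w
    by (rule finite_imageD[of "\<lambda>\<beta>. w \<zeta> + scale h \<beta>"])
       (auto intro!: finite_subset[OF _ assms(2)] inj_onI simp: scale_inj assms(1))
  then have "finite (SIGMA w:weyl. {\<beta>. g (w \<zeta> + scale h \<beta>) \<noteq> 0})" by simp
  then show ?thesis by (rule finite_subset[rotated]) auto
qed

text \<open>The affine Weyl group acts freely on the orbits of interior points of the alcove, and the remaining points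
do not contribute.\<close>
theorem fold_onto_alcove:
  assumes h: "h > 0" and \<Phi>: "affine_antisym h \<Phi>" and g: "finite {\<nu>. g \<nu> \<noteq> 0}"
  shows "pairing g \<Phi> = (\<Sum>\<zeta>\<in>alcove h. of_int (affine_sum h g \<zeta>) * \<Phi> \<zeta>)"
proof -
  let ?q = "\<lambda>(\<zeta>, w, \<beta>). w \<zeta> + scale h \<beta>" and ?D = "alcove h \<times> (weyl \<times> root_lattice)"
  let ?f = "\<lambda>\<kappa>. of_int (g \<kappa>) * \<Phi> \<kappa>"
  have inj: "inj_on ?q ?D" by (rule alcove_orbit_inj[OF h])
  have "pairing g \<Phi> = infsum ?f (?q ` ?D)"
    unfolding pairing_def
  proof (rule infsum_cong_neutral)
    fix \<kappa> assume "\<kappa> \<in> UNIV - ?q ` ?D"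
    then have "\<Phi> \<kappa> = 0" by (intro affine_antisym_zero[OF h \<Phi>]) force
    then show "?f \<kappa> = 0" by simp
  qed auto
  also have "\<dots> = (\<Sum>\<^sub>\<infinity>d\<in>?D. ?f (?q d))"
    using infsum_reindex[OF inj, of ?f] by (simp add: o_def)
  also have "\<dots> = (\<Sum>\<^sub>\<infinity>\<zeta>\<in>alcove h. \<Sum>\<^sub>\<infinity>e\<in>weyl \<times> root_lattice. ?f (?q (\<zeta>, e)))"
  proof (rule infsum_Sigma_banach[symmetric])
    have "finite {d \<in> ?D. ?f (?q d) \<noteq> 0}"
    proof (rule finite_imageD[of ?q])
      show "finite (?q ` {d \<in> ?D. ?f (?q d) \<noteq> 0})"
        by (rule finite_subset[OF _ g]) auto
      show "inj_on ?q {d \<in> ?D. ?f (?q d) \<noteq> 0}" using inj by (rule inj_on_subset) auto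
    qed
    then show "(\<lambda>d. ?f (?q d)) summable_on ?D" by (rule finite_nonzero_values_imp_summable_on)
  qed
  also have "\<dots> = (\<Sum>\<zeta>\<in>alcove h. \<Sum>\<^sub>\<infinity>e\<in>weyl \<times> root_lattice. ?f (?q (\<zeta>, e)))" by simp
  also have "\<dots> = (\<Sum>\<zeta>\<in>alcove h. of_int (affine_sum h g \<zeta>) * \<Phi> \<zeta>)"
  proof (intro sum.cong refl)
    fix \<zeta>
    let ?d = "\<lambda>(w, \<beta>). wdet w * g (w \<zeta> + scale h \<beta>)"
    have fin: "finite {e \<in> weyl \<times> root_lattice. ?d e \<noteq> 0}"
      by (rule affine_sum_finite) (use h g in auto)
    have "(\<Sum>\<^sub>\<infinity>e\<in>weyl \<times> root_lattice. ?f (?q (\<zeta>, e))) = (\<Sum>\<^sub>\<infinity>e\<in>weyl \<times> root_lattice. of_int (?d e) * \<Phi> \<zeta>)"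
      by (rule infsum_cong) (clarsimp simp: affine_antisym_orbit[OF \<Phi>])
    also have "\<dots> = (\<Sum>\<^sub>\<infinity>e\<in>weyl \<times> root_lattice. of_int (?d e)) * \<Phi> \<zeta>" by (rule infsum_cmult_left')
    also have "(\<Sum>\<^sub>\<infinity>e\<in>weyl \<times> root_lattice. of_int (?d e)) = (of_int (\<Sum>\<^sub>\<infinity>e\<in>weyl \<times> root_lattice. ?d e) :: complex)"
      by (rule infsum_of_int)
    finally show "(\<Sum>\<^sub>\<infinity>e\<in>weyl \<times> root_lattice. ?f (?q (\<zeta>, e))) = of_int (affine_sum h g \<zeta>) * \<Phi> \<zeta>"
      by (simp add: affine_sum_def)
  qed
  finally show ?thesis .
qed

section \<open>Affine Weyl group elements as honeycomb points\<close>

lemma affine_decomposition: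
  assumes "w \<in> weyl" "\<xi> \<in> root_lattice"
  shows "horiz (w \<circ> transl (- \<xi>)) = w" and "vert (w \<circ> transl (- \<xi>)) = \<xi>"
proof -
  have unique: "w' = w \<and> \<xi>' = \<xi>" if "w' \<in> weyl" "w \<circ> transl (- \<xi>) = w' \<circ> transl (- \<xi>')" for w' \<xi>'
  proof -
    have eq: "w (\<nu> - \<xi>) = w' (\<nu> - \<xi>')" for \<nu>
      using fun_cong[OF that(2), of \<nu>] by (simp add: transl_def)
    have "w \<xi> = w' \<xi>'" using eq[of 0] assms(1) that(1) by (simp add: weyl_minus)
    then have "w \<nu> = w' \<nu>" for \<nu>
      using eq[of \<nu>] assms(1) that(1) by (simp add: weyl_diff)
    then have w: "w' = w" by auto
    then have "w (0 - \<xi>) = w (0 - \<xi>')" using eq[of 0] by simp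
    then have "0 - \<xi> = 0 - \<xi>'" using weyl_bij[OF assms(1)] by (metis bij_is_inj injD)
    with w show ?thesis by simp
  qed
  show "horiz (w \<circ> transl (- \<xi>)) = w"
    unfolding horiz_def
  proof (rule the_equality)
    show "w \<in> weyl \<and> (\<exists>\<xi>'\<in>root_lattice. w \<circ> transl (- \<xi>) = w \<circ> transl (- \<xi>'))" using assms by blast
  qed (use unique in blast)
  show "vert (w \<circ> transl (- \<xi>)) = \<xi>"
    unfolding vert_def
  proof (rule the_equality)
    show "\<xi> \<in> root_lattice \<and> (\<exists>w'\<in>weyl. w \<circ> transl (- \<xi>) = w' \<circ> transl (- \<xi>))" using assms by blast
  qed (use unique in blast)
qed

lemma affine_weylE:
  assumes "y \<in> affine_weyl"
  obtains w \<xi> where "w \<in> weyl" "\<xi> \<in> root_lattice" "y = w \<circ> transl (- \<xi>)"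
proof -
  obtain w \<beta> where w: "w \<in> weyl" "\<beta> \<in> root_lattice" "y = w \<circ> transl (- (- \<beta>))"
    using assms unfolding affine_weyl_def by auto
  show thesis by (rule that[OF w(1) root_lattice_minus[OF w(2)] w(3)])
qed

lemma affine_weylI: "w \<in> weyl \<Longrightarrow> \<xi> \<in> root_lattice \<Longrightarrow> w \<circ> transl (- \<xi>) \<in> affine_weyl"
  unfolding affine_weyl_def using root_lattice_minus by blast

lemma affine_comp:
  assumes "u \<in> weyl"
  shows "(w \<circ> transl (- \<xi>)) \<circ> (u \<circ> transl (- \<mu>)) = (w \<circ> u) \<circ> transl (- (inv u \<xi> + \<mu>))"
  using assms by (auto simp: transl_def fun_eq_iff weyl_add weyl_diff algebra_simps)

lemma affine_inv:
  assumes "u \<in> weyl"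
  shows "inv (u \<circ> transl (- \<mu>)) = inv u \<circ> transl (- (- u \<mu>))"
proof (rule inv_unique_comp)
  have 0: "inv u 0 = 0" "u 0 = 0"
    using weyl_diff[OF weyl_inv[OF assms], of 0 0] weyl_diff[OF assms, of 0 0] by simp_all
  show "(u \<circ> transl (- \<mu>)) \<circ> (inv u \<circ> transl (- (- u \<mu>))) = id"
    using assms weyl_inv[OF assms] by (auto simp: transl_def fun_eq_iff weyl_add weyl_diff)
  show "(inv u \<circ> transl (- (- u \<mu>))) \<circ> (u \<circ> transl (- \<mu>)) = id"
    using assms weyl_inv[OF assms] by (auto simp: transl_def fun_eq_iff weyl_add weyl_diff)
qed

text \<open>Three times the barycentre of the alcove of \<open>y\<^sup>-\<^sup>1\<close>: this is \<open>3 y\<^sup>-\<^sup>1(\<rho>/3)\<close>.\<close>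
definition center :: "(weight \<Rightarrow> weight) \<Rightarrow> weight" where
  "center y = iota y + \<rho>"

lemma center_eq:
  "w \<in> weyl \<Longrightarrow> \<xi> \<in> root_lattice \<Longrightarrow> center (w \<circ> transl (- \<xi>)) = scale 3 \<xi> + inv w \<rho>"
  by (simp add: center_def iota_def affine_decomposition shifted_def)

lemma affine_weyl_comp:
  assumes "v \<in> affine_weyl" "u \<in> affine_weyl"
  shows "v \<circ> u \<in> affine_weyl" and "horiz (v \<circ> u) = horiz v \<circ> horiz u"
proof -
  obtain w \<xi> where w: "w \<in> weyl" "\<xi> \<in> root_lattice" "v = w \<circ> transl (- \<xi>)"
    using assms(1) by (rule affine_weylE)
  obtain w' \<xi>' where w': "w' \<in> weyl" "\<xi>' \<in> root_lattice" "u = w' \<circ> transl (- \<xi>')"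
    using assms(2) by (rule affine_weylE)
  have h: "horiz v = w" "horiz u = w'" unfolding w(3) w'(3) by (intro affine_decomposition w w')+
  have vu: "v \<circ> u = (w \<circ> w') \<circ> transl (- (inv w' \<xi> + \<xi>'))"
    unfolding w(3) w'(3) by (rule affine_comp[OF w'(1)])
  have in_lattice: "inv w' \<xi> + \<xi>' \<in> root_lattice"
    by (rule root_lattice_add[OF root_lattice_weyl[OF weyl_inv[OF w'(1)] w(2)] w'(2)])
  show "v \<circ> u \<in> affine_weyl" "horiz (v \<circ> u) = horiz v \<circ> horiz u"
    unfolding h vu
    by (rule affine_weylI[OF weyl_comp[OF w(1) w'(1)] in_lattice])
       (rule affine_decomposition(1)[OF weyl_comp[OF w(1) w'(1)] in_lattice])
qed

lemma affine_weyl_inv: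
  assumes "u \<in> affine_weyl"
  shows "inv u \<in> affine_weyl" and "horiz (inv u) = inv (horiz u)"
proof -
  obtain w \<xi> where w: "w \<in> weyl" "\<xi> \<in> root_lattice" "u = w \<circ> transl (- \<xi>)"
    using assms by (rule affine_weylE)
  have h: "horiz u = w" unfolding w(3) by (intro affine_decomposition w)
  have in_lattice: "- w \<xi> \<in> root_lattice" by (rule root_lattice_minus[OF root_lattice_weyl[OF w(1,2)]])
  have iu: "inv u = inv w \<circ> transl (- (- w \<xi>))" unfolding w(3) by (rule affine_inv[OF w(1)])
  show "inv u \<in> affine_weyl" "horiz (inv u) = inv (horiz u)"
    unfolding h iu
    by (rule affine_weylI[OF weyl_inv[OF w(1)] in_lattice])
       (rule affine_decomposition(1)[OF weyl_inv[OF w(1)] in_lattice])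
qed

lemma horiz_weyl: "u \<in> affine_weyl \<Longrightarrow> horiz u \<in> weyl"
  by (erule affine_weylE) (simp add: affine_decomposition)

lemma center_comp:
  assumes "v \<in> affine_weyl" "u \<in> weyl" "\<mu> \<in> root_lattice"
  shows "center (v \<circ> (u \<circ> transl (- \<mu>))) = inv u (center v) + scale 3 \<mu>"
proof -
  obtain w \<xi> where w: "w \<in> weyl" "\<xi> \<in> root_lattice" "v = w \<circ> transl (- \<xi>)"
    using assms(1) by (rule affine_weylE)
  have iu: "inv u \<in> weyl" by (rule weyl_inv[OF assms(2)])
  have "center (v \<circ> (u \<circ> transl (- \<mu>))) = scale 3 (inv u \<xi> + \<mu>) + inv (w \<circ> u) \<rho>"
    unfolding w(3) affine_comp[OF assms(2)]
    by (rule center_eq[OF weyl_comp[OF w(1) assms(2)] root_lattice_add[OF root_lattice_weyl[OF iu w(2)] assms(3)]])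
  also have "inv (w \<circ> u) = inv u \<circ> inv w" by (intro o_inv_distrib weyl_bij w assms)
  also have "scale 3 (inv u \<xi> + \<mu>) = inv u (scale 3 \<xi>) + scale 3 \<mu>"
    by (simp add: weyl_scale[OF iu]) (simp add: scale_def algebra_simps)
  also have "inv u (scale 3 \<xi>) + scale 3 \<mu> + (inv u \<circ> inv w) \<rho> = inv u (scale 3 \<xi> + inv w \<rho>) + scale 3 \<mu>"
    by (simp add: weyl_add[OF iu] algebra_simps)
  also have "scale 3 \<xi> + inv w \<rho> = center v" using w by (simp add: center_eq)
  finally show ?thesis .
qed

text \<open>\<open>\<iota>(u y\<^sup>-\<^sup>1)\<close> is the image of \<open>center u - center y\<close> under the horizontal projection of \<open>y\<close>, and weight
multiplicities are Weyl invariant.\<close>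
lemma m_coeff_center:
  assumes "u \<in> affine_weyl" "y \<in> affine_weyl"
  shows "m_coeff x (u \<circ> inv y) = weight_mult (center x) (center u - center y)"
proof -
  obtain v \<mu> where v: "v \<in> weyl" "\<mu> \<in> root_lattice" "y = v \<circ> transl (- \<mu>)"
    using assms(2) by (rule affine_weylE)
  have "center (u \<circ> inv y) = inv (inv v) (center u) + scale 3 (- v \<mu>)"
    unfolding v(3) affine_inv[OF v(1)]
    by (rule center_comp[OF assms(1) weyl_inv[OF v(1)] root_lattice_minus[OF root_lattice_weyl[OF v(1,2)]]])
  also have "inv (inv v) = v" by (simp add: inv_inv_eq weyl_bij v)
  also have "v (center u) + scale 3 (- v \<mu>) = v (center u - center y) + \<rho>"
  proof -
    have "v (center y) = v (scale 3 \<mu>) + \<rho>"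
      unfolding v(3) by (simp add: center_eq v weyl_add)
    then show ?thesis
      by (simp add: weyl_diff v weyl_scale[symmetric] weyl_minus[symmetric]) (simp add: weyl_minus v weyl_scale scale_def)
  qed
  finally have "center (u \<circ> inv y) = v (center u - center y) + \<rho>" .
  then have "iota (u \<circ> inv y) = v (center u - center y)" unfolding center_def by (simp only: add_right_cancel)
  then show ?thesis
    unfolding m_coeff_def using weight_mult_weyl[OF v(1), of "center x" "center u - center y"]
    by (simp add: weight_mult_def center_def)
qed

lemma center_honeycomb: "y \<in> affine_weyl \<Longrightarrow> center y \<in> honeycomb"
proof -
  assume "y \<in> affine_weyl"
  then obtain w \<xi> where w: "w \<in> weyl" "\<xi> \<in> root_lattice" "y = w \<circ> transl (- \<xi>)" by (rule affine_weylE)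
  have "inv w \<rho> \<in> honeycomb"
    by (rule honeycomb_weyl[OF weyl_inv[OF w(1)]]) (simp add: weight_simps honeycomb_iff)
  moreover have "center y = scale 3 \<xi> + inv w \<rho>" using w by (simp add: center_eq)
  ultimately show ?thesis
    by (cases \<xi>; cases "inv w \<rho>"; simp add: honeycomb_iff scale_def; presburger)
qed

text \<open>The map sends \<open>y\<close> to \<open>y\<^sup>-\<^sup>1\<close> applied to \<open>\<rho>\<close> in the level \<open>3\<close> action, and \<open>\<rho>\<close> is the only honeycomb point in the closed
fundamental alcove of level \<open>3\<close>.\<close>
lemma center_bij: "bij_betw center affine_weyl honeycomb"
  unfolding bij_betw_def
proof
  show "inj_on center affine_weyl"
  proof (rule inj_onI)
    fix y y' assume y: "y \<in> affine_weyl" "y' \<in> affine_weyl" and eq: "center y = center y'"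
    obtain w \<xi> where w: "w \<in> weyl" "\<xi> \<in> root_lattice" "y = w \<circ> transl (- \<xi>)"
      using y(1) by (rule affine_weylE)
    obtain w' \<xi>' where w': "w' \<in> weyl" "\<xi>' \<in> root_lattice" "y' = w' \<circ> transl (- \<xi>')"
      using y(2) by (rule affine_weylE)
    have e: "inv w \<rho> + scale 3 (\<xi> - \<xi>') = inv w' \<rho>"
      using eq w w' by (simp add: center_eq scale_def algebra_simps prod_eq_iff)
    have iw: "inv (inv w') = w'" "inv (inv w) = w" using w w' by (simp_all add: inv_inv_eq weyl_bij)
    have "(w' \<circ> inv w) \<rho> + scale 3 (w' (\<xi> - \<xi>')) = \<rho>"
      using arg_cong[OF e, of w'] w' by (simp add: weyl_add weyl_scale)
    moreover have \<rho>: "\<rho> \<in> alcove 3" by (simp add: weight_simps alcove_iff)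
    ultimately have in_alcove: "(w' \<circ> inv w) \<rho> + scale 3 (w' (\<xi> - \<xi>')) \<in> alcove 3" by simp
    have "\<xi> - \<xi>' \<in> root_lattice"
      using root_lattice_add[OF w(2) root_lattice_minus[OF w'(2)]] by simp
    then have "w' (\<xi> - \<xi>') \<in> root_lattice" by (rule root_lattice_weyl[OF w'(1)])
    from this \<rho> in_alcove have "w' \<circ> inv w = id \<and> w' (\<xi> - \<xi>') = 0"
      by (intro alcove_fundamental[of 3]) (simp_all only: weyl_comp[OF w'(1) weyl_inv[OF w(1)]])
    then have 1: "w' \<circ> inv w = id" and 2: "w' (\<xi> - \<xi>') = 0" by auto
    have "w' = (w' \<circ> inv w) \<circ> w" using weyl_comp_inv(2)[OF w(1)] by simp
    then have "w' = w" unfolding 1 by simp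
    moreover have "w' 0 = 0" using weyl_diff[OF w'(1), of 0 0] by simp
    then have "\<xi> - \<xi>' = 0" using 2 weyl_bij[OF w'(1)] by (metis bij_is_inj injD)
    ultimately show "y = y'" using w w' by simp
  qed
  show "center ` affine_weyl = honeycomb"
  proof
    show "honeycomb \<subseteq> center ` affine_weyl"
    proof
      fix \<kappa> assume \<kappa>: "\<kappa> \<in> honeycomb"
      obtain w \<xi> a b where w: "w \<in> weyl" "\<xi> \<in> root_lattice" "\<kappa> = w (a, b) + scale 3 \<xi>"
        and ab: "0 \<le> a" "0 \<le> b" "a + b \<le> 3"
        using closed_alcove_exists[of 3 \<kappa>] by auto
      have "w (a, b) \<in> honeycomb"
        using \<kappa> unfolding w(3) by (cases \<xi>; cases "w (a, b)"; simp add: honeycomb_iff scale_def; presburger)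
      then have "(a, b) \<in> honeycomb" using honeycomb_weyl[OF weyl_inv[OF w(1)], of "w (a, b)"] w(1) by simp
      then have "a = 1 \<and> b = 1" using ab unfolding honeycomb_iff by presburger
      then have "\<kappa> = scale 3 \<xi> + w \<rho>" using w(3) by (simp add: weight_simps add.commute)
      note w = w(1,2) this
      have "center (inv w \<circ> transl (- \<xi>)) = \<kappa>"
        using center_eq[OF weyl_inv[OF w(1)] w(2)] w by (simp add: inv_inv_eq weyl_bij)
      then show "\<kappa> \<in> center ` affine_weyl"
        using affine_weylI[OF weyl_inv[OF w(1)] w(2)] by blast
    qed
  qed (use center_honeycomb in blast)
qed

text \<open>The \<open>i\<close>-th label of \<open>center y\<close> is three times that of the vertical part plus the height of the
root \<open>w \<alpha>\<^sub>i\<close>, which is between \<open>-2\<close> and \<open>2\<close> and not zero. Strict positivity of the sum is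
therefore the weak or strict inequality of the definition, according to the sign of that root, and
likewise for \<open>\<theta>\<close> and the upper bound.\<close>
lemma W_plus_iff:
  assumes "y \<in> affine_weyl"
  shows "y \<in> W_plus \<longleftrightarrow> fst (center y) > 0 \<and> snd (center y) > 0"
    and "y \<in> W_plus_p p \<longleftrightarrow> center y \<in> alcove (3 * p)"
proof -
  obtain w \<xi> where w: "w \<in> weyl" "\<xi> \<in> root_lattice" "y = w \<circ> transl (- \<xi>)"
    using assms by (rule affine_weylE)
  have hv: "horiz y = w" "vert y = \<xi>" unfolding w(3) by (intro affine_decomposition w)+
  obtain a b where ab: "\<xi> = (a, b)" by (cases \<xi>)
  have inv: "inv id = id" "inv s\<^sub>1 = s\<^sub>1" "inv s\<^sub>2 = s\<^sub>2" "inv (s\<^sub>1 \<circ> s\<^sub>2) = s\<^sub>2 \<circ> s\<^sub>1" "inv (s\<^sub>2 \<circ> s\<^sub>1) = s\<^sub>1 \<circ> s\<^sub>2"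
    "inv (s\<^sub>1 \<circ> s\<^sub>2 \<circ> s\<^sub>1) = s\<^sub>1 \<circ> s\<^sub>2 \<circ> s\<^sub>1"
    by (intro inv_unique_comp; simp add: fun_eq_iff s1_pair s2_pair)+
  have c: "center y = (3 * a, 3 * b) + inv w \<rho>" using center_eq[OF w(1,2)] unfolding w(3) by (simp add: ab scale_def)
  have dom: "(a, b) \<in> dominant \<longleftrightarrow> 0 \<le> a \<and> 0 \<le> b" by (simp add: dominant_def ip_\<alpha>\<^sub>1 ip_\<alpha>\<^sub>2)
  have P: "y \<in> W_plus \<longleftrightarrow> (a, b) \<in> dominant_w w" "y \<in> W_plus_p p \<longleftrightarrow> (a, b) \<in> dominant_wp p w"
    using assms w(2) unfolding W_plus_def W_plus_p_def by (auto simp: ab hv)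
  have int_real: "real_of_int a + real_of_int b < real_of_int p \<longleftrightarrow> a + b < p"
    "real_of_int a + real_of_int b \<le> real_of_int p \<longleftrightarrow> a + b \<le> p" by linarith+
  have ips: "ip (a, b) (2, -1) = of_int a" "ip (a, b) (-1, 2) = of_int b" "ip (a, b) (1, 1) = of_int (a + b)"
    by (simp_all add: ip_def)
  show "y \<in> W_plus \<longleftrightarrow> fst (center y) > 0 \<and> snd (center y) > 0"
    unfolding P c
    by (use w(1) in \<open>cases rule: weyl_cases\<close>)
       (auto simp: dominant_w_def dom inv ips pos_roots_def weight_simps)
  show "y \<in> W_plus_p p \<longleftrightarrow> center y \<in> alcove (3 * p)"
    unfolding P c
    by (use w(1) in \<open>cases rule: weyl_cases\<close>)
       (auto simp: dominant_w_def dominant_wp_def dom inv ips int_real pos_roots_def alcove_iff weight_simps)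
qed

lemma W_plus_p_bij: "bij_betw center (W_plus_p p) (alcove (3 * p) \<inter> honeycomb)"
proof (rule bij_betw_subset[OF center_bij, of "W_plus_p p"])
  show sub: "W_plus_p p \<subseteq> affine_weyl" by (auto simp: W_plus_p_def)
  show "center ` W_plus_p p = alcove (3 * p) \<inter> honeycomb"
  proof
    show "center ` W_plus_p p \<subseteq> alcove (3 * p) \<inter> honeycomb"
    proof (rule image_subsetI)
      fix y assume y: "y \<in> W_plus_p p"
      then have "y \<in> affine_weyl" using sub by blast
      then show "center y \<in> alcove (3 * p) \<inter> honeycomb"
        using W_plus_iff(2)[of y p] center_honeycomb[of y] y by simp
    qed
    show "alcove (3 * p) \<inter> honeycomb \<subseteq> center ` W_plus_p p"
    proof
      fix \<kappa> assume \<kappa>: "\<kappa> \<in> alcove (3 * p) \<inter> honeycomb"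
      have "\<kappa> \<in> center ` affine_weyl"
        using \<kappa> unfolding bij_betw_imp_surj_on[OF center_bij] by (rule IntD2)
      then obtain y where y: "\<kappa> = center y" "y \<in> affine_weyl" by (rule imageE)
      then have "y \<in> W_plus_p p" using W_plus_iff(2)[of y p] \<kappa> by simp
      with y(1) show "\<kappa> \<in> center ` W_plus_p p" by (rule image_eqI)
    qed
  qed
qed

section \<open>The sums over the affine Kac--Wakimoto group\<close>

text \<open>The inverse and the sign make right multiplication by \<open>sub_element p (w, \<beta>)\<close> act on barycentres as
\<open>\<kappa> \<mapsto> w \<kappa> + 3 p \<beta>\<close>.\<close>
definition sub_element :: "int \<Rightarrow> (weight \<Rightarrow> weight) \<times> weight \<Rightarrow> weight \<Rightarrow> weight" where
  "sub_element p = (\<lambda>(w, \<beta>). inv w \<circ> transl (- scale p \<beta>))"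

lemma W_sub_bij:
  assumes "p \<noteq> 0"
  shows "bij_betw (sub_element p) (weyl \<times> root_lattice) (W_sub p)"
  unfolding bij_betw_def
proof
  show "inj_on (sub_element p) (weyl \<times> root_lattice)"
  proof (rule inj_onI)
    fix d d' assume d: "d \<in> weyl \<times> root_lattice" "d' \<in> weyl \<times> root_lattice"
      and eq: "sub_element p d = sub_element p d'"
    obtain w \<beta> w' \<beta>' where dd: "d = (w, \<beta>)" "d' = (w', \<beta>')" by (metis prod.exhaust)
    have w: "w \<in> weyl" "\<beta> \<in> root_lattice" "w' \<in> weyl" "\<beta>' \<in> root_lattice" using d by (auto simp: dd)
    have "inv w = horiz (sub_element p d)" "scale p \<beta> = vert (sub_element p d)"
      unfolding dd sub_element_def prod.case
      by (rule affine_decomposition[symmetric]; rule weyl_inv root_lattice_scale; rule w)+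
    moreover have "inv w' = horiz (sub_element p d')" "scale p \<beta>' = vert (sub_element p d')"
      unfolding dd sub_element_def prod.case
      by (rule affine_decomposition[symmetric]; rule weyl_inv root_lattice_scale; rule w)+
    ultimately have "inv w = inv w'" "scale p \<beta> = scale p \<beta>'" using eq by simp_all
    then have "inv (inv w) = inv (inv w')" "\<beta> = \<beta>'" using scale_inj[OF assms] by simp_all
    then show "d = d'" using w by (simp add: dd inv_inv_eq weyl_bij)
  qed
  show "sub_element p ` (weyl \<times> root_lattice) = W_sub p"
  proof
    show "sub_element p ` (weyl \<times> root_lattice) \<subseteq> W_sub p"
    proof
      fix v assume "v \<in> sub_element p ` (weyl \<times> root_lattice)"
      then obtain w \<beta> where w: "w \<in> weyl" "\<beta> \<in> root_lattice" "v = inv w \<circ> transl (- scale p \<beta>)"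
        by (auto simp: sub_element_def)
      have "v = inv w \<circ> transl (scale p (- \<beta>))" unfolding w(3) by (simp add: scale_def uminus_prod_def)
      then show "v \<in> W_sub p" unfolding W_sub_def using weyl_inv[OF w(1)] root_lattice_minus[OF w(2)] by blast
    qed
    show "W_sub p \<subseteq> sub_element p ` (weyl \<times> root_lattice)"
    proof
      fix v assume "v \<in> W_sub p"
      then obtain w \<beta> where w: "w \<in> weyl" "\<beta> \<in> root_lattice" "v = w \<circ> transl (scale p \<beta>)"
        unfolding W_sub_def by blast
      have "v = sub_element p (inv w, - \<beta>)"
        unfolding w(3) sub_element_def prod.case inv_inv_eq[OF weyl_bij[OF w(1)]]
        by (simp add: scale_def uminus_prod_def)
      then show "v \<in> sub_element p ` (weyl \<times> root_lattice)"
        using weyl_inv[OF w(1)] root_lattice_minus[OF w(2)] by blast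
    qed
  qed
qed

lemma W_sub_affine: "v \<in> W_sub p \<Longrightarrow> v \<in> affine_weyl"
  unfolding W_sub_def affine_weyl_def using root_lattice_scale by blast

lemma weyl_W_sub: "u \<in> weyl \<Longrightarrow> u \<in> W_sub p"
proof -
  assume "u \<in> weyl"
  moreover have "u = u \<circ> transl (scale p 0)" by (simp add: fun_eq_iff transl_def scale_def flip: zero_prod_def)
  moreover have "0 \<in> root_lattice" by (simp add: zero_prod_def root_lattice_iff)
  ultimately show ?thesis unfolding W_sub_def by blast
qed

lemma weyl_horiz: "u \<in> weyl \<Longrightarrow> horiz u = u"
proof -
  assume u: "u \<in> weyl"
  have "u = u \<circ> transl (- 0)" by (simp add: fun_eq_iff transl_def)
  moreover have "0 \<in> root_lattice" by (simp add: zero_prod_def root_lattice_iff)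
  ultimately show ?thesis using affine_decomposition(1)[OF u] by metis
qed

lemma W_sub_comp_weyl: "v \<in> W_sub p \<Longrightarrow> u \<in> weyl \<Longrightarrow> v \<circ> u \<in> W_sub p"
proof -
  assume "v \<in> W_sub p" and u: "u \<in> weyl"
  then obtain w \<beta> where w: "w \<in> weyl" "\<beta> \<in> root_lattice" "v = w \<circ> transl (scale p \<beta>)"
    unfolding W_sub_def by blast
  have iu: "inv u \<in> weyl" by (rule weyl_inv[OF u])
  have "v \<circ> u = (w \<circ> u) \<circ> transl (scale p (inv u \<beta>))"
    unfolding w(3) using u by (simp add: fun_eq_iff transl_def weyl_add weyl_scale[OF iu, symmetric])
  then show ?thesis
    unfolding W_sub_def using weyl_comp[OF w(1) u] root_lattice_weyl[OF iu w(2)] by blast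
qed

lemma weyl_affine: "u \<in> weyl \<Longrightarrow> u \<in> affine_weyl"
  using weyl_W_sub W_sub_affine by blast

lemma center_sub_element:
  assumes "z \<in> affine_weyl" "w \<in> weyl" "\<beta> \<in> root_lattice"
  shows "center (z \<circ> sub_element p (w, \<beta>)) = w (center z) + scale (3 * p) \<beta>"
proof -
  have "center (z \<circ> sub_element p (w, \<beta>)) = inv (inv w) (center z) + scale 3 (scale p \<beta>)"
    unfolding sub_element_def prod.case
    by (rule center_comp[OF assms(1) weyl_inv[OF assms(2)] root_lattice_scale[OF assms(3)]])
  then show ?thesis by (simp add: inv_inv_eq weyl_bij assms) (simp add: scale_def)
qed

lemma center_comp_weyl:
  assumes "v \<in> affine_weyl" "u \<in> weyl"
  shows "center (v \<circ> u) = inv u (center v)"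
proof -
  have "u = u \<circ> transl (- 0)" by (simp add: fun_eq_iff transl_def)
  moreover have "0 \<in> root_lattice" by (simp add: zero_prod_def root_lattice_iff)
  ultimately show ?thesis
    using center_comp[OF assms, of 0] by (metis add.right_neutral mult_zero_right scale_def fst_zero snd_zero zero_prod_def)
qed

lemma horiz_sub_element:
  assumes "w \<in> weyl" "\<beta> \<in> root_lattice"
  shows "horiz (sub_element p (w, \<beta>)) = inv w"
  unfolding sub_element_def prod.case
  by (rule affine_decomposition(1)[OF weyl_inv[OF assms(1)] root_lattice_scale[OF assms(2)]])

text \<open>The multiplicity that is summed in all expressions for the structure constants, as a function of the
barycentre of the element \<open>u\<close> in \<open>u y\<^sup>-\<^sup>1\<close>.\<close>
definition fusion_weight :: "(weight \<Rightarrow> weight) \<Rightarrow> (weight \<Rightarrow> weight) \<Rightarrow> weight \<Rightarrow> int" where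
  "fusion_weight x y \<kappa> = weight_mult (center x) (\<kappa> - center y)"

lemma finite_fusion_weight: "finite {\<nu>. fusion_weight x y \<nu> \<noteq> 0}"
  unfolding fusion_weight_def by (rule finite_shift[OF finite_weight_mult])

lemma W_sub_term:
  assumes "z \<in> affine_weyl" "y \<in> affine_weyl" "w \<in> weyl" "\<beta> \<in> root_lattice"
  shows "wdet (horiz (sub_element p (w, \<beta>))) * m_coeff x (z \<circ> sub_element p (w, \<beta>) \<circ> inv y) =
    wdet w * fusion_weight x y (w (center z) + scale (3 * p) \<beta>)"
proof -
  have "sub_element p (w, \<beta>) \<in> affine_weyl"
    unfolding sub_element_def prod.case
    by (rule affine_weylI[OF weyl_inv[OF assms(3)] root_lattice_scale[OF assms(4)]])
  then have "z \<circ> sub_element p (w, \<beta>) \<in> affine_weyl" by (rule affine_weyl_comp(1)[OF assms(1)])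
  from m_coeff_center[OF this assms(2)] show ?thesis
    using assms by (simp only: center_sub_element horiz_sub_element fusion_weight_def wdet_inv)
qed

lemma W_sub_sum:
  assumes p: "p \<noteq> 0" and zy: "z \<in> affine_weyl" "y \<in> affine_weyl"
  shows "finite {w \<in> W_sub p. wdet (horiz w) * m_coeff x (z \<circ> w \<circ> inv y) \<noteq> 0}"
    and "(\<Sum>\<^sub>\<infinity>w\<in>W_sub p. wdet (horiz w) * m_coeff x (z \<circ> w \<circ> inv y)) =
      affine_sum (3 * p) (fusion_weight x y) (center z)"
proof -
  let ?f = "\<lambda>w. wdet (horiz w) * m_coeff x (z \<circ> w \<circ> inv y)"
  let ?g = "\<lambda>(w, \<beta>). wdet w * fusion_weight x y (w (center z) + scale (3 * p) \<beta>)"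
  have eq: "?f (sub_element p e) = ?g e" if "e \<in> weyl \<times> root_lattice" for e
    using that by (cases e) (simp only: mem_Times_iff fst_conv snd_conv prod.case W_sub_term[OF zy])
  have "{w \<in> W_sub p. ?f w \<noteq> 0} \<subseteq> sub_element p ` {e \<in> weyl \<times> root_lattice. ?g e \<noteq> 0}"
  proof
    fix v assume v: "v \<in> {w \<in> W_sub p. ?f w \<noteq> 0}"
    then have "v \<in> sub_element p ` (weyl \<times> root_lattice)"
      unfolding bij_betw_imp_surj_on[OF W_sub_bij[OF p]] by simp
    then obtain e where e: "v = sub_element p e" "e \<in> weyl \<times> root_lattice" by (rule imageE)
    from v have "?f v \<noteq> 0" by simp
    then have "?g e \<noteq> 0" unfolding e(1) eq[OF e(2)] .
    then have "e \<in> {e \<in> weyl \<times> root_lattice. ?g e \<noteq> 0}" using e(2) by simp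
    then show "v \<in> sub_element p ` {e \<in> weyl \<times> root_lattice. ?g e \<noteq> 0}"
      unfolding e(1) by (rule imageI)
  qed
  moreover have "finite {e \<in> weyl \<times> root_lattice. ?g e \<noteq> 0}"
    by (rule affine_sum_finite[OF _ finite_fusion_weight]) (use p in simp)
  ultimately show "finite {w \<in> W_sub p. ?f w \<noteq> 0}" by (meson finite_surj)
  have "infsum ?f (W_sub p) = (\<Sum>\<^sub>\<infinity>e\<in>weyl \<times> root_lattice. ?f (sub_element p e))"
    by (rule infsum_reindex_bij_betw[OF W_sub_bij[OF p], symmetric])
  also have "\<dots> = infsum ?g (weyl \<times> root_lattice)" by (rule infsum_cong) (rule eq)
  finally show "infsum ?f (W_sub p) = affine_sum (3 * p) (fusion_weight x y) (center z)"
    by (simp add: affine_sum_def)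
qed

lemma affine_weyl_bij: "v \<in> affine_weyl \<Longrightarrow> bij v"
proof (erule affine_weylE)
  fix w \<xi> assume w: "w \<in> weyl" "v = w \<circ> transl (- \<xi>)"
  have "bij (transl (- \<xi>))" by (rule o_bij[of "transl \<xi>"]) (simp_all add: fun_eq_iff transl_def)
  then show "bij v" unfolding w(2) using weyl_bij[OF w(1)] by (rule bij_comp)
qed

text \<open>Conjugation by \<open>z\<close> turns the sum over the affine Kac--Wakimoto group into one over \<open>W_sub p\<close>, and
preserves determinants.\<close>
lemma KW_group_conjugation:
  assumes z: "z \<in> affine_weyl"
  shows "bij_betw (\<lambda>w. z \<circ> w \<circ> inv z) (W_sub p) (KW_group p z)"
    and "\<And>w. w \<in> W_sub p \<Longrightarrow> wdet (horiz (z \<circ> w \<circ> inv z)) * m_coeff x ((z \<circ> w \<circ> inv z) \<circ> z \<circ> inv y) =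
      wdet (horiz w) * m_coeff x (z \<circ> w \<circ> inv y)"
proof -
  have bij: "bij z" by (rule affine_weyl_bij[OF z])
  have iz: "inv z \<circ> z = id" "z \<circ> inv z = id"
    using bij by (simp_all add: fun_eq_iff bij_is_inj bij_is_surj surj_f_inv_f)
  show "bij_betw (\<lambda>w. z \<circ> w \<circ> inv z) (W_sub p) (KW_group p z)"
    unfolding bij_betw_def
  proof
    show "inj_on (\<lambda>w. z \<circ> w \<circ> inv z) (W_sub p)"
    proof (rule inj_onI)
      fix v w assume "z \<circ> v \<circ> inv z = z \<circ> w \<circ> inv z"
      then have "inv z \<circ> (z \<circ> v \<circ> inv z) \<circ> z = inv z \<circ> (z \<circ> w \<circ> inv z) \<circ> z" by simp
      then have "(inv z \<circ> z) \<circ> v \<circ> (inv z \<circ> z) = (inv z \<circ> z) \<circ> w \<circ> (inv z \<circ> z)" by (simp only: o_assoc)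
      then show "v = w" by (simp only: iz id_comp comp_id)
    qed
    show "(\<lambda>w. z \<circ> w \<circ> inv z) ` W_sub p = KW_group p z" by (auto simp: KW_group_def)
  qed
  fix w assume w: "w \<in> W_sub p"
  have a: "w \<in> affine_weyl" by (rule W_sub_affine[OF w])
  have "(z \<circ> w \<circ> inv z) \<circ> z \<circ> inv y = z \<circ> w \<circ> (inv z \<circ> z) \<circ> inv y" by (simp only: o_assoc)
  then have 1: "(z \<circ> w \<circ> inv z) \<circ> z \<circ> inv y = z \<circ> w \<circ> inv y" by (simp only: iz comp_id)
  have "horiz (z \<circ> w \<circ> inv z) = horiz z \<circ> horiz w \<circ> inv (horiz z)"
    using affine_weyl_comp[OF z a] affine_weyl_comp(2)[OF affine_weyl_comp(1)[OF z a] affine_weyl_inv(1)[OF z]]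
      affine_weyl_inv(2)[OF z] by simp
  moreover have "wdet (horiz z \<circ> horiz w \<circ> inv (horiz z)) = wdet (horiz w)"
    using wdet_square[OF horiz_weyl[OF z]] horiz_weyl[OF z] horiz_weyl[OF a]
    by (simp only: wdet_comp weyl_comp weyl_inv wdet_inv) algebra
  ultimately show "wdet (horiz (z \<circ> w \<circ> inv z)) * m_coeff x ((z \<circ> w \<circ> inv z) \<circ> z \<circ> inv y) =
      wdet (horiz w) * m_coeff x (z \<circ> w \<circ> inv y)"
    by (simp only: 1)
qed

lemma Np_coeff_eq:
  assumes p: "p \<noteq> 0" and zy: "z \<in> affine_weyl" "y \<in> affine_weyl"
  shows "finite {w' \<in> KW_group p z. wdet (horiz w') * m_coeff x (w' \<circ> z \<circ> inv y) \<noteq> 0}"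
    and "Np_coeff p x y z = affine_sum (3 * p) (fusion_weight x y) (center z)"
proof -
  let ?c = "\<lambda>w. z \<circ> w \<circ> inv z" and ?f = "\<lambda>w'. wdet (horiz w') * m_coeff x (w' \<circ> z \<circ> inv y)"
    and ?g = "\<lambda>w. wdet (horiz w) * m_coeff x (z \<circ> w \<circ> inv y)"
  note bij = KW_group_conjugation(1)[OF zy(1), of p] and summand = KW_group_conjugation(2)[OF zy(1), of _ p x y]
  have "{w' \<in> KW_group p z. ?f w' \<noteq> 0} \<subseteq> ?c ` {w \<in> W_sub p. ?g w \<noteq> 0}"
  proof
    fix v assume v: "v \<in> {w' \<in> KW_group p z. ?f w' \<noteq> 0}"
    then have "v \<in> ?c ` W_sub p" unfolding bij_betw_imp_surj_on[OF bij] by simp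
    then obtain w where w: "v = ?c w" "w \<in> W_sub p" by (rule imageE)
    from v have "?f v \<noteq> 0" by simp
    then have "?g w \<noteq> 0" unfolding w(1) summand[OF w(2)] .
    then have "w \<in> {w \<in> W_sub p. ?g w \<noteq> 0}" using w(2) by simp
    then show "v \<in> ?c ` {w \<in> W_sub p. ?g w \<noteq> 0}" unfolding w(1) by (rule imageI)
  qed
  then show "finite {w' \<in> KW_group p z. ?f w' \<noteq> 0}"
    using W_sub_sum(1)[OF p zy, of x] by (meson finite_surj)
  have "Np_coeff p x y z = (\<Sum>\<^sub>\<infinity>w\<in>W_sub p. ?f (?c w))"
    unfolding Np_coeff_def by (rule infsum_reindex_bij_betw[OF bij, symmetric])
  also have "\<dots> = infsum ?g (W_sub p)" by (rule infsum_cong) (rule summand)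
  finally show "Np_coeff p x y z = affine_sum (3 * p) (fusion_weight x y) (center z)"
    by (simp only: W_sub_sum(2)[OF p zy])
qed

lemma chamber_exists:
  assumes "\<kappa> \<in> honeycomb"
  shows "\<exists>u\<in>weyl. fst (u \<kappa>) > 0 \<and> snd (u \<kappa>) > 0"
proof -
  obtain a b where ab: "\<kappa> = (a, b)" by (cases \<kappa>)
  have "a \<noteq> 0" "b \<noteq> 0" "a + b \<noteq> 0" using assms unfolding ab honeycomb_iff by presburger+
  then consider "a > 0" "b > 0" | "a < 0" "a + b > 0" | "b < 0" "a + b > 0"
    | "a + b < 0" "a > 0" | "a + b < 0" "b > 0" | "a < 0" "b < 0" by linarith
  then show ?thesis
    unfolding weyl_eq by cases (auto simp: ab s1_pair s2_pair)
qed

lemma chamber_unique: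
  assumes "u \<in> weyl" "fst \<kappa> > 0" "snd \<kappa> > 0" "fst (u \<kappa>) > 0" "snd (u \<kappa>) > 0"
  shows "u = id"
proof -
  \<comment> \<open>A level so large that both points are in the alcove; then only the trivial translation occurs.\<close>
  define h where "h = fst \<kappa> + snd \<kappa> + fst (u \<kappa>) + snd (u \<kappa>)"
  have "h > 0" "\<kappa> \<in> alcove h" "u \<kappa> + scale h 0 \<in> alcove h"
    using assms by (auto simp: h_def alcove_def scale_def case_prod_unfold)
  moreover have "0 \<in> root_lattice" by (simp add: zero_prod_def root_lattice_iff)
  ultimately show ?thesis using alcove_fundamental[OF _ assms(1)] by blast
qed

text \<open>Right multiplication by the finite Weyl group moves the barycentre of \<open>z \<circ> w\<close> through all Weyl chambers, and
exactly one of the six elements has it in the dominant chamber.\<close>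
lemma chamber_transversal:
  assumes z: "z \<in> affine_weyl"
  shows "bij_betw (\<lambda>(w, u). w \<circ> u) ({w \<in> W_sub p. z \<circ> w \<in> W_plus} \<times> weyl) (W_sub p)"
  unfolding bij_betw_def
proof
  have plus: "z \<circ> w \<in> W_plus \<longleftrightarrow> fst (center (z \<circ> w)) > 0 \<and> snd (center (z \<circ> w)) > 0" if "w \<in> W_sub p" for w
    by (rule W_plus_iff(1)[OF affine_weyl_comp(1)[OF z W_sub_affine[OF that]]])
  show "inj_on (\<lambda>(w, u). w \<circ> u) ({w \<in> W_sub p. z \<circ> w \<in> W_plus} \<times> weyl)"
  proof (rule inj_onI)
    fix d d' assume d: "d \<in> {w \<in> W_sub p. z \<circ> w \<in> W_plus} \<times> weyl" "d' \<in> {w \<in> W_sub p. z \<circ> w \<in> W_plus} \<times> weyl"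
      and eq0: "(\<lambda>(w, u). w \<circ> u) d = (\<lambda>(w, u). w \<circ> u) d'"
    obtain w u w' u' where dd: "d = (w, u)" "d' = (w', u')" by (metis prod.exhaust)
    have w: "w \<in> W_sub p" "z \<circ> w \<in> W_plus" "u \<in> weyl" and w': "w' \<in> W_sub p" "z \<circ> w' \<in> W_plus" "u' \<in> weyl"
      and eq: "w \<circ> u = w' \<circ> u'" using d eq0 by (auto simp: dd)
    define v where "v = u \<circ> inv u'"
    have v: "v \<in> weyl" unfolding v_def by (rule weyl_comp[OF w(3) weyl_inv[OF w'(3)]])
    have "w \<circ> v = w' \<circ> u' \<circ> inv u'" unfolding v_def eq[symmetric] by (simp only: o_assoc)
    then have wv: "w' = w \<circ> v" using weyl_comp_inv(1)[OF w'(3), of w'] by simp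
    have "center (z \<circ> w') = inv v (center (z \<circ> w))"
      using center_comp_weyl[OF affine_weyl_comp(1)[OF z W_sub_affine[OF w(1)]] v] unfolding wv by (simp only: o_assoc)
    then have "inv v = id"
      using chamber_unique[OF weyl_inv[OF v], of "center (z \<circ> w)"] w w' plus by simp
    then have "v = id" using inv_inv_eq[OF weyl_bij[OF v]] by simp
    then have "w' = w" using wv by simp
    moreover have "u = u'"
      using weyl_comp_inv(2)[OF w'(3), of u] \<open>v = id\<close> unfolding v_def by simp
    ultimately show "d = d'" by (simp add: dd)
  qed
  show "(\<lambda>(w, u). w \<circ> u) ` ({w \<in> W_sub p. z \<circ> w \<in> W_plus} \<times> weyl) = W_sub p"
  proof
    show "(\<lambda>(w, u). w \<circ> u) ` ({w \<in> W_sub p. z \<circ> w \<in> W_plus} \<times> weyl) \<subseteq> W_sub p"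
    proof
      fix v assume "v \<in> (\<lambda>(w, u). w \<circ> u) ` ({w \<in> W_sub p. z \<circ> w \<in> W_plus} \<times> weyl)"
      then obtain w u where "w \<in> W_sub p" "u \<in> weyl" "v = w \<circ> u" by auto
      then show "v \<in> W_sub p" using W_sub_comp_weyl by metis
    qed
    show "W_sub p \<subseteq> (\<lambda>(w, u). w \<circ> u) ` ({w \<in> W_sub p. z \<circ> w \<in> W_plus} \<times> weyl)"
    proof
      fix v assume v: "v \<in> W_sub p"
      have zv: "z \<circ> v \<in> affine_weyl" by (rule affine_weyl_comp(1)[OF z W_sub_affine[OF v]])
      obtain u where u: "u \<in> weyl" "fst (u (center (z \<circ> v))) > 0" "snd (u (center (z \<circ> v))) > 0"
        using chamber_exists[OF center_honeycomb[OF zv]] by blast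
      define w where "w = v \<circ> inv u"
      have w: "w \<in> W_sub p" unfolding w_def by (rule W_sub_comp_weyl[OF v weyl_inv[OF u(1)]])
      have "center (z \<circ> w) = u (center (z \<circ> v))"
        using center_comp_weyl[OF zv weyl_inv[OF u(1)]] inv_inv_eq[OF weyl_bij[OF u(1)]]
        unfolding w_def by (simp only: o_assoc)
      then have "z \<circ> w \<in> W_plus" using plus[OF w] u by simp
      moreover have "v = w \<circ> u" unfolding w_def using weyl_comp_inv(2)[OF u(1), of v] by simp
      ultimately show "v \<in> (\<lambda>(w, u). w \<circ> u) ` ({w \<in> W_sub p. z \<circ> w \<in> W_plus} \<times> weyl)"
        using w u(1) by (intro image_eqI[of _ _ "(w, u)"]) simp_all
    qed
  qed
qed

text \<open>The inner sum over the finite Weyl group in \<open>N_coeff\<close> restores the cosets of which the condition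
\<open>z \<circ> w \<in> W_plus\<close> selects one representative. Both sums are rearranged over the reals, where summability
on a product yields the iterated sum.\<close>
lemma N_coeff_sum:
  assumes p: "p \<noteq> 0" and zy: "z \<in> affine_weyl" "y \<in> affine_weyl"
  shows "finite {w \<in> W_sub p. wdet (horiz w) * N_coeff x y (z \<circ> w) \<noteq> 0}"
    and "(\<Sum>\<^sub>\<infinity>w\<in>W_sub p. wdet (horiz w) * N_coeff x y (z \<circ> w)) =
      (\<Sum>\<^sub>\<infinity>w\<in>W_sub p. wdet (horiz w) * m_coeff x (z \<circ> w \<circ> inv y))"
proof -
  let ?f = "\<lambda>w. wdet (horiz w) * m_coeff x (z \<circ> w \<circ> inv y)"
  let ?S = "{w \<in> W_sub p. z \<circ> w \<in> W_plus}"
  have fin: "finite {w \<in> W_sub p. ?f w \<noteq> 0}" by (rule W_sub_sum(1)[OF p zy])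
  have N: "wdet (horiz w) * N_coeff x y (z \<circ> w) = (if z \<circ> w \<in> W_plus then \<Sum>u\<in>weyl. ?f (w \<circ> u) else 0)"
    if w: "w \<in> W_sub p" for w
  proof -
    have "wdet (horiz w) * (wdet u * m_coeff x (z \<circ> w \<circ> u \<circ> inv y)) = ?f (w \<circ> u)" if u: "u \<in> weyl" for u
    proof -
      have "horiz (w \<circ> u) = horiz w \<circ> u"
        using affine_weyl_comp(2)[OF W_sub_affine[OF w] weyl_affine[OF u]] weyl_horiz[OF u] by simp
      then have "wdet (horiz (w \<circ> u)) = wdet (horiz w) * wdet u"
        using wdet_comp[OF horiz_weyl[OF W_sub_affine[OF w]] u] by simp
      then show ?thesis by (simp only: o_assoc mult.assoc)
    qed
    then show ?thesis unfolding N_coeff_def by (simp add: sum_distrib_left)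
  qed
  have "{w \<in> W_sub p. wdet (horiz w) * N_coeff x y (z \<circ> w) \<noteq> 0} \<subseteq>
    (\<Union>u\<in>weyl. (\<lambda>v. v \<circ> inv u) ` {w \<in> W_sub p. ?f w \<noteq> 0})"
  proof
    fix w assume "w \<in> {w \<in> W_sub p. wdet (horiz w) * N_coeff x y (z \<circ> w) \<noteq> 0}"
    then have w: "w \<in> W_sub p" and "wdet (horiz w) * N_coeff x y (z \<circ> w) \<noteq> 0" by simp_all
    then have "(\<Sum>u\<in>weyl. ?f (w \<circ> u)) \<noteq> 0" unfolding N[OF w] by presburger
    then obtain u where u: "u \<in> weyl" "?f (w \<circ> u) \<noteq> 0" by (rule sum.not_neutral_contains_not_neutral)
    have "w \<circ> u \<in> {w \<in> W_sub p. ?f w \<noteq> 0}" using W_sub_comp_weyl[OF w u(1)] u(2) by (simp only: mem_Collect_eq simp_thms)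
    then have "w \<circ> u \<circ> inv u \<in> (\<lambda>v. v \<circ> inv u) ` {w \<in> W_sub p. ?f w \<noteq> 0}" by (rule imageI)
    then show "w \<in> (\<Union>u\<in>weyl. (\<lambda>v. v \<circ> inv u) ` {w \<in> W_sub p. ?f w \<noteq> 0})"
      unfolding weyl_comp_inv(1)[OF u(1), of w] by (rule UN_I[OF u(1)])
  qed
  then show "finite {w \<in> W_sub p. wdet (horiz w) * N_coeff x y (z \<circ> w) \<noteq> 0}"
    by (rule finite_subset) (intro finite_UN_I finite_weyl finite_imageI fin)
  let ?c = "\<lambda>(w, u). w \<circ> u"
  have summable: "(\<lambda>e. real_of_int (?f (?c e))) summable_on (?S \<times> weyl)"
  proof (rule finite_nonzero_values_imp_summable_on, rule finite_imageD[of ?c])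
    show "inj_on ?c {e \<in> ?S \<times> weyl. real_of_int (?f (?c e)) \<noteq> 0}"
      by (rule inj_on_subset[OF bij_betw_imp_inj_on[OF chamber_transversal[OF zy(1), of p]]]) blast
    show "finite (?c ` {e \<in> ?S \<times> weyl. real_of_int (?f (?c e)) \<noteq> 0})"
    proof (rule finite_subset[OF _ fin], rule subsetI)
      fix v assume "v \<in> ?c ` {e \<in> ?S \<times> weyl. real_of_int (?f (?c e)) \<noteq> 0}"
      then obtain e where v: "v = ?c e" and e: "e \<in> {e \<in> ?S \<times> weyl. real_of_int (?f (?c e)) \<noteq> 0}" by (rule imageE)
      from e have "e \<in> ?S \<times> weyl" "?f (?c e) \<noteq> 0" by (simp_all only: mem_Collect_eq of_int_eq_0_iff simp_thms)
      then show "v \<in> {w \<in> W_sub p. ?f w \<noteq> 0}"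
        unfolding v using bij_betw_apply[OF chamber_transversal[OF zy(1), of p], of e] by (simp only: mem_Collect_eq simp_thms)
    qed
  qed
  have "real_of_int (\<Sum>\<^sub>\<infinity>w\<in>W_sub p. wdet (horiz w) * N_coeff x y (z \<circ> w)) =
    (\<Sum>\<^sub>\<infinity>w\<in>W_sub p. real_of_int (if z \<circ> w \<in> W_plus then \<Sum>u\<in>weyl. ?f (w \<circ> u) else 0))"
    unfolding infsum_of_int[symmetric] by (rule infsum_cong) (simp only: N)
  also have "\<dots> = (\<Sum>\<^sub>\<infinity>w\<in>?S. \<Sum>\<^sub>\<infinity>u\<in>weyl. real_of_int (?f (?c (w, u))))"
    by (rule infsum_cong_neutral; clarsimp)
  also have "\<dots> = (\<Sum>\<^sub>\<infinity>e\<in>?S \<times> weyl. real_of_int (?f (?c e)))"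
    by (rule infsum_Sigma_banach[OF summable])
  also have "\<dots> = (\<Sum>\<^sub>\<infinity>w\<in>W_sub p. real_of_int (?f w))"
    by (rule infsum_reindex_bij_betw[OF chamber_transversal[OF zy(1), of p]])
  also have "\<dots> = real_of_int (\<Sum>\<^sub>\<infinity>w\<in>W_sub p. ?f w)" by (rule infsum_of_int)
  finally show "(\<Sum>\<^sub>\<infinity>w\<in>W_sub p. wdet (horiz w) * N_coeff x y (z \<circ> w)) = (\<Sum>\<^sub>\<infinity>w\<in>W_sub p. ?f w)"
    by simp
qed

section \<open>Roots of unity, alternants and the quantised characters\<close>

definition zeta :: "int \<Rightarrow> int \<Rightarrow> complex" where
  "zeta h t = exp (- (2 * of_real pi * \<i> * of_int t / (3 * of_int h)))"

lemma zeta_add: "zeta h (s + t) = zeta h s * zeta h t"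
  by (simp add: zeta_def exp_add[symmetric] add_divide_distrib distrib_left)

lemma zeta_nonzero [simp]: "zeta h t \<noteq> 0"
  by (simp add: zeta_def)

lemma zeta_0 [simp]: "zeta h 0 = 1"
  by (simp add: zeta_def)

lemma zeta_powi: "zeta h t powi k = zeta h (k * t)"
  by (simp add: zeta_def exp_power_int algebra_simps)

lemma zeta_minus: "zeta h (- t) = inverse (zeta h t)"
  using zeta_powi[of h t "-1"] by (simp add: power_int_minus)

lemma zeta_eq_1_iff:
  assumes "h > 0"
  shows "zeta h t = 1 \<longleftrightarrow> 3 * h dvd t"
proof
  assume "zeta h t = 1"
  then obtain n :: int where "Im (- (2 * of_real pi * \<i> * of_int t / (3 * of_int h))) = of_int (2 * n) * pi"
    unfolding zeta_def exp_eq_1 by blast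
  then have "- (2 * pi * of_int t / (3 * of_int h)) = of_int (2 * n) * pi" by simp
  then have "pi * (of_int t + 3 * of_int h * of_int n) = 0" using assms by (simp add: field_simps)
  then have "of_int (t + 3 * h * n) = (0 :: real)" by simp
  then have "t + 3 * h * n = 0" by (simp only: of_int_eq_0_iff)
  then have "t = 3 * h * - n" by simp
  then show "3 * h dvd t" by (rule dvdI)
next
  assume "3 * h dvd t"
  then obtain k where k: "t = 3 * h * k" by (elim dvdE)
  have "- (2 * of_real pi * \<i> * of_int t / (3 * of_int h)) = 2 * of_real pi * \<i> * of_int (- k)"
    using assms by (simp add: k field_simps)
  then show "zeta h t = 1"
    unfolding zeta_def by (simp only: exp_eq_1) (auto intro!: exI[of _ "- k"])
qed

text \<open>Three times the inner product, as an integer.\<close>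
definition bil :: "weight \<Rightarrow> weight \<Rightarrow> int" where
  "bil \<kappa> \<mu> = 2 * fst \<kappa> * fst \<mu> + fst \<kappa> * snd \<mu> + snd \<kappa> * fst \<mu> + 2 * snd \<kappa> * snd \<mu>"

lemma exp_ip: "exp (- (2 * of_real pi * \<i> / of_int h) * of_real (ip \<nu> \<mu>)) = zeta h (bil \<nu> \<mu>)"
  by (simp add: zeta_def ip_def bil_def mult.commute)

lemma ev_zeta: "ev (zeta h (bil (1, 0) \<mu>)) (zeta h (bil (0, 1) \<mu>)) \<nu> = zeta h (bil \<nu> \<mu>)"
  by (simp add: ev_def zeta_powi zeta_add[symmetric]) (simp add: bil_def algebra_simps)

text \<open>The torus point at which a character of \<open>sl(3)\<close> becomes \<open>\<mu> \<mapsto> chibar h \<xi> \<mu>\<close>.\<close>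
abbreviation coord1 :: "int \<Rightarrow> weight \<Rightarrow> complex" where "coord1 h \<mu> \<equiv> zeta h (bil (1, 0) (\<mu> + \<rho>))"
abbreviation coord2 :: "int \<Rightarrow> weight \<Rightarrow> complex" where "coord2 h \<mu> \<equiv> zeta h (bil (0, 1) (\<mu> + \<rho>))"

lemma torus_point_zeta: "torus_point (zeta h s) (zeta h t)"
  by unfold_locales simp_all

lemma chibar_eq: "chibar h \<xi> \<mu> = torus_point.sl3_char (coord1 h \<mu>) (coord2 h \<mu>) (\<xi> + \<rho>)"
  unfolding torus_point.sl3_char_def[OF torus_point_zeta] pairing_def chibar_def exp_ip ev_zeta weight_mult_def
  by simp

lemma root_lattice_bil: "\<beta> \<in> root_lattice \<Longrightarrow> 3 dvd bil \<beta> \<mu>"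
proof (elim root_lattice_coords)
  fix m n assume "\<beta> = (2 * m - n, 2 * n - m)"
  then have "bil \<beta> \<mu> = 3 * (m * fst \<mu> + n * snd \<mu>)" by (simp add: bil_def algebra_simps)
  then show "3 dvd bil \<beta> \<mu>" by simp
qed

lemma bil_scale: "bil (scale k \<nu>) \<mu> = k * bil \<nu> \<mu>"
  by (simp add: bil_def scale_def algebra_simps)

context torus_point
begin

definition alternant :: "weight \<Rightarrow> complex" where
  "alternant \<kappa> = (\<Sum>w\<in>weyl. of_int (wdet w) * ev X Y (w \<kappa>))"

lemma alternant_char: "alternant \<rho> * sl3_char \<kappa> = alternant \<kappa>"
  using sl3_char_denominator[of \<kappa>] by (simp add: alternant_def)

lemma alternant_weyl:
  assumes "u \<in> weyl"
  shows "alternant (u \<kappa>) = of_int (wdet u) * alternant \<kappa>"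
proof -
  have "alternant (u \<kappa>) = alternant \<rho> * sl3_char (u \<kappa>)" by (rule alternant_char[symmetric])
  also have "\<dots> = of_int (wdet u) * (alternant \<rho> * sl3_char \<kappa>)" by (simp add: sl3_char_weyl assms)
  finally show ?thesis by (simp only: alternant_char)
qed

lemma alternant_affine_antisym:
  assumes "\<And>\<beta>. \<beta> \<in> root_lattice \<Longrightarrow> ev X Y (scale h \<beta>) = 1"
  shows "affine_antisym h alternant"
  unfolding affine_antisym_def
proof (intro conjI ballI allI)
  fix \<beta> \<kappa> assume \<beta>: "\<beta> \<in> root_lattice"
  show "alternant (\<kappa> + scale h \<beta>) = alternant \<kappa>"
    unfolding alternant_def
    by (intro sum.cong refl) (simp add: weyl_add weyl_scale ev_add assms root_lattice_weyl \<beta>)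
qed (rule alternant_weyl)

lemma alternant_rho: "alternant \<rho> = X * Y * (1 - Y / X ^ 2) * (1 - X / Y ^ 2) * (1 - 1 / (X * Y))"
  using nz by (simp add: alternant_def sum_weyl weight_simps ev_def power_int_minus field_simps power2_eq_square)

lemma sl3_char_small:
  "sl3_char (2, 1) = fund1" "sl3_char (1, 2) = fund2" "sl3_char (2, 2) = fund1 * fund2 - 1"
  "sl3_char (2, -1) = -1" "sl3_char (-1, 2) = -1" "sl3_char (-2, 1) = 1" "sl3_char (1, -2) = 1"
proof -
  show f1: "sl3_char (2, 1) = fund1" using sl3_char_rec1[of 1 1] by (simp add: sl3_char_wall sl3_char_rho)
  show f2: "sl3_char (1, 2) = fund2" using sl3_char_rec2[of 1 1] by (simp add: sl3_char_wall sl3_char_rho)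
  show "sl3_char (2, 2) = fund1 * fund2 - 1"
    using sl3_char_rec1[of 1 2] by (simp add: sl3_char_wall sl3_char_rho f2 algebra_simps)
  show a: "sl3_char (2, -1) = -1" using sl3_char_s2[of 1 1] by (simp add: sl3_char_rho)
  show b: "sl3_char (-1, 2) = -1" using sl3_char_s1[of 1 1] by (simp add: sl3_char_rho)
  show "sl3_char (-2, 1) = 1" using sl3_char_s1[of 2 "-1"] by (simp add: a)
  show "sl3_char (1, -2) = 1" using sl3_char_s2[of "-1" 2] by (simp add: b)
qed

lemma char3_scale3: "char3 (scale 3 \<xi>) = sl3_char \<xi>"
  using char3_scale[of "fst \<xi>" "snd \<xi>"] by (simp add: scale_def)

lemma char3_off:
  assumes "\<eta> \<in> honeycomb"
  shows "char3 (scale 3 \<xi> + \<eta>) = 0"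
  using assms by (cases \<xi>; cases \<eta>) (auto simp: char3_def honeycomb_iff scale_def dvd_add_right_iff)

text \<open>The points \<open>\<rho> + u \<rho>\<close> and \<open>\<rho> + 2 u \<rho>\<close> that lie in \<open>3P\<close> are three times the vertices \<open>0\<close>, \<open>\<Lambda>\<^sub>1\<close>, \<open>\<Lambda>\<^sub>2\<close>
of the fundamental alcove and three times their mirror images.\<close>
lemma shells_at_center:
  assumes v: "v \<in> weyl"
  shows "shell1 (scale 3 \<xi> + v \<rho>) = sl3_char \<xi> + sl3_char (\<xi> + v (1, 0)) + sl3_char (\<xi> + v (0, 1))"
    and "shell2 (scale 3 \<xi> + v \<rho>) = sl3_char (\<xi> + v (1, 1)) + sl3_char (\<xi> + v (-1, 1)) + sl3_char (\<xi> + v (1, -1))"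
proof -
  have v3: "char3 (scale 3 \<xi> + v (3 * i, 3 * j)) = sl3_char (\<xi> + v (i, j))" for i j
  proof -
    have "(3 * i, 3 * j) = scale 3 (i, j)" by (simp add: scale_def)
    then have "scale 3 \<xi> + v (3 * i, 3 * j) = scale 3 (\<xi> + v (i, j))"
      by (simp only: weyl_scale[OF v]) (simp add: scale_def algebra_simps)
    then show ?thesis by (simp only: char3_scale3)
  qed
  have v0: "char3 (scale 3 \<xi> + v (i, j)) = 0" if "(i, j) \<in> honeycomb" for i j
    using char3_off[OF honeycomb_weyl[OF v that]] .
  have out: "orbit_sum (scale 3 \<xi> + v \<rho>) \<eta> = (\<Sum>u\<in>weyl. char3 (scale 3 \<xi> + v (\<rho> + u \<eta>)))" for \<eta>
    unfolding orbit_sum_def using sum_weyl_left[OF v, of "\<lambda>u. char3 (scale 3 \<xi> + v \<rho> + u \<eta>)"]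
    by (simp add: weyl_add[OF v] add.assoc)
  have zero: "v (0, 0) = 0" using weyl_diff[OF v, of 0 0] by (simp add: zero_prod_def)
  show "shell1 (scale 3 \<xi> + v \<rho>) = sl3_char \<xi> + sl3_char (\<xi> + v (1, 0)) + sl3_char (\<xi> + v (0, 1))"
    using v3[of 0 0] v3[of 1 0] v3[of 0 1] v0[of 2 2] v0[of "-1" 2] v0[of 2 "-1"]
    unfolding out by (simp add: sum_weyl weight_simps honeycomb_iff zero)
  show "shell2 (scale 3 \<xi> + v \<rho>) = sl3_char (\<xi> + v (1, 1)) + sl3_char (\<xi> + v (-1, 1)) + sl3_char (\<xi> + v (1, -1))"
    using v3[of 1 1] v3[of "-1" 1] v3[of 1 "-1"] v0[of "-1" 5] v0[of 5 "-1"] v0[of "-1" "-1"]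
    unfolding out by (simp add: sum_weyl weight_simps honeycomb_iff)
qed

end

text \<open>The six characters in the definition of the quantised character are those at the vertices and mirror
images in the two shells around \<open>center y\<close>. The phase is trivial since the vertical part
has triality zero.\<close>
lemma chi_eq_mode:
  assumes y: "y \<in> affine_weyl" and mode: "honeycomb_mode (coord1 p \<mu>) (coord2 p \<mu>) (F_fun p \<mu>)"
  shows "chi p y \<mu> = honeycomb_mode.mode (coord1 p \<mu>) (coord2 p \<mu>) (F_fun p \<mu>) (center y)"
proof -
  interpret honeycomb_mode "coord1 p \<mu>" "coord2 p \<mu>" "F_fun p \<mu>" by (rule mode)
  obtain w \<xi> where w: "w \<in> weyl" "\<xi> \<in> root_lattice" "y = w \<circ> transl (- \<xi>)"
    using y by (rule affine_weylE)
  have hv: "horiz y = w" "vert y = \<xi>" unfolding w(3) by (intro affine_decomposition w)+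
  have "triality \<xi> = 0"
    using w(2) by (cases \<xi>) (simp add: triality_def root_lattice_iff, presburger)
  then have phase: "exp (- (2 * of_real pi * \<i> * of_int p / 3) * of_int (triality \<mu>) * of_int (triality \<xi>)) = 1"
    by simp
  have c: "chibar p (\<xi> + shifted (inv w) \<beta>) \<mu> = sl3_char (\<xi> + inv w (\<beta> + \<rho>))" for \<beta>
  proof -
    have "\<xi> + shifted (inv w) \<beta> + \<rho> = \<xi> + inv w (\<beta> + \<rho>)" by (simp add: shifted_def)
    then show ?thesis by (simp only: chibar_eq)
  qed
  have b: "0 + \<rho> = (1, 1)" "scale (-2) \<Lambda>\<^sub>1 + \<rho> = (-1, 1)" "scale (-2) \<Lambda>\<^sub>2 + \<rho> = (1, -1)"
    "- \<rho> + \<rho> = 0" "- \<Lambda>\<^sub>2 + \<rho> = (1, 0)" "- \<Lambda>\<^sub>1 + \<rho> = (0, 1)"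
    by (simp_all add: weight_simps zero_prod_def)
  have zero: "inv w 0 = 0" using weyl_diff[OF weyl_inv[OF w(1)], of 0 0] by simp
  have ctr: "center y = scale 3 \<xi> + inv w \<rho>" unfolding w(3) by (rule center_eq[OF w(1,2)])
  show ?thesis
    unfolding chi_def Let_def hv phase c b zero ctr mode_def shells_at_center[OF weyl_inv[OF w(1)]] by simp
qed

section \<open>Periodicity of the eigenfunction\<close>

context honeycomb_mode
begin

lemma mode_affine_antisymI:
  assumes "\<And>\<beta> \<kappa>. \<beta> \<in> root_lattice \<Longrightarrow> mode (\<kappa> + scale h \<beta>) = mode \<kappa>"
  shows "affine_antisym h mode"
  using assms mode_weyl unfolding affine_antisym_def by blast

lemma mode_periodic_regular:
  assumes regular: "alternant \<rho> \<noteq> 0"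
    and period: "\<And>\<beta>. \<beta> \<in> root_lattice \<Longrightarrow> ev X Y (scale p \<beta>) = 1"
  shows "affine_antisym (3 * p) mode"
proof (rule mode_affine_antisymI)
  fix \<beta> \<kappa> assume \<beta>: "\<beta> \<in> root_lattice"
  have "alternant (\<kappa> + scale p \<beta>) = alternant \<kappa>" for \<kappa>
    using alternant_affine_antisym[OF period] \<beta> unfolding affine_antisym_def by blast
  then have char: "sl3_char (\<kappa> + scale p \<beta>) = sl3_char \<kappa>" for \<kappa>
    using alternant_char regular by (metis mult_left_cancel)
  have char3: "char3 (\<kappa> + scale (3 * p) \<beta>) = char3 \<kappa>" for \<kappa>
  proof (cases "3 dvd fst \<kappa> \<and> 3 dvd snd \<kappa>")
    case True
    then obtain \<zeta> where \<zeta>: "\<kappa> = scale 3 \<zeta>" by (cases \<kappa>) (auto elim!: dvdE simp: scale_def)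
    then have "\<kappa> + scale (3 * p) \<beta> = scale 3 (\<zeta> + scale p \<beta>)" by (simp add: scale_def algebra_simps)
    then show ?thesis by (simp only: \<zeta> char3_scale3 char)
  next
    case False
    then show ?thesis by (cases \<kappa>; cases \<beta>) (auto simp: char3_def scale_def dvd_add_left_iff)
  qed
  show "mode (\<kappa> + scale (3 * p) \<beta>) = mode \<kappa>"
  proof -
    have "orbit_sum (\<kappa> + scale (3 * p) \<beta>) \<eta> = orbit_sum \<kappa> \<eta>" for \<eta>
      unfolding orbit_sum_def
    proof (intro sum.cong refl)
      fix w
      have "\<kappa> + scale (3 * p) \<beta> + w \<eta> = \<kappa> + w \<eta> + scale (3 * p) \<beta>" by (simp add: add_ac)
      then show "char3 (\<kappa> + scale (3 * p) \<beta> + w \<eta>) = char3 (\<kappa> + w \<eta>)" by (simp only: char3)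
    qed
    then show ?thesis by (simp only: mode_def)
  qed
qed

lemma mode_rec:
  "mode (\<tau> + (3, 0)) + mode (\<tau> + (-3, 3)) + mode (\<tau> + (0, -3)) = fund1 * mode \<tau>"
  "mode (\<tau> + (0, 3)) + mode (\<tau> + (3, -3)) + mode (\<tau> + (-3, 0)) = fund2 * mode \<tau>"
proof -
  have rec: "orbit_sum (\<tau> + (3, 0)) \<eta> + orbit_sum (\<tau> + (-3, 3)) \<eta> + orbit_sum (\<tau> + (0, -3)) \<eta> = fund1 * orbit_sum \<tau> \<eta>" for \<eta>
    unfolding orbit_sum_def sum.distrib[symmetric] sum_distrib_left char3_rec(1)[symmetric]
    by (simp add: add_ac)
  have "mode (\<tau> + (3, 0)) + mode (\<tau> + (-3, 3)) + mode (\<tau> + (0, -3)) =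
    (F + 2) * (shell1 (\<tau> + (3, 0)) + shell1 (\<tau> + (-3, 3)) + shell1 (\<tau> + (0, -3))) +
    (shell2 (\<tau> + (3, 0)) + shell2 (\<tau> + (-3, 3)) + shell2 (\<tau> + (0, -3)))"
    by (simp add: mode_def algebra_simps)
  also have "\<dots> = fund1 * mode \<tau>" unfolding rec by (simp add: mode_def algebra_simps)
  finally show "mode (\<tau> + (3, 0)) + mode (\<tau> + (-3, 3)) + mode (\<tau> + (0, -3)) = fund1 * mode \<tau>" .
next
  have rec: "orbit_sum (\<tau> + (0, 3)) \<eta> + orbit_sum (\<tau> + (3, -3)) \<eta> + orbit_sum (\<tau> + (-3, 0)) \<eta> = fund2 * orbit_sum \<tau> \<eta>" for \<eta>
    unfolding orbit_sum_def sum.distrib[symmetric] sum_distrib_left char3_rec(2)[symmetric]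
    by (simp add: add_ac)
  have "mode (\<tau> + (0, 3)) + mode (\<tau> + (3, -3)) + mode (\<tau> + (-3, 0)) =
    (F + 2) * (shell1 (\<tau> + (0, 3)) + shell1 (\<tau> + (3, -3)) + shell1 (\<tau> + (-3, 0))) +
    (shell2 (\<tau> + (0, 3)) + shell2 (\<tau> + (3, -3)) + shell2 (\<tau> + (-3, 0)))"
    by (simp add: mode_def algebra_simps)
  also have "\<dots> = fund2 * mode \<tau>" unfolding rec by (simp add: mode_def algebra_simps)
  finally show "mode (\<tau> + (0, 3)) + mode (\<tau> + (3, -3)) + mode (\<tau> + (-3, 0)) = fund2 * mode \<tau>" .
qed

text \<open>Here \<open>x\<close>, \<open>x\<close>, \<open>x\<^sup>-\<^sup>2\<close> are the exponentials of the weights of the first fundamental module. Each of the three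
powers on the right is an exponential in \<open>(m, n)\<close> with the same eigenvalues \<open>fund1\<close> and \<open>fund2\<close> under the two
recursions, so it suffices to compare six values. At a general torus point with
two equal exponentials, characters carry an additional linear factor; it cancels in the combination of
shells for this value of \<open>F\<close>.\<close>
lemma mode_singular:
  assumes x: "x \<noteq> 0" "fund1 = 2 * x + 1 / x ^ 2" "fund2 = 2 / x + x ^ 2" "F = - (1 + x + 1 / x)"
  shows "(1 + x + x ^ 2) * mode (scale 3 (m, n) + \<rho>) =
    x powi (m - n + 1) + x powi (m + 2 * n + 2) + x powi (- 2 * m - n)"
proof -
  define P where "P = (\<lambda>m n. x powi (m - n + 1) + x powi (m + 2 * n + 2) + x powi (- 2 * m - n))"
  define G where "G = (\<lambda>(m, n) (_::unit). (1 + x + x ^ 2) * mode (scale 3 (m, n) + \<rho>) - P m n)"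
  have shift: "x powi k' = x powi k * x powi i" if "k' = k + i" for k' k i
    using x(1) that by (simp add: power_int_add)
  have P1: "P (m + 1) n + P (m - 1) (n + 1) + P m (n - 1) = fund1 * P m n" for m n
  proof -
    have e: "x powi (m + 1 - n + 1) = x powi (m - n + 1) * x powi 1"
      "x powi (m + 1 + 2 * n + 2) = x powi (m + 2 * n + 2) * x powi 1"
      "x powi (- 2 * (m + 1) - n) = x powi (- 2 * m - n) * x powi (-2)"
      "x powi (m - 1 - (n + 1) + 1) = x powi (m - n + 1) * x powi (-2)"
      "x powi (m - 1 + 2 * (n + 1) + 2) = x powi (m + 2 * n + 2) * x powi 1"
      "x powi (- 2 * (m - 1) - (n + 1)) = x powi (- 2 * m - n) * x powi 1"
      "x powi (m - (n - 1) + 1) = x powi (m - n + 1) * x powi 1"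
      "x powi (m + 2 * (n - 1) + 2) = x powi (m + 2 * n + 2) * x powi (-2)"
      "x powi (- 2 * m - (n - 1)) = x powi (- 2 * m - n) * x powi 1"
      by (rule shift; simp)+
    have "P (m + 1) n + P (m - 1) (n + 1) + P m (n - 1) = (2 * x powi 1 + x powi (-2)) * P m n"
      unfolding P_def e by (simp add: algebra_simps)
    also have "2 * x powi 1 + x powi (-2) = fund1" unfolding x(2) by (simp add: power_int_minus field_simps)
    finally show ?thesis .
  qed
  have P2: "P m (n + 1) + P (m + 1) (n - 1) + P (m - 1) n = fund2 * P m n" for m n
  proof -
    have e: "x powi (m - (n + 1) + 1) = x powi (m - n + 1) * x powi (-1)"
      "x powi (m + 2 * (n + 1) + 2) = x powi (m + 2 * n + 2) * x powi 2"
      "x powi (- 2 * m - (n + 1)) = x powi (- 2 * m - n) * x powi (-1)"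
      "x powi (m + 1 - (n - 1) + 1) = x powi (m - n + 1) * x powi 2"
      "x powi (m + 1 + 2 * (n - 1) + 2) = x powi (m + 2 * n + 2) * x powi (-1)"
      "x powi (- 2 * (m + 1) - (n - 1)) = x powi (- 2 * m - n) * x powi (-1)"
      "x powi (m - 1 - n + 1) = x powi (m - n + 1) * x powi (-1)"
      "x powi (m - 1 + 2 * n + 2) = x powi (m + 2 * n + 2) * x powi (-1)"
      "x powi (- 2 * (m - 1) - n) = x powi (- 2 * m - n) * x powi 2"
      by (rule shift; simp)+
    have "P m (n + 1) + P (m + 1) (n - 1) + P (m - 1) n = (2 * x powi (-1) + x powi 2) * P m n"
      unfolding P_def e by (simp add: algebra_simps)
    also have "2 * x powi (-1) + x powi 2 = fund2" unfolding x(3) by (simp add: power_int_minus field_simps)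
    finally show ?thesis .
  qed
  have at_centre: "mode (scale 3 (m, n) + \<rho>) = (F + 2) * (sl3_char (m, n) + sl3_char (m + 1, n) + sl3_char (m, n + 1)) +
    (sl3_char (m + 1, n + 1) + sl3_char (m - 1, n + 1) + sl3_char (m + 1, n - 1))" for m n
    using shells_at_center[OF weyl_id, of "(m, n)"] by (simp add: mode_def)
  have "G (m, n) \<in> {\<lambda>_. 0}"
  proof (rule lattice_recursion_closure[of _ G fund1 fund2])
    fix i j t
    have e: "scale 3 (i, j) + \<rho> + (3, 0) = scale 3 (i + 1, j) + \<rho>" "scale 3 (i, j) + \<rho> + (-3, 3) = scale 3 (i - 1, j + 1) + \<rho>"
      "scale 3 (i, j) + \<rho> + (0, -3) = scale 3 (i, j - 1) + \<rho>" "scale 3 (i, j) + \<rho> + (0, 3) = scale 3 (i, j + 1) + \<rho>"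
      "scale 3 (i, j) + \<rho> + (3, -3) = scale 3 (i + 1, j - 1) + \<rho>" "scale 3 (i, j) + \<rho> + (-3, 0) = scale 3 (i - 1, j) + \<rho>"
      by (simp_all add: weight_simps algebra_simps)
    note r = mode_rec[of "scale 3 (i, j) + \<rho>", unfolded e]
    have "G (i + 1, j) t + G (i - 1, j + 1) t + G (i, j - 1) t =
      (1 + x + x ^ 2) * (mode (scale 3 (i + 1, j) + \<rho>) + mode (scale 3 (i - 1, j + 1) + \<rho>) + mode (scale 3 (i, j - 1) + \<rho>))
      - (P (i + 1) j + P (i - 1) (j + 1) + P i (j - 1))"
      by (simp add: G_def algebra_simps)
    then show "G (i + 1, j) t + G (i - 1, j + 1) t + G (i, j - 1) t = fund1 * G (i, j) t"
      unfolding r P1 by (simp add: G_def algebra_simps)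
    have "G (i, j + 1) t + G (i + 1, j - 1) t + G (i - 1, j) t =
      (1 + x + x ^ 2) * (mode (scale 3 (i, j + 1) + \<rho>) + mode (scale 3 (i + 1, j - 1) + \<rho>) + mode (scale 3 (i - 1, j) + \<rho>))
      - (P i (j + 1) + P (i + 1) (j - 1) + P (i - 1) j)"
      by (simp add: G_def algebra_simps)
    then show "G (i, j + 1) t + G (i + 1, j - 1) t + G (i - 1, j) t = fund2 * G (i, j) t"
      unfolding r P2 by (simp add: G_def algebra_simps)
  next
    have walls: "sl3_char (-1, 1) = 0" "sl3_char (1, -1) = 0" "sl3_char (-2, 2) = 0"
      using sl3_char_wall(3)[of "-1"] sl3_char_wall(3)[of 1] sl3_char_wall(3)[of "-2"] by simp_all
    have "G (-1, 0) t = 0" "G (0, 0) t = 0" "G (1, 0) t = 0" "G (-1, 1) t = 0" "G (0, 1) t = 0" "G (1, 1) t = 0" for t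
      unfolding G_def P_def prod.case at_centre unfolding x(4) using x(1)
      by (simp_all add: walls sl3_char_wall sl3_char_rho sl3_char_small x(2,3) power_int_minus)
         (simp_all add: field_simps power2_eq_square power_numeral_reduce)
    then show "G \<zeta> \<in> {\<lambda>_. 0}" if "\<zeta> \<in> {(-1, 0), (0, 0), (1, 0), (-1, 1), (0, 1), (1, 1)}" for \<zeta>
      using that by (auto simp: fun_eq_iff)
  qed auto
  then have "G (m, n) () = 0" by simp
  then show ?thesis by (simp add: G_def P_def)
qed

text \<open>The closed form determines the eigenfunction because \<open>1 + x + x\<^sup>2 = - x F\<close> is not zero. It covers the
honeycomb points of the class of \<open>\<rho>\<close>; a reflection carries the other class to it.\<close>
lemma mode_periodic_singular:
  assumes x: "x \<noteq> 0" "fund1 = 2 * x + 1 / x ^ 2" "fund2 = 2 / x + x ^ 2" "F = - (1 + x + 1 / x)"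
    and F: "F \<noteq> 0" and period: "\<And>k. x powi (3 * p * k) = 1"
  shows "affine_antisym (3 * p) mode"
proof (rule mode_affine_antisymI)
  have nonzero: "1 + x + x ^ 2 \<noteq> 0"
  proof
    assume "1 + x + x ^ 2 = 0"
    moreover have "x * F = - (1 + x + x ^ 2)" unfolding x(4) using x(1) by (simp add: field_simps power2_eq_square)
    ultimately show False using F x(1) by simp
  qed
  have sh: "x powi (k + 3 * p * l) = x powi k" for k l
    using period[of l] x(1) power_int_add[of x k "3 * p * l"] by simp
  have up: "mode (\<kappa> + scale (3 * p) \<beta>) = mode \<kappa>" if \<beta>: "\<beta> \<in> root_lattice" and \<kappa>: "\<kappa> = scale 3 (m, n) + \<rho>" for \<kappa> \<beta> m n
  proof -
    obtain i j where ij: "\<beta> = (2 * i - j, 2 * j - i)" using \<beta> by (rule root_lattice_coords)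
    have "\<kappa> + scale (3 * p) \<beta> = scale 3 (m + p * (2 * i - j), n + p * (2 * j - i)) + \<rho>"
      by (simp add: \<kappa> ij weight_simps algebra_simps)
    moreover have e: "m + p * (2 * i - j) - (n + p * (2 * j - i)) + 1 = (m - n + 1) + 3 * p * (i - j)"
      "m + p * (2 * i - j) + 2 * (n + p * (2 * j - i)) + 2 = (m + 2 * n + 2) + 3 * p * j"
      "- 2 * (m + p * (2 * i - j)) - (n + p * (2 * j - i)) = (- 2 * m - n) + 3 * p * (- i)"
      by (simp_all add: algebra_simps)
    ultimately have "(1 + x + x ^ 2) * mode (\<kappa> + scale (3 * p) \<beta>) =
      x powi ((m - n + 1) + 3 * p * (i - j)) + x powi ((m + 2 * n + 2) + 3 * p * j) + x powi ((- 2 * m - n) + 3 * p * (- i))"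
      by (simp only: mode_singular[OF x] e)
    also have "\<dots> = (1 + x + x ^ 2) * mode \<kappa>" by (simp only: sh \<kappa> mode_singular[OF x])
    finally show ?thesis using nonzero by simp
  qed
  fix \<beta> \<kappa> :: weight assume \<beta>: "\<beta> \<in> root_lattice"
  obtain a b where ab: "\<kappa> = (a, b)" by (cases \<kappa>)
  show "mode (\<kappa> + scale (3 * p) \<beta>) = mode \<kappa>"
  proof (cases "\<kappa> \<in> honeycomb")
    case False
    moreover obtain c d where cd: "\<beta> = (c, d)" by (cases \<beta>)
    have "\<kappa> + scale (3 * p) \<beta> = (a + 3 * (p * c), b + 3 * (p * d))" by (simp add: ab cd scale_def)
    then have "\<kappa> + scale (3 * p) \<beta> \<notin> honeycomb"
      using False unfolding ab by (simp only: honeycomb_iff) presburger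
    ultimately show ?thesis by (simp add: mode_outside)
  next
    case True
    then have "a mod 3 = 1 \<or> a mod 3 = 2" unfolding ab honeycomb_iff by presburger
    then show ?thesis
    proof
      assume "a mod 3 = 1"
      then have "a = 3 * (a div 3) + 1" "b = 3 * (b div 3) + 1"
        using True unfolding ab honeycomb_iff by presburger+
      then have "\<kappa> = scale 3 (a div 3, b div 3) + \<rho>" by (simp add: ab weight_simps)
      then show ?thesis by (rule up[OF \<beta>])
    next
      assume "a mod 3 = 2"
      then have "- a = 3 * (- a div 3) + 1" "a + b = 3 * ((a + b) div 3) + 1"
        using True unfolding ab honeycomb_iff by presburger+
      then have "s\<^sub>1 \<kappa> = scale 3 (- a div 3, (a + b) div 3) + \<rho>" by (simp add: ab weight_simps)
      from up[OF root_lattice_weyl[OF weyl_s1 \<beta>] this]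
      have "mode (s\<^sub>1 (\<kappa> + scale (3 * p) \<beta>)) = mode (s\<^sub>1 \<kappa>)" by (simp add: s1_add s1_scale)
      then show ?thesis by (simp add: mode_weyl)
    qed
  qed
qed

end

lemma zeta_diff: "zeta h (s - t) = zeta h s / zeta h t"
  using zeta_add[of h s "- t"] by (simp add: zeta_minus divide_inverse)

lemma zeta_power: "zeta h t ^ k = zeta h (int k * t)"
  using zeta_powi[of h t "int k"] by simp

lemma zeta_period:
  assumes h: "h > 0" and \<beta>: "\<beta> \<in> root_lattice"
  shows "ev (coord1 h \<mu>) (coord2 h \<mu>) (scale h \<beta>) = 1"
proof -
  obtain k where "bil \<beta> (\<mu> + \<rho>) = 3 * k" using root_lattice_bil[OF \<beta>, of "\<mu> + \<rho>"] by (elim dvdE)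
  then have "3 * h dvd bil (scale h \<beta>) (\<mu> + \<rho>)" by (simp add: bil_scale)
  then show ?thesis unfolding ev_zeta zeta_eq_1_iff[OF h] .
qed

text \<open>The three factors of the Weyl denominator compare the exponentials of the positive roots with \<open>1\<close>.\<close>
lemma zeta_regular:
  assumes h: "h > 0" and mn: "\<mu> + \<rho> = (m, n)" and "\<not> h dvd m" "\<not> h dvd n" "\<not> h dvd (m + n)"
  shows "torus_point.alternant (coord1 h \<mu>) (coord2 h \<mu>) \<rho> \<noteq> 0"
proof -
  interpret torus_point "coord1 h \<mu>" "coord2 h \<mu>" by (rule torus_point_zeta)
  have "coord2 h \<mu> / coord1 h \<mu> ^ 2 = zeta h (3 * - m)" "coord1 h \<mu> / coord2 h \<mu> ^ 2 = zeta h (3 * - n)"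
    "1 / (coord1 h \<mu> * coord2 h \<mu>) = zeta h (3 * - (m + n))"
    unfolding mn zeta_power zeta_diff[symmetric] zeta_add[symmetric] zeta_0[of h, symmetric]
    by (simp_all add: bil_def algebra_simps)
  moreover have cancel: "3 * h dvd 3 * t \<longleftrightarrow> h dvd t" for t by simp
  have "zeta h (3 * - m) \<noteq> 1" "zeta h (3 * - n) \<noteq> 1" "zeta h (3 * - (m + n)) \<noteq> 1"
    unfolding zeta_eq_1_iff[OF h] using assms(3-5) by (simp_all only: cancel dvd_minus_iff simp_thms)
  ultimately show ?thesis unfolding alternant_rho by simp
qed

lemma honeycomb_mode_F_fun: "honeycomb_mode (coord1 p \<mu>) (coord2 p \<mu>) (F_fun p \<mu>)"
proof -
  interpret torus_point "coord1 p \<mu>" "coord2 p \<mu>" by (rule torus_point_zeta)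
  have \<Lambda>: "\<Lambda>\<^sub>1 + \<rho> = (2, 1)" "\<Lambda>\<^sub>2 + \<rho> = (1, 2)" by (simp_all add: weight_simps)
  have "F_fun p \<mu> ^ 2 = 3 + fund1 + fund2"
    unfolding F_fun_def power_mult_distrib chibar_eq \<Lambda> sl3_char_small by (simp add: eps_def)
  then show ?thesis by unfold_locales
qed

text \<open>This lemma and the next determine the sign of \<open>1 + 2 cos t\<close>, hence of \<open>1 + x + 1/x\<close>, for the repeated exponential.\<close>
lemma cos_above:
  assumes "0 < p" "2 * p < s" "s \<le> 3 * p"
  shows "cos (2 * pi * s / (3 * p)) > - 1 / 2"
proof -
  have "cos (2 * pi * s / (3 * p)) = cos (2 * pi - 2 * pi * s / (3 * p))" by (simp add: cos_diff)
  moreover have "cos (2 * pi / 3) < cos (2 * pi - 2 * pi * s / (3 * p))"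
  proof (rule cos_monotone_0_pi)
    show "0 \<le> 2 * pi - 2 * pi * s / (3 * p)" using assms by (simp add: field_simps)
    have "pi * (2 * p) < pi * s" using assms by simp
    then show "2 * pi - 2 * pi * s / (3 * p) < 2 * pi / 3" using assms(1) by (simp add: field_simps)
    show "2 * pi / 3 \<le> pi" by simp
  qed
  ultimately show ?thesis using cos_120 by simp
qed

lemma cos_below:
  assumes "0 < p" "p < s" "s < 2 * p"
  shows "cos (2 * pi * s / (3 * p)) < - 1 / 2"
proof -
  have below: "cos \<theta> < - 1 / 2" if "2 * pi / 3 < \<theta>" "\<theta> \<le> pi" for \<theta>
    using cos_monotone_0_pi[of "2 * pi / 3" \<theta>] that cos_120 by simp
  have "pi * p < pi * s" "pi * s < pi * (2 * p)" using assms by simp_all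
  then have 1: "2 * pi / 3 < 2 * pi * s / (3 * p)" and 2: "2 * pi / 3 < 2 * pi - 2 * pi * s / (3 * p)"
    using assms(1) by (simp_all add: field_simps)
  have "cos (2 * pi * s / (3 * p)) = cos (2 * pi - 2 * pi * s / (3 * p))" by (simp add: cos_diff)
  then show ?thesis using below[OF 1] below[OF 2] by (cases "2 * pi * s / (3 * p) \<le> pi") simp_all
qed

lemma zeta_cos: "zeta h s + 1 / zeta h s = of_real (2 * cos (2 * pi * of_int s / (3 * of_int h)))"
proof -
  have cis: "zeta h t = cis (- (2 * pi * of_int t / (3 * of_int h)))" for t
    by (simp add: zeta_def cis_conv_exp mult_ac)
  have "1 / zeta h s = zeta h (- s)" by (simp add: zeta_minus divide_inverse)
  then show ?thesis unfolding cis by (simp add: complex_eq_iff)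
qed

text \<open>The radicand of \<open>F\<close> is the square of the real number \<open>1 + x + 1/x\<close>. The sign condition says that \<open>\<epsilon>\<close>
makes \<open>F\<close> its negative.\<close>
lemma mode_affine_antisym_singular:
  assumes p: "p > 0"
    and x_def: "x = zeta p s"
    and x: "torus_point.fund1 (coord1 p \<mu>) (coord2 p \<mu>) = 2 * x + 1 / x ^ 2"
      "torus_point.fund2 (coord1 p \<mu>) (coord2 p \<mu>) = 2 / x + x ^ 2"
    and sign: "1 + 2 * cos (2 * pi * of_int s / (3 * of_int p)) > 0 \<and> eps p \<mu> = -1 \<or>
      1 + 2 * cos (2 * pi * of_int s / (3 * of_int p)) < 0 \<and> eps p \<mu> = 1"
  shows "affine_antisym (3 * p) (honeycomb_mode.mode (coord1 p \<mu>) (coord2 p \<mu>) (F_fun p \<mu>))"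
proof -
  interpret honeycomb_mode "coord1 p \<mu>" "coord2 p \<mu>" "F_fun p \<mu>" by (rule honeycomb_mode_F_fun)
  define r where "r = 1 + 2 * cos (2 * pi * of_int s / (3 * of_int p))"
  have x0: "x \<noteq> 0" by (simp add: x_def)
  have r: "1 + x + 1 / x = of_real r"
    using zeta_cos[of p s] by (simp add: x_def r_def add.assoc)
  have \<Lambda>: "\<Lambda>\<^sub>1 + \<rho> = (2, 1)" "\<Lambda>\<^sub>2 + \<rho> = (1, 2)" by (simp_all add: weight_simps)
  have "3 + chibar p \<Lambda>\<^sub>1 \<mu> + chibar p \<Lambda>\<^sub>2 \<mu> = (1 + x + 1 / x) ^ 2"
    unfolding chibar_eq \<Lambda> sl3_char_small x using x0
    by (simp add: field_simps power2_eq_square)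
  also have "\<dots> = of_real (r ^ 2)" unfolding r by simp
  finally have "csqrt (3 + chibar p \<Lambda>\<^sub>1 \<mu> + chibar p \<Lambda>\<^sub>2 \<mu>) = of_real \<bar>r\<bar>"
    by (simp only:) (subst csqrt_of_real_nonneg, simp_all)
  then have "F_fun p \<mu> = - of_real r" "r \<noteq> 0"
    using sign unfolding F_fun_def r_def[symmetric] by auto
  then have F: "F_fun p \<mu> = - (1 + x + 1 / x)" "F_fun p \<mu> \<noteq> 0" unfolding r by simp_all
  have period: "x powi (3 * p * k) = 1" for k
    unfolding x_def zeta_powi zeta_eq_1_iff[OF p] by simp
  show ?thesis
    by (rule mode_periodic_singular[OF x0 x F period])
qed

text \<open>With \<open>(m, n) = \<mu> + \<rho>\<close> the Weyl denominator vanishes if \<open>m\<close>, \<open>n\<close> or \<open>m + n\<close> is divisible by \<open>p\<close>, which in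
the range of \<open>E_set p\<close> leaves \<open>m = p\<close>, \<open>n = p\<close> and \<open>m + n = p\<close>. In the first two cases \<open>\<mu>\<close> has
\<open>\<epsilon> = -1\<close> and \<open>1 + x + 1/x\<close> is positive, in the third \<open>\<epsilon> = 1\<close> and it is negative.\<close>
lemma mode_affine_antisym_E_set:
  assumes p: "p \<ge> 2" and \<mu>: "\<mu> \<in> E_set p"
  shows "affine_antisym (3 * p) (honeycomb_mode.mode (coord1 p \<mu>) (coord2 p \<mu>) (F_fun p \<mu>))"
proof -
  interpret honeycomb_mode "coord1 p \<mu>" "coord2 p \<mu>" "F_fun p \<mu>" by (rule honeycomb_mode_F_fun)
  define m where "m = fst \<mu> + 1"
  define n where "n = snd \<mu> + 1"
  have mn: "\<mu> + \<rho> = (m, n)" by (cases \<mu>) (simp add: m_def n_def weight_simps)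
  have bounds: "1 \<le> m" "m \<le> p" "1 \<le> n" "n \<le> p"
    using \<mu> by (simp_all add: E_set_def ip_\<alpha>\<^sub>1 ip_\<alpha>\<^sub>2 m_def n_def)
  have p0: "p > 0" using p by simp
  have eps: "eps p \<mu> = (if m + n \<le> p then 1 else -1)"
    unfolding eps_def ip_\<theta> of_int_le_iff by (simp add: m_def n_def)
  have coords: "coord1 p \<mu> = zeta p (2 * m + n)" "coord2 p \<mu> = zeta p (m + 2 * n)"
    unfolding mn by (simp_all add: bil_def)
  have p3: "zeta p (3 * p * k) = 1" for k using zeta_eq_1_iff[OF p0] by simp
  consider "m = p" | "n = p" | "m + n = p" | "m < p" "n < p" "m + n \<noteq> p" using bounds by linarith
  then show ?thesis
  proof cases
    case 1
    have Y: "coord2 p \<mu> = coord1 p \<mu> ^ 2"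
      unfolding coords zeta_power using zeta_add[of p "3 * p" "p + 2 * n"] p3[of 1] 1 by (simp add: algebra_simps)
    have "cos (2 * pi * of_int (2 * m + n) / (3 * of_int p)) > - 1 / 2"
      by (rule cos_above) (use bounds p 1 in linarith)+
    moreover have "fund1 = 2 * coord1 p \<mu> + 1 / coord1 p \<mu> ^ 2" "fund2 = 2 / coord1 p \<mu> + coord1 p \<mu> ^ 2"
      unfolding fund1_def fund2_def unfolding Y by (simp_all add: power2_eq_square)
    ultimately show ?thesis
      by (intro mode_affine_antisym_singular[OF p0 coords(1)]) (use bounds 1 in \<open>simp_all add: eps\<close>)
  next
    case 2
    have X: "coord1 p \<mu> = coord2 p \<mu> ^ 2"
      unfolding coords zeta_power using zeta_add[of p "3 * p" "p + 2 * m"] p3[of 1] 2 by (simp add: algebra_simps)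
    have "cos (2 * pi * of_int (m + 2 * n) / (3 * of_int p)) > - 1 / 2"
      by (rule cos_above) (use bounds p 2 in linarith)+
    moreover have "cos (2 * pi * of_int (- (m + 2 * n)) / (3 * of_int p)) = cos (2 * pi * of_int (m + 2 * n) / (3 * of_int p))"
      by (simp only: of_int_minus mult_minus_right minus_divide_left[symmetric] cos_minus)
    moreover have "1 / coord2 p \<mu> = zeta p (- (m + 2 * n))"
      unfolding coords zeta_minus by (simp add: divide_inverse)
    moreover have "fund1 = 2 * (1 / coord2 p \<mu>) + 1 / (1 / coord2 p \<mu>) ^ 2" "fund2 = 2 / (1 / coord2 p \<mu>) + (1 / coord2 p \<mu>) ^ 2"
      unfolding fund1_def fund2_def unfolding X by (simp_all add: power2_eq_square)
    ultimately show ?thesis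
      by (intro mode_affine_antisym_singular[OF p0, where x = "1 / coord2 p \<mu>" and s = "- (m + 2 * n)"])
         (use bounds 2 in \<open>simp_all add: eps\<close>)
  next
    case 3
    have "coord1 p \<mu> * coord2 p \<mu> = 1"
    proof -
      have e: "2 * m + n + (m + 2 * n) = 3 * p * 1" using 3 by linarith
      show ?thesis unfolding coords zeta_add[symmetric] e by (rule p3)
    qed
    then have Y: "coord2 p \<mu> = 1 / coord1 p \<mu>" by (simp add: field_simps)
    have "cos (2 * pi * of_int (2 * m + n) / (3 * of_int p)) < - 1 / 2"
      by (rule cos_below) (use bounds p 3 in linarith)+
    moreover have "fund1 = 2 * coord1 p \<mu> + 1 / coord1 p \<mu> ^ 2" "fund2 = 2 / coord1 p \<mu> + coord1 p \<mu> ^ 2"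
      unfolding fund1_def fund2_def unfolding Y by (simp_all add: power2_eq_square)
    ultimately show ?thesis
      by (intro mode_affine_antisym_singular[OF p0 coords(1)]) (use 3 in \<open>simp_all add: eps\<close>)
  next
    case 4
    have "\<not> p dvd m" "\<not> p dvd n" using 4 bounds by (auto dest: zdvd_imp_le)
    moreover have "\<not> p dvd (m + n)"
    proof
      assume "p dvd (m + n)"
      then have "p dvd (m + n - p)" by simp
      moreover have "m + n - p < p" "- p < m + n - p" "m + n - p \<noteq> 0" using 4 bounds by auto
      ultimately show False by (metis abs_less_iff dvd_imp_le_int minus_less_iff abs_of_pos p0 not_le)
    qed
    ultimately show ?thesis
      by (intro mode_periodic_regular zeta_regular[OF p0 mn] zeta_period[OF p0])
  qed
qed

section \<open>Fusion coefficients\<close>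

context torus_point
begin

lemma alternant_product: "sl3_char \<kappa> * alternant \<tau> = pairing (weight_mult \<kappa>) (\<lambda>\<nu>. alternant (\<nu> + \<tau>))"
proof -
  have "pairing (weight_mult \<kappa>) (\<lambda>\<nu>. alternant (\<nu> + \<tau>)) =
    pairing (weight_mult \<kappa>) (\<lambda>\<nu>. \<Sum>w\<in>weyl. of_int (wdet w) * ev X Y (w \<tau>) * ev X Y (w \<nu>))"
    unfolding alternant_def
    by (intro arg_cong2[where f = pairing] ext sum.cong refl) (simp add: weyl_add ev_add mult.assoc)
  also have "\<dots> = (\<Sum>w\<in>weyl. of_int (wdet w) * ev X Y (w \<tau>) * pairing (weight_mult \<kappa>) (\<lambda>\<nu>. ev X Y (w \<nu>)))"
    by (simp only: pairing_sum[OF finite_weight_mult] pairing_cmult)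
  also have "\<dots> = (\<Sum>w\<in>weyl. of_int (wdet w) * ev X Y (w \<tau>) * sl3_char \<kappa>)"
  proof (intro sum.cong refl)
    fix w assume "w \<in> weyl"
    then have "pairing (weight_mult \<kappa>) (\<lambda>\<nu>. ev X Y (w \<nu>)) = sl3_char \<kappa>"
      unfolding sl3_char_def by (rule pairing_weyl) (simp add: weight_mult_weyl \<open>w \<in> weyl\<close>)
    then show "of_int (wdet w) * ev X Y (w \<tau>) * pairing (weight_mult \<kappa>) (\<lambda>\<nu>. ev X Y (w \<nu>)) =
      of_int (wdet w) * ev X Y (w \<tau>) * sl3_char \<kappa>" by simp
  qed
  finally show ?thesis by (simp add: alternant_def sum_distrib_left mult_ac)
qed

text \<open>Multiply one character by the alternant that is the numerator of the other. The result is a sum of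
alternants over the weights of the first module, and alternants are affinely antisymmetric, so the sum folds
onto the alcove.\<close>
theorem kac_walton:
  assumes h: "h > 0" and period: "\<And>\<beta>. \<beta> \<in> root_lattice \<Longrightarrow> ev X Y (scale h \<beta>) = 1"
    and regular: "alternant \<rho> \<noteq> 0"
  shows "sl3_char \<kappa> * sl3_char \<tau> =
    (\<Sum>\<zeta>\<in>alcove h. of_int (affine_sum h (\<lambda>\<nu>. weight_mult \<kappa> (\<nu> - \<tau>)) \<zeta>) * sl3_char \<zeta>)"
proof -
  have "alternant \<rho> * (sl3_char \<kappa> * sl3_char \<tau>) = sl3_char \<kappa> * alternant \<tau>"
    by (simp only: mult.left_commute[of "alternant \<rho>"] alternant_char)
  also have "\<dots> = pairing (\<lambda>\<nu>. weight_mult \<kappa> (\<nu> - \<tau>)) alternant"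
    unfolding pairing_shift by (rule alternant_product)
  also have "\<dots> = (\<Sum>\<zeta>\<in>alcove h. of_int (affine_sum h (\<lambda>\<nu>. weight_mult \<kappa> (\<nu> - \<tau>)) \<zeta>) * alternant \<zeta>)"
    by (rule fold_onto_alcove[OF h alternant_affine_antisym[OF period] finite_shift[OF finite_weight_mult]])
  also have "\<dots> = alternant \<rho> * (\<Sum>\<zeta>\<in>alcove h. of_int (affine_sum h (\<lambda>\<nu>. weight_mult \<kappa> (\<nu> - \<tau>)) \<zeta>) * sl3_char \<zeta>)"
    unfolding sum_distrib_left mult.left_commute[of "alternant \<rho>"] alternant_char by (rule refl)
  finally show ?thesis using regular by simp
qed

end

definition alt_matrix :: "int \<Rightarrow> weight \<Rightarrow> weight \<Rightarrow> complex" where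
  "alt_matrix h \<kappa> \<mu> = (\<Sum>w\<in>weyl. of_int (wdet w) * zeta h (bil (w \<kappa>) \<mu>))"

lemma alternant_alt_matrix:
  "torus_point.alternant (coord1 h \<mu>) (coord2 h \<mu>) \<kappa> = alt_matrix h \<kappa> (\<mu> + \<rho>)"
  unfolding torus_point.alternant_def[OF torus_point_zeta] ev_zeta alt_matrix_def ..

lemma bil_sym: "bil \<kappa> \<mu> = bil \<mu> \<kappa>"
  by (simp add: bil_def algebra_simps)

lemma bil_weyl:
  assumes "w \<in> weyl"
  shows "bil (w \<kappa>) (w \<mu>) = bil \<kappa> \<mu>"
proof -
  have s: "bil (s\<^sub>1 \<kappa>) (s\<^sub>1 \<mu>) = bil \<kappa> \<mu>" "bil (s\<^sub>2 \<kappa>) (s\<^sub>2 \<mu>) = bil \<kappa> \<mu>" for \<kappa> \<mu>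
    by (cases \<kappa>; cases \<mu>; simp add: bil_def s1_pair s2_pair algebra_simps)+
  from assms show ?thesis by (induction rule: weyl_induct) (simp_all add: s)
qed

lemma alt_matrix_sym: "alt_matrix h \<kappa> \<mu> = alt_matrix h \<mu> \<kappa>"
proof -
  have "alt_matrix h \<mu> \<kappa> = (\<Sum>w\<in>weyl. of_int (wdet (inv w)) * zeta h (bil (inv w \<mu>) \<kappa>))"
    unfolding alt_matrix_def by (rule sum_weyl_inv[symmetric])
  also have "\<dots> = alt_matrix h \<kappa> \<mu>"
    unfolding alt_matrix_def
  proof (intro sum.cong refl)
    fix w assume w: "w \<in> weyl"
    have "bil (inv w \<mu>) \<kappa> = bil (w (inv w \<mu>)) (w \<kappa>)" by (rule bil_weyl[OF w, symmetric])
    also have "\<dots> = bil (w \<kappa>) \<mu>" using w by (simp add: bil_sym)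
    finally show "of_int (wdet (inv w)) * zeta h (bil (inv w \<mu>) \<kappa>) = of_int (wdet w) * zeta h (bil (w \<kappa>) \<mu>)"
      by (simp add: wdet_inv w)
  qed
  finally show ?thesis ..
qed

lemma alt_matrix_affine_antisym:
  assumes h: "h > 0"
  shows "affine_antisym h (\<lambda>\<kappa>. alt_matrix h \<kappa> \<mu>)"
proof -
  interpret torus_point "coord1 h (\<mu> - \<rho>)" "coord2 h (\<mu> - \<rho>)" by (rule torus_point_zeta)
  have "affine_antisym h alternant" by (rule alternant_affine_antisym[OF zeta_period[OF h]])
  then show ?thesis unfolding alternant_alt_matrix by simp
qed

lemma zeta_geometric:
  assumes h: "h > 0"
  shows "(\<Sum>c<nat (3 * h). zeta h (int c * s)) = (if 3 * h dvd s then of_int (3 * h) else 0)"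
proof -
  have "(\<Sum>c<nat (3 * h). zeta h (int c * s)) = (\<Sum>c<nat (3 * h). zeta h s ^ c)"
    by (simp add: zeta_power)
  also have "\<dots> = (if 3 * h dvd s then of_int (3 * h) else 0)"
  proof (cases "3 * h dvd s")
    case True
    then have "zeta h s = 1" by (simp only: zeta_eq_1_iff[OF h])
    then show ?thesis using True h by simp
  next
    case False
    then have "zeta h s \<noteq> 1" by (simp only: zeta_eq_1_iff[OF h] simp_thms)
    moreover have "zeta h s ^ nat (3 * h) = 1"
      unfolding zeta_power zeta_eq_1_iff[OF h] using h by simp
    ultimately show ?thesis using False by (simp add: geometric_sum)
  qed
  finally show ?thesis .
qed

lemma zeta_orthogonality:
  assumes h: "h > 0"
  shows "(\<Sum>c<nat (3 * h). \<Sum>d<nat (3 * h). zeta h (bil \<kappa> (int c, int d))) =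
    (if \<exists>\<beta>\<in>root_lattice. \<kappa> = scale h \<beta> then of_int (9 * h ^ 2) else 0)"
proof -
  obtain a b where ab: "\<kappa> = (a, b)" by (cases \<kappa>)
  have iff: "(\<exists>\<beta>\<in>root_lattice. \<kappa> = scale h \<beta>) \<longleftrightarrow> 3 * h dvd (2 * a + b) \<and> 3 * h dvd (a + 2 * b)"
  proof
    assume "\<exists>\<beta>\<in>root_lattice. \<kappa> = scale h \<beta>"
    then obtain \<beta> where \<beta>: "\<beta> \<in> root_lattice" "\<kappa> = scale h \<beta>" by blast
    obtain m n where "\<beta> = (2 * m - n, 2 * n - m)" using \<beta>(1) by (rule root_lattice_coords)
    then have "2 * a + b = 3 * h * m" "a + 2 * b = 3 * h * n"
      using \<beta>(2) by (simp_all add: ab scale_def algebra_simps)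
    then show "3 * h dvd (2 * a + b) \<and> 3 * h dvd (a + 2 * b)" by simp
  next
    assume "3 * h dvd (2 * a + b) \<and> 3 * h dvd (a + 2 * b)"
    then obtain m n where mn: "2 * a + b = 3 * h * m" "a + 2 * b = 3 * h * n" by (elim conjE dvdE)
    define M where "M = h * m"
    define N where "N = h * n"
    have "2 * a + b = 3 * M" "a + 2 * b = 3 * N" using mn by (simp_all add: M_def N_def)
    then have "a = 2 * M - N" "b = 2 * N - M" by linarith+
    then have "\<kappa> = scale h (2 * m - n, 2 * n - m)" by (simp add: ab scale_def M_def N_def algebra_simps)
    moreover have "(2 * m - n, 2 * n - m) \<in> root_lattice" unfolding root_lattice_iff by presburger
    ultimately show "\<exists>\<beta>\<in>root_lattice. \<kappa> = scale h \<beta>" by blast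
  qed
  have "bil \<kappa> (int c, int d) = int c * (2 * a + b) + int d * (a + 2 * b)" for c d
    by (simp add: bil_def ab algebra_simps)
  then have "(\<Sum>c<nat (3 * h). \<Sum>d<nat (3 * h). zeta h (bil \<kappa> (int c, int d))) =
    (\<Sum>c<nat (3 * h). zeta h (int c * (2 * a + b))) * (\<Sum>d<nat (3 * h). zeta h (int d * (a + 2 * b)))"
    by (simp add: zeta_add sum_product)
  then show ?thesis
    unfolding zeta_geometric[OF h] iff by (simp add: power2_eq_square)
qed

text \<open>The transform of \<open>D\<close> is an affinely antisymmetric function of \<open>\<mu>\<close> which vanishes on the alcove, hence
everywhere. Fourier inversion over the box of side \<open>3 h\<close>, a multiple of the period of
all exponentials involved, recovers \<open>D\<close>; the point \<open>\<zeta>0\<close> receives a contribution only from itself since the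
alcove is a fundamental domain.\<close>
lemma alt_matrix_injective:
  assumes h: "h > 0"
    and zero: "\<And>\<mu>. \<mu> \<in> alcove h \<Longrightarrow> (\<Sum>\<zeta>\<in>alcove h. D \<zeta> * alt_matrix h \<zeta> \<mu>) = 0"
    and \<zeta>0: "\<zeta>0 \<in> alcove h"
  shows "D \<zeta>0 = 0"
proof -
  define \<Psi> where "\<Psi> = (\<lambda>\<mu>. \<Sum>\<zeta>\<in>alcove h. D \<zeta> * alt_matrix h \<zeta> \<mu>)"
  have anti: "affine_antisym h (\<lambda>\<mu>. alt_matrix h \<zeta> \<mu>)" for \<zeta>
    using alt_matrix_affine_antisym[OF h, of \<zeta>] by (simp only: alt_matrix_sym[of h \<zeta>])
  have "affine_antisym h \<Psi>"
    unfolding affine_antisym_def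
  proof (intro conjI ballI allI)
    fix w \<mu> assume "w \<in> weyl"
    then have "alt_matrix h \<zeta> (w \<mu>) = of_int (wdet w) * alt_matrix h \<zeta> \<mu>" for \<zeta>
      using anti[of \<zeta>] unfolding affine_antisym_def by blast
    then show "\<Psi> (w \<mu>) = of_int (wdet w) * \<Psi> \<mu>"
      unfolding \<Psi>_def by (simp add: sum_distrib_left mult_ac)
  next
    fix \<beta> \<mu> assume "\<beta> \<in> root_lattice"
    then have "alt_matrix h \<zeta> (\<mu> + scale h \<beta>) = alt_matrix h \<zeta> \<mu>" for \<zeta>
      using anti[of \<zeta>] unfolding affine_antisym_def by blast
    then show "\<Psi> (\<mu> + scale h \<beta>) = \<Psi> \<mu>" unfolding \<Psi>_def by simp
  qed
  note \<Psi> = this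
  have vanish: "\<Psi> \<mu> = 0" for \<mu>
  proof (cases "\<exists>w\<in>weyl. \<exists>\<beta>\<in>root_lattice. \<exists>\<zeta>\<in>alcove h. \<mu> = w \<zeta> + scale h \<beta>")
    case True
    then obtain w \<beta> \<zeta> where w: "w \<in> weyl" "\<beta> \<in> root_lattice" "\<zeta> \<in> alcove h" "\<mu> = w \<zeta> + scale h \<beta>" by blast
    have "\<Psi> \<zeta> = 0" unfolding \<Psi>_def by (rule zero[OF w(3)])
    then show ?thesis unfolding w(4) affine_antisym_orbit[OF \<Psi> w(1,2)] by simp
  next
    case False
    then show ?thesis by (intro affine_antisym_zero[OF h \<Psi>]) blast
  qed
  let ?box = "{..<nat (3 * h)}"
  have orth: "(\<Sum>c\<in>?box. \<Sum>d\<in>?box. zeta h (- bil \<zeta>0 (int c, int d)) * alt_matrix h \<zeta> (int c, int d)) =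
      (if \<zeta> = \<zeta>0 then of_int (9 * h ^ 2) else 0)" if \<zeta>: "\<zeta> \<in> alcove h" for \<zeta>
  proof -
    have "(\<Sum>c\<in>?box. \<Sum>d\<in>?box. zeta h (- bil \<zeta>0 (int c, int d)) * alt_matrix h \<zeta> (int c, int d)) =
      (\<Sum>c\<in>?box. \<Sum>d\<in>?box. \<Sum>w\<in>weyl. of_int (wdet w) * zeta h (bil (w \<zeta> - \<zeta>0) (int c, int d)))"
    proof (intro sum.cong refl)
      fix c d
      have "bil (w \<zeta> - \<zeta>0) (int c, int d) = - bil \<zeta>0 (int c, int d) + bil (w \<zeta>) (int c, int d)" for w
        by (simp add: bil_def algebra_simps)
      then show "zeta h (- bil \<zeta>0 (int c, int d)) * alt_matrix h \<zeta> (int c, int d) =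
          (\<Sum>w\<in>weyl. of_int (wdet w) * zeta h (bil (w \<zeta> - \<zeta>0) (int c, int d)))"
        by (simp only: alt_matrix_def zeta_add sum_distrib_left mult.left_commute)
    qed
    also have "\<dots> = (\<Sum>c\<in>?box. \<Sum>w\<in>weyl. \<Sum>d\<in>?box. of_int (wdet w) * zeta h (bil (w \<zeta> - \<zeta>0) (int c, int d)))"
      by (intro sum.cong refl) (rule sum.swap)
    also have "\<dots> = (\<Sum>w\<in>weyl. \<Sum>c\<in>?box. \<Sum>d\<in>?box. of_int (wdet w) * zeta h (bil (w \<zeta> - \<zeta>0) (int c, int d)))"
      by (rule sum.swap)
    also have "\<dots> = (\<Sum>w\<in>weyl. of_int (wdet w) *
        (\<Sum>c\<in>?box. \<Sum>d\<in>?box. zeta h (bil (w \<zeta> - \<zeta>0) (int c, int d))))"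
      by (simp only: sum_distrib_left)
    also have "\<dots> = (\<Sum>w\<in>weyl. if w = id then (if \<zeta> = \<zeta>0 then of_int (9 * h ^ 2) else 0) else 0)"
    proof (intro sum.cong refl)
      fix w assume w: "w \<in> weyl"
      have iff: "(\<exists>\<beta>\<in>root_lattice. w \<zeta> - \<zeta>0 = scale h \<beta>) \<longleftrightarrow> w = id \<and> \<zeta> = \<zeta>0"
      proof
        assume "\<exists>\<beta>\<in>root_lattice. w \<zeta> - \<zeta>0 = scale h \<beta>"
        then obtain \<beta> where \<beta>: "\<beta> \<in> root_lattice" "w \<zeta> - \<zeta>0 = scale h \<beta>" by blast
        have "scale h (- \<beta>) = - scale h \<beta>" by (cases \<beta>) (simp add: scale_def)
        then have "\<zeta>0 = w \<zeta> + scale h (- \<beta>)" using \<beta>(2) by (simp add: algebra_simps)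
        moreover from this have "w = id \<and> - \<beta> = 0"
          using alcove_fundamental[OF h w root_lattice_minus[OF \<beta>(1)] \<zeta>] \<zeta>0 by simp
        moreover have "scale h 0 = 0" by (simp add: scale_def zero_prod_def)
        ultimately show "w = id \<and> \<zeta> = \<zeta>0" by simp
      next
        assume *: "w = id \<and> \<zeta> = \<zeta>0"
        have "scale h 0 = 0" "0 \<in> root_lattice" by (simp_all add: scale_def zero_prod_def root_lattice_iff)
        then show "\<exists>\<beta>\<in>root_lattice. w \<zeta> - \<zeta>0 = scale h \<beta>" using * by (intro bexI[of _ 0]) simp_all
      qed
      show "of_int (wdet w) * (\<Sum>c\<in>?box. \<Sum>d\<in>?box. zeta h (bil (w \<zeta> - \<zeta>0) (int c, int d))) =
          (if w = id then (if \<zeta> = \<zeta>0 then of_int (9 * h ^ 2) else 0) else 0)"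
        unfolding zeta_orthogonality[OF h] iff by (cases "w = id") (simp_all add: wdet_weyl(1))
    qed
    also have "\<dots> = (if \<zeta> = \<zeta>0 then of_int (9 * h ^ 2) else 0)" by (simp add: sum.delta)
    finally show ?thesis .
  qed
  have "0 = (\<Sum>c\<in>?box. \<Sum>d\<in>?box. zeta h (- bil \<zeta>0 (int c, int d)) * \<Psi> (int c, int d))"
    by (simp add: vanish)
  also have "\<dots> = (\<Sum>c\<in>?box. \<Sum>d\<in>?box. \<Sum>\<zeta>\<in>alcove h.
      D \<zeta> * (zeta h (- bil \<zeta>0 (int c, int d)) * alt_matrix h \<zeta> (int c, int d)))"
    unfolding \<Psi>_def by (simp only: sum_distrib_left mult.left_commute)
  also have "\<dots> = (\<Sum>c\<in>?box. \<Sum>\<zeta>\<in>alcove h. \<Sum>d\<in>?box.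
      D \<zeta> * (zeta h (- bil \<zeta>0 (int c, int d)) * alt_matrix h \<zeta> (int c, int d)))"
    by (intro sum.cong refl) (rule sum.swap)
  also have "\<dots> = (\<Sum>\<zeta>\<in>alcove h. \<Sum>c\<in>?box. \<Sum>d\<in>?box.
      D \<zeta> * (zeta h (- bil \<zeta>0 (int c, int d)) * alt_matrix h \<zeta> (int c, int d)))"
    by (rule sum.swap)
  also have "\<dots> = (\<Sum>\<zeta>\<in>alcove h. D \<zeta> * (if \<zeta> = \<zeta>0 then of_int (9 * h ^ 2) else 0))"
    by (simp only: sum_distrib_left[symmetric]) (intro sum.cong refl, simp only: orth)
  also have "\<dots> = D \<zeta>0 * of_int (9 * h ^ 2)"
    using \<zeta>0 by (simp add: if_distrib[of "\<lambda>x. _ * x"] sum.delta cong: if_cong)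
  finally show ?thesis using h by simp
qed

lemma dominant_level_alcove: "\<sigma> \<in> dominant_level (h - 3) \<longleftrightarrow> \<sigma> + \<rho> \<in> alcove h"
proof -
  obtain a b where ab: "\<sigma> = (a, b)" by (cases \<sigma>)
  have "ip \<sigma> \<theta> \<le> of_int (h - 3) \<longleftrightarrow> a + b \<le> h - 3" unfolding ip_\<theta> of_int_le_iff by (simp add: ab)
  then show ?thesis
    unfolding dominant_level_def dominant_def ip_\<alpha>\<^sub>1 ip_\<alpha>\<^sub>2 by (auto simp: ab weight_simps alcove_iff)
qed

lemma sum_dominant_level:
  "(\<Sum>\<sigma>\<in>dominant_level (h - 3). f (\<sigma> + \<rho>)) = (\<Sum>\<zeta>\<in>alcove h. f \<zeta>)"
  by (rule sum.reindex_bij_witness[of _ "\<lambda>\<zeta>. \<zeta> - \<rho>" "\<lambda>\<sigma>. \<sigma> + \<rho>"]) (auto simp: dominant_level_alcove)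

lemma alcove_regular:
  assumes h: "h > 0" and \<mu>: "\<mu> + \<rho> \<in> alcove h"
  shows "torus_point.alternant (coord1 h \<mu>) (coord2 h \<mu>) \<rho> \<noteq> 0"
proof -
  obtain m n where mn: "\<mu> + \<rho> = (m, n)" by (cases "\<mu> + \<rho>")
  have "0 < m" "0 < n" "m + n < h" using \<mu> unfolding mn alcove_iff by simp_all
  then show ?thesis by (intro zeta_regular[OF h mn]) (auto dest: zdvd_imp_le)
qed

text \<open>The Kac--Walton coefficients satisfy the defining equations. Two solutions differ by a
vector in the kernel of the matrix of alternants, because the Weyl denominator does not vanish on the alcove.\<close>
theorem fusion_eq:
  assumes h: "h > 0" and \<zeta>: "\<zeta> + \<rho> \<in> alcove h"
  shows "fusion h \<xi> \<nu> \<zeta> = of_int (affine_sum h (\<lambda>\<kappa>. weight_mult (\<xi> + \<rho>) (\<kappa> - (\<nu> + \<rho>))) (\<zeta> + \<rho>))"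
proof -
  define K where "K = (\<lambda>\<kappa>. of_int (affine_sum h (\<lambda>\<kappa>. weight_mult (\<xi> + \<rho>) (\<kappa> - (\<nu> + \<rho>))) \<kappa>) :: complex)"
  define N where "N = (\<lambda>\<sigma>. if \<sigma> \<in> dominant_level (h - 3) then K (\<sigma> + \<rho>) else 0)"
  have product: "chibar h \<xi> \<mu> * chibar h \<nu> \<mu> = (\<Sum>\<sigma>\<in>dominant_level (h - 3). K (\<sigma> + \<rho>) * chibar h \<sigma> \<mu>)"
    if \<mu>: "\<mu> \<in> dominant_level (h - 3)" for \<mu>
  proof -
    interpret torus_point "coord1 h \<mu>" "coord2 h \<mu>" by (rule torus_point_zeta)
    have regular: "alternant \<rho> \<noteq> 0" by (rule alcove_regular[OF h \<mu>[unfolded dominant_level_alcove]])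
    have fold: "(\<Sum>\<sigma>\<in>dominant_level (h - 3). K (\<sigma> + \<rho>) * chibar h \<sigma> \<mu>) = (\<Sum>\<zeta>\<in>alcove h. K \<zeta> * sl3_char \<zeta>)"
      unfolding chibar_eq by (rule sum_dominant_level)
    show ?thesis
      unfolding fold unfolding chibar_eq K_def
      by (rule kac_walton[OF h _ regular]) (rule zeta_period[OF h])
  qed
  have "fusion h \<xi> \<nu> = N"
    unfolding fusion_def
  proof (rule the_equality)
    show "(\<forall>\<sigma>. \<sigma> \<notin> dominant_level (h - 3) \<longrightarrow> N \<sigma> = 0) \<and>
      (\<forall>\<mu>\<in>dominant_level (h - 3). chibar h \<xi> \<mu> * chibar h \<nu> \<mu> = (\<Sum>\<sigma>\<in>dominant_level (h - 3). N \<sigma> * chibar h \<sigma> \<mu>))"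
      using product by (simp add: N_def)
  next
    fix N' assume N': "(\<forall>\<sigma>. \<sigma> \<notin> dominant_level (h - 3) \<longrightarrow> N' \<sigma> = 0) \<and>
      (\<forall>\<mu>\<in>dominant_level (h - 3). chibar h \<xi> \<mu> * chibar h \<nu> \<mu> = (\<Sum>\<sigma>\<in>dominant_level (h - 3). N' \<sigma> * chibar h \<sigma> \<mu>))"
    define D where "D = (\<lambda>\<zeta>. N' (\<zeta> - \<rho>) - K \<zeta>)"
    have "D \<zeta> = 0" if "\<zeta> \<in> alcove h" for \<zeta>
    proof (rule alt_matrix_injective[OF h _ that])
      fix \<mu> assume \<mu>: "\<mu> \<in> alcove h"
      define \<mu>' where "\<mu>' = \<mu> - \<rho>"
      have dom: "\<mu>' \<in> dominant_level (h - 3)" unfolding dominant_level_alcove by (simp add: \<mu>'_def \<mu>)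
      interpret torus_point "coord1 h \<mu>'" "coord2 h \<mu>'" by (rule torus_point_zeta)
      have "(\<Sum>\<sigma>\<in>dominant_level (h - 3). N' \<sigma> * chibar h \<sigma> \<mu>') = (\<Sum>\<sigma>\<in>dominant_level (h - 3). K (\<sigma> + \<rho>) * chibar h \<sigma> \<mu>')"
        using N' product[OF dom] dom by simp
      then have "0 = (\<Sum>\<sigma>\<in>dominant_level (h - 3). D (\<sigma> + \<rho>) * sl3_char (\<sigma> + \<rho>))"
        by (simp add: D_def left_diff_distrib sum_subtractf chibar_eq)
      also have "\<dots> = (\<Sum>\<zeta>\<in>alcove h. D \<zeta> * sl3_char \<zeta>)" by (rule sum_dominant_level)
      finally have "0 = alternant \<rho> * (\<Sum>\<zeta>\<in>alcove h. D \<zeta> * sl3_char \<zeta>)" by simp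
      also have "\<dots> = (\<Sum>\<zeta>\<in>alcove h. D \<zeta> * alternant \<zeta>)"
        by (simp only: sum_distrib_left mult.left_commute[of "alternant \<rho>"] alternant_char)
      finally show "(\<Sum>\<zeta>\<in>alcove h. D \<zeta> * alt_matrix h \<zeta> \<mu>) = 0"
        unfolding alternant_alt_matrix by (simp add: \<mu>'_def)
    qed
    note D = this
    have "N' \<sigma> = K (\<sigma> + \<rho>)" if "\<sigma> \<in> dominant_level (h - 3)" for \<sigma>
      using D[OF that[unfolded dominant_level_alcove]] by (simp add: D_def)
    then show "N' = N" using N' by (auto simp: N_def fun_eq_iff)
  qed
  then show ?thesis using \<zeta> by (simp add: N_def K_def dominant_level_alcove)
qed

section \<open>The quantised characters and their structure constants\<close>

text \<open>Convolution gives the product of two values of the eigenfunction as a sum over the whole weight lattice; folding it onto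
the alcove of level \<open>3 p\<close> and discarding the points outside the honeycomb leaves the barycentres of
\<open>W_plus_p p\<close>.\<close>
lemma chi_product:
  assumes p: "p \<ge> 2" and x: "x \<in> W_plus_p p" and y: "y \<in> W_plus_p p" and \<mu>: "\<mu> \<in> E_set p"
  shows "chi p x \<mu> * chi p y \<mu> = (\<Sum>z\<in>W_plus_p p. of_int (Np_coeff p x y z) * chi p z \<mu>)"
proof -
  interpret honeycomb_mode "coord1 p \<mu>" "coord2 p \<mu>" "F_fun p \<mu>" by (rule honeycomb_mode_F_fun)
  have aff: "z \<in> affine_weyl" if "z \<in> W_plus_p p" for z using that by (simp add: W_plus_p_def)
  have chi: "chi p z \<mu> = mode (center z)" if "z \<in> W_plus_p p" for z
    by (rule chi_eq_mode[OF aff[OF that] honeycomb_mode_F_fun])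
  have "chi p x \<mu> * chi p y \<mu> = mode (center x) * mode (center y)" by (simp only: chi x y)
  also have "\<dots> = pairing (weight_mult (center x)) (\<lambda>\<eta>. mode (center y + \<eta>))"
    by (rule mode_product[symmetric]; rule center_honeycomb; rule aff; fact)
  also have "\<dots> = pairing (fusion_weight x y) mode"
    unfolding fusion_weight_def pairing_shift by (simp add: add.commute)
  also have "\<dots> = (\<Sum>\<zeta>\<in>alcove (3 * p). of_int (affine_sum (3 * p) (fusion_weight x y) \<zeta>) * mode \<zeta>)"
    by (rule fold_onto_alcove[OF _ mode_affine_antisym_E_set[OF p \<mu>] finite_fusion_weight]) (use p in simp)
  also have "\<dots> = (\<Sum>\<zeta>\<in>alcove (3 * p) \<inter> honeycomb. of_int (affine_sum (3 * p) (fusion_weight x y) \<zeta>) * mode \<zeta>)"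
    by (rule sum.mono_neutral_right) (auto simp: mode_outside)
  also have "\<dots> = (\<Sum>z\<in>W_plus_p p. of_int (affine_sum (3 * p) (fusion_weight x y) (center z)) * mode (center z))"
    by (rule sum.reindex_bij_betw[OF W_plus_p_bij, symmetric])
  also have "\<dots> = (\<Sum>z\<in>W_plus_p p. of_int (Np_coeff p x y z) * chi p z \<mu>)"
  proof (intro sum.cong refl)
    fix z assume z: "z \<in> W_plus_p p"
    have p0: "p \<noteq> 0" using p by simp
    show "of_int (affine_sum (3 * p) (fusion_weight x y) (center z)) * mode (center z) =
        of_int (Np_coeff p x y z) * chi p z \<mu>"
      by (simp only: Np_coeff_eq(2)[OF p0 aff[OF z] aff[OF y]] chi[OF z])
  qed
  finally show ?thesis .
qed

theorem proposition6p1: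
  fixes p :: int
  assumes "p \<ge> 2" and "\<not> 3 dvd p"
  shows
    "(\<forall>x \<in> W_plus_p p. \<forall>y \<in> W_plus_p p. \<forall>\<mu> \<in> E_set p.
        chi p x \<mu> * chi p y \<mu> = (\<Sum>z\<in>W_plus_p p. of_int (Np_coeff p x y z) * chi p z \<mu>)) \<and>
     (\<forall>x \<in> W_plus_p p. \<forall>y \<in> W_plus_p p. \<forall>z \<in> W_plus_p p.
        finite {w' \<in> KW_group p z. wdet (horiz w') * m_coeff x (w' \<circ> z \<circ> inv y) \<noteq> 0} \<and>
        finite {w \<in> W_sub p. wdet (horiz w) * m_coeff x (z \<circ> w \<circ> inv y) \<noteq> 0} \<and>
        finite {w \<in> W_sub p. wdet (horiz w) * N_coeff x y (z \<circ> w) \<noteq> 0} \<and>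
        Np_coeff p x y z = (\<Sum>\<^sub>\<infinity>w\<in>W_sub p. wdet (horiz w) * m_coeff x (z \<circ> w \<circ> inv y)) \<and>
        Np_coeff p x y z = (\<Sum>\<^sub>\<infinity>w\<in>W_sub p. wdet (horiz w) * N_coeff x y (z \<circ> w)) \<and>
        of_int (Np_coeff p x y z) = fusion (3 * p) (iota x) (iota y) (iota z))"
proof (intro conjI ballI)
  fix x y \<mu> assume "x \<in> W_plus_p p" "y \<in> W_plus_p p" "\<mu> \<in> E_set p"
  then show "chi p x \<mu> * chi p y \<mu> = (\<Sum>z\<in>W_plus_p p. of_int (Np_coeff p x y z) * chi p z \<mu>)"
    by (rule chi_product[OF assms(1)])
next
  fix x y z assume xyz: "x \<in> W_plus_p p" "y \<in> W_plus_p p" "z \<in> W_plus_p p"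
  have p0: "p \<noteq> 0" and p3: "3 * p > 0" using assms(1) by simp_all
  have z: "z \<in> affine_weyl" and y: "y \<in> affine_weyl" using xyz by (simp_all add: W_plus_p_def)
  show "finite {w' \<in> KW_group p z. wdet (horiz w') * m_coeff x (w' \<circ> z \<circ> inv y) \<noteq> 0}"
    by (rule Np_coeff_eq(1)[OF p0 z y])
  show "finite {w \<in> W_sub p. wdet (horiz w) * m_coeff x (z \<circ> w \<circ> inv y) \<noteq> 0}"
    by (rule W_sub_sum(1)[OF p0 z y])
  show "finite {w \<in> W_sub p. wdet (horiz w) * N_coeff x y (z \<circ> w) \<noteq> 0}"
    by (rule N_coeff_sum(1)[OF p0 z y])
  show first: "Np_coeff p x y z = (\<Sum>\<^sub>\<infinity>w\<in>W_sub p. wdet (horiz w) * m_coeff x (z \<circ> w \<circ> inv y))"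
    unfolding Np_coeff_eq(2)[OF p0 z y] by (rule W_sub_sum(2)[OF p0 z y, symmetric])
  show "Np_coeff p x y z = (\<Sum>\<^sub>\<infinity>w\<in>W_sub p. wdet (horiz w) * N_coeff x y (z \<circ> w))"
    unfolding first by (rule N_coeff_sum(2)[OF p0 z y, symmetric])
  have "iota z + \<rho> \<in> alcove (3 * p)"
    using W_plus_iff(2)[OF z, of p] xyz(3) by (simp add: center_def)
  from fusion_eq[OF p3 this]
  show "of_int (Np_coeff p x y z) = fusion (3 * p) (iota x) (iota y) (iota z)"
    unfolding Np_coeff_eq(2)[OF p0 z y] fusion_weight_def center_def by simp
qed

end
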